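(* Let $M$ be a $2n$-dimensional manifold endowed with an almost biparacomplex structure $(F,P)$ and let $\nabla$ be its canonical connection. Then the following three conditions are equivalent: (i) $T=0$ and $R=0$, where $T$ and $R$ are the torsion and curvature tensor fields of $\nabla$ (i.e. the canonical connection is locally flat); (ii) for every point $x\in M$ there exist an open neighbourhood $U$ of $x$ and local coordinates $(x_1,\ldots,x_n,y_1,\ldots,y_n)$ on $U$ such that, for all $i=1,\ldots,n$, $$F\left(\frac{\partial}{\partial x_i}\right)=\frac{\partial}{\partial y_i},\quad F\left(\frac{\partial}{\partial y_i}\right)=\frac{\partial}{\partial x_i},\quad P\left(\frac{\partial}{\partial x_i}\right)=\frac{\partial}{\partial x_i},\quad P\left(\frac{\partial}{\partial y_i}\right)=-\frac{\partial}{\partial y_i};$$ (iii) the $\Delta GL(n;\mathbb{R})$-structure on $M$ defined by $(F,P)$ is integrable.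
   Context: Manifolds and tensor fields are $C^\infty$. An almost biparacomplex structure on $M$ is a pair $(F,P)$ of tensor fields of type $(1,1)$ with $F^2=P^2=\mathrm{Id}$ and $F\circ P+P\circ F=0$. Put $T_F^{\pm}(M)=\ker(F\mp\mathrm{Id})$; both have rank $n$ when $\dim M=2n$. The canonical connection of $(F,P)$ is the unique linear connection $\nabla$ on $M$ such that $\nabla F=0=\nabla P$ and $T(X,Y)=0$ for all $X\in T_F^+(M)$, $Y\in T_F^-(M)$, where $T$ is the torsion of $\nabla$. $\Delta GL(n;\mathbb{R})=\left\{\begin{pmatrix}A&0\\0&A\end{pmatrix}: A\in GL(n;\mathbb{R})\right\}\subset GL(2n;\mathbb{R})$. The $\Delta GL(n;\mathbb{R})$-structure defined by $(F,P)$ is the subbundle $\mathcal{B}$ of the bundle of linear frames of $M$ consisting of the adapted frames $(X_1,\ldots,X_n,Y_1,\ldots,Y_n)$ at points $x\in M$, i.e. those with $\{X_1,\ldots,X_n\}$ a basis of $T_F^+(M)$ at $x$ and $Y_i=PX_i$. A $G$-structure $\mathcal{B}$ is integrable if around every point of $M$ there are local coordinates whose coordinate frame is a local section of $\mathcal{B}$. *)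

theory Defs
  imports "HOL-Analysis.Analysis" "HOL-Library.Function_Algebras"
begin

text \<open>Pointwise operations on functions (real functions, tangent vectors, vector fields)
  are those of \<^theory>\<open>HOL-Library.Function_Algebras\<close>.\<close>


section \<open>Smooth manifolds\<close>

text \<open>Meant for open \<open>S\<close> in a finite-dimensional space, where it is the usual notion of being
  \<open>k\<close> times continuously differentiable on \<open>S\<close>.\<close>

primrec Ck_on :: "nat \<Rightarrow> 'a::euclidean_space set \<Rightarrow> ('a \<Rightarrow> 'b::real_normed_vector) \<Rightarrow> bool" where
  "Ck_on 0 S f \<longleftrightarrow> continuous_on S f"
| "Ck_on (Suc k) S f \<longleftrightarrow>
     (\<forall>x\<in>S. f differentiable (at x)) \<and> (\<forall>v. Ck_on k S (\<lambda>x. frechet_derivative f (at x) v))"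

definition smooth_on :: "'a::euclidean_space set \<Rightarrow> ('a \<Rightarrow> 'b::real_normed_vector) \<Rightarrow> bool" where
  "smooth_on S f \<longleftrightarrow> (\<forall>k. Ck_on k S f)"

type_synonym ('a, 'e) atlas = "('a set \<times> ('a \<Rightarrow> 'e)) set"

definition chart_on :: "'a::topological_space set \<Rightarrow> ('a \<Rightarrow> 'e::euclidean_space) \<Rightarrow> bool" where
  "chart_on U \<phi> \<longleftrightarrow> open U \<and> open (\<phi> ` U) \<and> homeomorphism U (\<phi> ` U) \<phi> (inv_into U \<phi>)"

definition compatible ::
    "'a::topological_space set \<Rightarrow> ('a \<Rightarrow> 'e::euclidean_space) \<Rightarrow> 'a set \<Rightarrow> ('a \<Rightarrow> 'e) \<Rightarrow> bool" where
  "compatible U \<phi> V \<psi> \<longleftrightarrow>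
     smooth_on (\<phi> ` (U \<inter> V)) (\<psi> \<circ> inv_into U \<phi>) \<and> smooth_on (\<psi> ` (U \<inter> V)) (\<phi> \<circ> inv_into V \<psi>)"

text \<open>\<open>A\<close> is a maximal smooth atlas on the whole type \<open>'a\<close>, so that its members are exactly the
  local coordinate systems of the manifold. The dimension is that of the model space \<open>'e\<close>; the
  Hausdorff property and second countability are left to the type class of \<open>'a\<close>.\<close>

definition smooth_structure :: "('a::topological_space, 'e::euclidean_space) atlas \<Rightarrow> bool" where
  "smooth_structure A \<longleftrightarrow>
     (\<forall>(U, \<phi>)\<in>A. chart_on U \<phi>) \<and>
     (\<forall>p. \<exists>(U, \<phi>)\<in>A. p \<in> U) \<and>
     (\<forall>(U, \<phi>)\<in>A. \<forall>(V, \<psi>)\<in>A. compatible U \<phi> V \<psi>) \<and>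
     (\<forall>U \<phi>. chart_on U \<phi> \<and> (\<forall>(V, \<psi>)\<in>A. compatible U \<phi> V \<psi>) \<longrightarrow> (U, \<phi>) \<in> A)"

definition smooth_funs :: "('a::topological_space, 'e::euclidean_space) atlas \<Rightarrow> ('a \<Rightarrow> real) set" where
  "smooth_funs A = {f. \<forall>(U, \<phi>)\<in>A. smooth_on (\<phi> ` U) (f \<circ> inv_into U \<phi>)}"


section \<open>Tangent vectors and vector fields\<close>

text \<open>Tangent vectors are derivations of the algebra of smooth functions. They are set to \<open>0\<close> on
  functions that are not smooth, so that equality of tangent vectors is equality in HOL.\<close>

type_synonym 'a tvec = "('a \<Rightarrow> real) \<Rightarrow> real"
type_synonym 'a vfield = "'a \<Rightarrow> 'a tvec"

definition tangent_space ::
    "('a::topological_space, 'e::euclidean_space) atlas \<Rightarrow> 'a \<Rightarrow> 'a tvec set" where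
  "tangent_space A p = {v.
     (\<forall>f\<in>smooth_funs A. \<forall>g\<in>smooth_funs A. v (f + g) = v f + v g) \<and>
     (\<forall>c. \<forall>f\<in>smooth_funs A. v (\<lambda>q. c * f q) = c * v f) \<and>
     (\<forall>f\<in>smooth_funs A. \<forall>g\<in>smooth_funs A. v (f * g) = f p * v g + g p * v f) \<and>
     (\<forall>f. f \<notin> smooth_funs A \<longrightarrow> v f = 0)}"

definition tscale :: "real \<Rightarrow> 'a tvec \<Rightarrow> 'a tvec" where
  "tscale c v = (\<lambda>f. c * v f)"

definition vector_fields ::
    "('a::topological_space, 'e::euclidean_space) atlas \<Rightarrow> 'a vfield set" where
  "vector_fields A = {X. (\<forall>p. X p \<in> tangent_space A p) \<and>
     (\<forall>f\<in>smooth_funs A. (\<lambda>p. X p f) \<in> smooth_funs A)}"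

definition fscale :: "('a \<Rightarrow> real) \<Rightarrow> 'a vfield \<Rightarrow> 'a vfield" where
  "fscale h X = (\<lambda>p. tscale (h p) (X p))"

definition deriv_along :: "'a vfield \<Rightarrow> ('a \<Rightarrow> real) \<Rightarrow> 'a \<Rightarrow> real" where
  "deriv_along X f = (\<lambda>p. X p f)"

definition lie_bracket :: "'a vfield \<Rightarrow> 'a vfield \<Rightarrow> 'a vfield" where
  "lie_bracket X Y = (\<lambda>p f. X p (deriv_along Y f) - Y p (deriv_along X f))"

text \<open>Partial derivative at \<open>p\<close> in the direction of the model vector \<open>b\<close>, in the coordinates
  \<open>(U, \<phi>)\<close>.\<close>

definition coord_vec ::
    "('a::topological_space, 'e::euclidean_space) atlas \<Rightarrow> 'a set \<Rightarrow> ('a \<Rightarrow> 'e) \<Rightarrow> 'e \<Rightarrow> 'a vfield" where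
  "coord_vec A U \<phi> b = (\<lambda>p f. if f \<in> smooth_funs A
     then frechet_derivative (f \<circ> inv_into U \<phi>) (at (\<phi> p)) b else 0)"


section \<open>Tensor fields of type (1,1) and linear connections\<close>

type_synonym 'a endo = "'a \<Rightarrow> 'a tvec \<Rightarrow> 'a tvec"

definition tapply :: "'a endo \<Rightarrow> 'a vfield \<Rightarrow> 'a vfield" where
  "tapply F X = (\<lambda>p. F p (X p))"

text \<open>Fields of endomorphisms of the tangent spaces; only the values \<open>F p v\<close> with \<open>v\<close> tangent at
  \<open>p\<close> are meaningful.\<close>

definition tensor_field_11 ::
    "('a::topological_space, 'e::euclidean_space) atlas \<Rightarrow> 'a endo \<Rightarrow> bool" where
  "tensor_field_11 A F \<longleftrightarrow>
     (\<forall>p. \<forall>v\<in>tangent_space A p. F p v \<in> tangent_space A p) \<and>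
     (\<forall>p. \<forall>v\<in>tangent_space A p. \<forall>w\<in>tangent_space A p. F p (v + w) = F p v + F p w) \<and>
     (\<forall>p c. \<forall>v\<in>tangent_space A p. F p (tscale c v) = tscale c (F p v)) \<and>
     (\<forall>X\<in>vector_fields A. tapply F X \<in> vector_fields A)"

type_synonym 'a connection = "'a vfield \<Rightarrow> 'a vfield \<Rightarrow> 'a vfield"

definition linear_connection ::
    "('a::topological_space, 'e::euclidean_space) atlas \<Rightarrow> 'a connection \<Rightarrow> bool" where
  "linear_connection A nabla \<longleftrightarrow>
     (\<forall>X\<in>vector_fields A. \<forall>Y\<in>vector_fields A. nabla X Y \<in> vector_fields A) \<and>
     (\<forall>X\<in>vector_fields A. \<forall>X'\<in>vector_fields A. \<forall>Y\<in>vector_fields A.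
        nabla (X + X') Y = nabla X Y + nabla X' Y) \<and>
     (\<forall>h\<in>smooth_funs A. \<forall>X\<in>vector_fields A. \<forall>Y\<in>vector_fields A.
        nabla (fscale h X) Y = fscale h (nabla X Y)) \<and>
     (\<forall>X\<in>vector_fields A. \<forall>Y\<in>vector_fields A. \<forall>Y'\<in>vector_fields A.
        nabla X (Y + Y') = nabla X Y + nabla X Y') \<and>
     (\<forall>h\<in>smooth_funs A. \<forall>X\<in>vector_fields A. \<forall>Y\<in>vector_fields A.
        nabla X (fscale h Y) = fscale (deriv_along X h) Y + fscale h (nabla X Y))"

definition torsion :: "'a connection \<Rightarrow> 'a vfield \<Rightarrow> 'a vfield \<Rightarrow> 'a vfield" where
  "torsion nabla X Y = nabla X Y - nabla Y X - lie_bracket X Y"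

definition curvature ::
    "'a connection \<Rightarrow> 'a vfield \<Rightarrow> 'a vfield \<Rightarrow> 'a vfield \<Rightarrow> 'a vfield" where
  "curvature nabla X Y Z =
     nabla X (nabla Y Z) - nabla Y (nabla X Z) - nabla (lie_bracket X Y) Z"

definition cov_deriv_endo ::
    "'a connection \<Rightarrow> 'a endo \<Rightarrow> 'a vfield \<Rightarrow> 'a vfield \<Rightarrow> 'a vfield" where
  "cov_deriv_endo nabla F X Y = nabla X (tapply F Y) - tapply F (nabla X Y)"

definition parallel_endo ::
    "('a::topological_space, 'e::euclidean_space) atlas \<Rightarrow> 'a connection \<Rightarrow> 'a endo \<Rightarrow> bool" where
  "parallel_endo A nabla F \<longleftrightarrow>
     (\<forall>X\<in>vector_fields A. \<forall>Y\<in>vector_fields A. cov_deriv_endo nabla F X Y = 0)"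


section \<open>Almost biparacomplex structures\<close>

definition almost_biparacomplex ::
    "('a::topological_space, 'e::euclidean_space) atlas \<Rightarrow> 'a endo \<Rightarrow> 'a endo \<Rightarrow> bool" where
  "almost_biparacomplex A F P \<longleftrightarrow>
     tensor_field_11 A F \<and> tensor_field_11 A P \<and>
     (\<forall>p. \<forall>v\<in>tangent_space A p.
        F p (F p v) = v \<and> P p (P p v) = v \<and> F p (P p v) + P p (F p v) = 0)"

definition T_plus ::
    "('a::topological_space, 'e::euclidean_space) atlas \<Rightarrow> 'a endo \<Rightarrow> 'a \<Rightarrow> 'a tvec set" where
  "T_plus A F p = {v \<in> tangent_space A p. F p v - v = 0}"

definition T_minus ::
    "('a::topological_space, 'e::euclidean_space) atlas \<Rightarrow> 'a endo \<Rightarrow> 'a \<Rightarrow> 'a tvec set" where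
  "T_minus A F p = {v \<in> tangent_space A p. F p v + v = 0}"

text \<open>The condition on the torsion is imposed on sections of the two distributions; as the torsion
  is a tensor this is the same as imposing it on tangent vectors.\<close>

definition canonical_connection ::
    "('a::topological_space, 'e::euclidean_space) atlas \<Rightarrow> 'a endo \<Rightarrow> 'a endo \<Rightarrow> 'a connection \<Rightarrow> bool" where
  "canonical_connection A F P nabla \<longleftrightarrow>
     linear_connection A nabla \<and> parallel_endo A nabla F \<and> parallel_endo A nabla P \<and>
     (\<forall>X\<in>vector_fields A. \<forall>Y\<in>vector_fields A.
        (\<forall>p. X p \<in> T_plus A F p) \<and> (\<forall>p. Y p \<in> T_minus A F p) \<longrightarrow> torsion nabla X Y = 0)"


section \<open>Frames and integrability\<close>

definition basis_of :: "('k::finite \<Rightarrow> 'a tvec) \<Rightarrow> 'a tvec set \<Rightarrow> bool" where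
  "basis_of e V \<longleftrightarrow> range e \<subseteq> V \<and> (\<forall>v\<in>V. \<exists>!c :: 'k \<Rightarrow> real. v = (\<Sum>k\<in>UNIV. tscale (c k) (e k)))"

definition frame_bundle ::
    "('a::topological_space, 'e::euclidean_space) atlas \<Rightarrow> ('a \<times> ('k::finite \<Rightarrow> 'a tvec)) set" where
  "frame_bundle A = {(p, e). basis_of e (tangent_space A p)}"

text \<open>The index type \<open>'n + 'n\<close> lists a frame as \<open>X\<^sub>1, \<dots>, X\<^sub>n, Y\<^sub>1, \<dots>, Y\<^sub>n\<close>, with \<open>X\<^sub>i\<close> at
  \<open>Inl i\<close> and \<open>Y\<^sub>i\<close> at \<open>Inr i\<close>.\<close>

definition adapted_frames ::
    "('a::topological_space, 'e::euclidean_space) atlas \<Rightarrow> 'a endo \<Rightarrow> 'a endo \<Rightarrow>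
     ('a \<times> ('n::finite + 'n \<Rightarrow> 'a tvec)) set" where
  "adapted_frames A F P = {(p, e) \<in> frame_bundle A.
     basis_of (\<lambda>i. e (Inl i)) (T_plus A F p) \<and> (\<forall>i. e (Inr i) = P p (e (Inl i)))}"

text \<open>Charts take values in \<open>\<real>\<^sup>n \<times> \<real>\<^sup>n\<close>: the coordinates are \<open>(x\<^sub>1, \<dots>, x\<^sub>n, y\<^sub>1, \<dots>, y\<^sub>n)\<close>.\<close>

definition partial_x ::
    "('a::topological_space, (real^'n) \<times> (real^'n)) atlas \<Rightarrow> 'a set \<Rightarrow>
     ('a \<Rightarrow> (real^'n) \<times> (real^'n)) \<Rightarrow> 'n \<Rightarrow> 'a vfield" where
  "partial_x A U \<phi> i = coord_vec A U \<phi> (axis i 1, 0)"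

definition partial_y ::
    "('a::topological_space, (real^'n) \<times> (real^'n)) atlas \<Rightarrow> 'a set \<Rightarrow>
     ('a \<Rightarrow> (real^'n) \<times> (real^'n)) \<Rightarrow> 'n \<Rightarrow> 'a vfield" where
  "partial_y A U \<phi> i = coord_vec A U \<phi> (0, axis i 1)"

definition coord_frame ::
    "('a::topological_space, (real^'n) \<times> (real^'n)) atlas \<Rightarrow> 'a set \<Rightarrow>
     ('a \<Rightarrow> (real^'n) \<times> (real^'n)) \<Rightarrow> 'a \<Rightarrow> ('n + 'n \<Rightarrow> 'a tvec)" where
  "coord_frame A U \<phi> p = case_sum (\<lambda>i. partial_x A U \<phi> i p) (\<lambda>i. partial_y A U \<phi> i p)"

text \<open>Integrability of a \<open>G\<close>-structure, given as a set \<open>B\<close> of pairs (point, frame at the point).\<close>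

definition integrable_structure ::
    "('a::topological_space, (real^'n) \<times> (real^'n)) atlas \<Rightarrow>
     ('a \<times> ('n + 'n \<Rightarrow> 'a tvec)) set \<Rightarrow> bool" where
  "integrable_structure A B \<longleftrightarrow>
     (\<forall>p. \<exists>(U, \<phi>)\<in>A. p \<in> U \<and> (\<forall>q\<in>U. (q, coord_frame A U \<phi> q) \<in> B))"

end

theory Submission
  imports Defs
begin

text \<open>In coordinates, the vanishing of torsion and curvature says that the linear system
  \<open>df = \<beta>\<close>, \<open>d\<beta>(h) = \<beta> \<circ> \<Gamma>(h)\<close> is integrable, \<open>\<Gamma>\<close> being the Christoffel symbols, and likewise
  \<open>d\<gamma>(h) = - \<Gamma>(h) \<circ> \<gamma>\<close>. The solutions are affine coordinates \<open>f\<close>, their parallel coframe \<open>\<beta>\<close> and the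
  dual parallel frame \<open>\<gamma>\<close>. In the coordinates \<open>f\<close> the parallel fields \<open>F\<close> and \<open>P\<close> have constant
  coefficients, and a linear change of coordinates brings them to the normal form of (ii).

  Conversely, if \<open>F\<close> and \<open>P\<close> have constant coefficients, then \<open>\<Gamma>(h)\<close> commutes with both. For \<open>a\<close> in
  the \<open>+1\<close> and \<open>b\<close> in the \<open>-1\<close> eigenspace of \<open>F\<close> the torsion condition gives
  \<open>\<Gamma>(a, b) = \<Gamma>(b, a)\<close>, which lies in both eigenspaces and therefore is \<open>0\<close>; as \<open>P\<close> exchanges the
  eigenspaces, \<open>\<Gamma> = 0\<close>.

  The coordinate frames of (ii) and of (iii) are related by
  \<open>(\<partial>\<^sub>x, \<partial>\<^sub>y) \<mapsto> (\<partial>\<^sub>x + \<partial>\<^sub>y, \<partial>\<^sub>x - \<partial>\<^sub>y)\<close>.\<close>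

section \<open>Calculus of smooth maps\<close>

text \<open>The linear systems are overdetermined: a solution is computed along the rays from a base
  point by an ordinary differential equation, and integrability makes the result satisfy the
  equation in the other directions too. Torsion and curvature enter separately: symmetry of
  \<open>\<Gamma>\<close> makes \<open>\<beta>\<close> closed, so that \<open>f\<close> exists, and
  vanishing curvature makes \<open>\<beta>\<close> and \<open>\<gamma>\<close> exist. Solving for
  \<open>\<gamma>\<close> besides \<open>\<beta>\<close> supplies a smooth inverse of the derivative
  of \<open>f\<close>, so no matrix has to be inverted.

  The other obstacle is that functions, vector fields and the arguments of \<open>nabla\<close> are
  global, and tangent vectors are derivations of the global smooth functions. Coordinate
  computations are therefore done on small balls on which local data agree with global objects
  obtained by cut-off; hence the bump functions, and Hadamard's expansion, which shows that
  derivations are coordinate vectors. The torsion condition, too, is available only for global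
  sections of the eigendistributions; these are made by applying \<open>Id + F\<close> and
  \<open>Id - F\<close> to global fields.\<close>

lemma frechet_derivative_cong_open:
  assumes "open S" "x \<in> S" "\<And>y. y \<in> S \<Longrightarrow> f y = g y"
  shows "f differentiable (at x) \<longleftrightarrow> g differentiable (at x)"
    and "frechet_derivative f (at x) = frechet_derivative g (at x)"
proof -
  have *: "(f has_derivative D) (at x) \<longleftrightarrow> (g has_derivative D) (at x)" for D
    using assms has_derivative_transform_within_open[OF _ assms(1,2), of _ D UNIV] by metis
  show "f differentiable (at x) \<longleftrightarrow> g differentiable (at x)"
    unfolding differentiable_def * ..
  show "frechet_derivative f (at x) = frechet_derivative g (at x)"
    unfolding frechet_derivative_def * ..
qed

lemma Ck_on_subset: "Ck_on k S f \<Longrightarrow> T \<subseteq> S \<Longrightarrow> Ck_on k T f"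
  by (induction k arbitrary: f) (auto intro: continuous_on_subset)

text \<open>Openness matters: a derivative at a point of \<open>S\<close> sees a whole
  neighbourhood, so agreement on \<open>S\<close> passes to derivatives because \<open>S\<close> is
  open.\<close>

lemma Ck_on_cong:
  assumes "open S" "\<And>x. x \<in> S \<Longrightarrow> f x = g x" "Ck_on k S f"
  shows "Ck_on k S g"
  using assms(2,3)
proof (induction k arbitrary: f g)
  case 0
  then show ?case using continuous_on_cong[of S S f g] by simp
next
  case (Suc k)
  note * = frechet_derivative_cong_open[OF assms(1) _ Suc.prems(1)]
  have "Ck_on k S (\<lambda>x. frechet_derivative g (at x) v)" for v
    by (rule Suc.IH[of "\<lambda>x. frechet_derivative f (at x) v"]) (use Suc.prems * in auto)
  then show ?case using Suc.prems * by auto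
qed

lemma Ck_on_local:
  assumes "\<And>x. x \<in> S \<Longrightarrow> \<exists>T. open T \<and> x \<in> T \<and> Ck_on k T f"
  shows "Ck_on k S f"
  using assms
proof (induction k arbitrary: f)
  case 0
  have "continuous (at x) f" if "x \<in> S" for x
    using 0[OF that] continuous_on_eq_continuous_at by auto
  then show ?case by (simp add: continuous_at_imp_continuous_on)
next
  case (Suc k)
  have "Ck_on k S (\<lambda>x. frechet_derivative f (at x) v)" for v
    by (rule Suc.IH) (use Suc.prems in fastforce)
  then show ?case using Suc.prems by fastforce
qed

lemma Ck_on_SucD: "Ck_on (Suc k) S f \<Longrightarrow> Ck_on k S f"
proof (induction k arbitrary: f)
  case 0
  then show ?case
    by (auto intro!: continuous_at_imp_continuous_on differentiable_imp_continuous_within)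
next
  case (Suc k)
  then show ?case by (metis Ck_on.simps(2))
qed

text \<open>Lets the closure lemmas below work with an explicit derivative \<open>f'\<close>; by
  uniqueness it agrees on \<open>S\<close> with the derivative chosen by
  \<open>frechet_derivative\<close>.\<close>

lemma Ck_on_SucI:
  assumes "open S" "\<And>x. x \<in> S \<Longrightarrow> (f has_derivative f' x) (at x)"
    "\<And>v. Ck_on k S (\<lambda>x. f' x v)"
  shows "Ck_on (Suc k) S f"
proof -
  have "Ck_on k S (\<lambda>x. frechet_derivative f (at x) v)" for v
    by (rule Ck_on_cong[OF assms(1) _ assms(3)[of v]])
      (use frechet_derivative_at[OF assms(2)] in auto)
  then show ?thesis using assms(2) by (auto simp: differentiable_def)
qed

lemma Ck_on_Suc_has_derivative:
  "Ck_on (Suc k) S f \<Longrightarrow> x \<in> S \<Longrightarrow> (f has_derivative frechet_derivative f (at x)) (at x)"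
  by (simp add: frechet_derivative_works)

lemma Ck_on_Suc_deriv: "Ck_on (Suc k) S f \<Longrightarrow> Ck_on k S (\<lambda>x. frechet_derivative f (at x) v)"
  by simp

declare Ck_on.simps(2)[simp del]

lemma Ck_on_const: "open S \<Longrightarrow> Ck_on k S (\<lambda>x. c)"
  by (induction k arbitrary: c) (auto intro!: Ck_on_SucI[where f'="\<lambda>_ _. 0"])

lemma Ck_on_bounded_linear:
  assumes "bounded_linear L" "open S" "Ck_on k S f"
  shows "Ck_on k S (\<lambda>x. L (f x))"
  using assms(3)
proof (induction k arbitrary: f)
  case 0
  then show ?case by (simp add: bounded_linear.continuous_on[OF assms(1)])
next
  case (Suc k)
  show ?case
    by (rule Ck_on_SucI[OF assms(2) bounded_linear.has_derivative[OF assms(1)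
            Ck_on_Suc_has_derivative[OF Suc.prems]] Suc.IH[OF Ck_on_Suc_deriv[OF Suc.prems]]])
qed

lemma Ck_on_id: "open S \<Longrightarrow> Ck_on k S (\<lambda>x. x)"
  by (cases k) (auto intro!: Ck_on_SucI[where f'="\<lambda>_ v. v"] Ck_on_const)

lemma Ck_on_add:
  assumes "open S" "Ck_on k S f" "Ck_on k S g"
  shows "Ck_on k S (\<lambda>x. f x + g x)"
  using assms(2,3)
proof (induction k arbitrary: f g)
  case 0
  then show ?case by (simp add: continuous_on_add)
next
  case (Suc k)
  show ?case
    by (rule Ck_on_SucI[OF assms(1) has_derivative_add[OF Ck_on_Suc_has_derivative[OF Suc.prems(1)]
          Ck_on_Suc_has_derivative[OF Suc.prems(2)]]])
      (assumption, assumption, intro Suc.IH Ck_on_Suc_deriv Suc.prems)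
qed

text \<open>The product rule mixes derivatives with the functions themselves, so the induction
  hypothesis is applied to both, the latter after lowering their order by one.\<close>

lemma Ck_on_bilinear:
  assumes "bounded_bilinear p" "open S" "Ck_on k S f" "Ck_on k S g"
  shows "Ck_on k S (\<lambda>x. p (f x) (g x))"
  using assms(3,4)
proof (induction k arbitrary: f g)
  case 0
  then show ?case using bounded_bilinear.continuous_on[OF assms(1)] by simp
next
  case (Suc k)
  show ?case
    by (rule Ck_on_SucI[OF assms(2) bounded_bilinear.FDERIV[OF assms(1)
          Ck_on_Suc_has_derivative[OF Suc.prems(1)] Ck_on_Suc_has_derivative[OF Suc.prems(2)]]])
      (assumption, assumption, intro Ck_on_add[OF assms(2)] Suc.IH Suc.prems[THEN Ck_on_SucD]
          Ck_on_Suc_deriv Suc.prems)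
qed

lemma Ck_on_sum:
  assumes "open S" "finite I" "\<And>i. i \<in> I \<Longrightarrow> Ck_on k S (f i)"
  shows "Ck_on k S (\<lambda>x. \<Sum>i\<in>I. f i x)"
  using assms(2,3) by (induction I rule: finite_induct) (auto intro!: Ck_on_add Ck_on_const
      assms(1))

lemma Ck_on_componentwise:
  fixes f :: "'a::euclidean_space \<Rightarrow> 'b::euclidean_space"
  assumes "open S" "\<And>b. b \<in> Basis \<Longrightarrow> Ck_on k S (\<lambda>x. f x \<bullet> b)"
  shows "Ck_on k S f"
proof -
  have "Ck_on k S (\<lambda>x. \<Sum>b\<in>Basis. (f x \<bullet> b) *\<^sub>R b)"
    by (intro Ck_on_sum Ck_on_bounded_linear[OF bounded_linear_scaleR_left] assms finite_Basis)
  then show ?thesis by (simp add: euclidean_representation)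
qed

text \<open>In the chain rule the direction in which \<open>g\<close> is differentiated varies with
  \<open>x\<close>, while \<open>Ck_on\<close> speaks of fixed directions. Expanding the direction
  in \<open>Basis\<close> leaves products of components of \<open>f'\<close> with compositions of
  fixed-direction derivatives, and these fall under the induction hypothesis.\<close>

lemma Ck_on_compose:
  fixes f :: "'a::euclidean_space \<Rightarrow> 'b::euclidean_space"
  assumes "open S" "open T" "f ` S \<subseteq> T" "Ck_on k S f" "Ck_on k T g"
  shows "Ck_on k S (\<lambda>x. g (f x))"
  using assms(4,5)
proof (induction k arbitrary: g)
  case 0
  then show ?case using assms(3) continuous_on_compose2[of T g S f] by auto
next
  case (Suc k)
  let ?D = "\<lambda>x v. frechet_derivative f (at x) v"
  let ?D' = "\<lambda>x. frechet_derivative g (at (f x))"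
  have g: "(g has_derivative ?D' x) (at (f x))" if "x \<in> S" for x
    using Ck_on_Suc_has_derivative[OF Suc.prems(2)] assms(3) that by blast
  have "Ck_on k S (\<lambda>x. ?D' x (?D x v))" for v
  proof (rule Ck_on_cong[OF assms(1)])
    fix x assume "x \<in> S"
    interpret bounded_linear "?D' x" using g[OF \<open>x \<in> S\<close>] by (rule has_derivative_bounded_linear)
    have "?D' x (?D x v) = ?D' x (\<Sum>b\<in>Basis. (?D x v \<bullet> b) *\<^sub>R b)"
      by (simp add: euclidean_representation)
    then show "(\<Sum>b\<in>Basis. (?D x v \<bullet> b) *\<^sub>R ?D' x b) = ?D' x (?D x v)"
      by (simp add: sum scaleR)
  next
    show "Ck_on k S (\<lambda>x. \<Sum>b\<in>Basis. (?D x v \<bullet> b) *\<^sub>R ?D' x b)"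
      by (intro Ck_on_sum Ck_on_bilinear[OF bounded_bilinear_scaleR] assms(1) finite_Basis
          Ck_on_bounded_linear[OF bounded_linear_inner_left] Ck_on_Suc_deriv Suc.prems Suc.IH
          Ck_on_SucD[OF Suc.prems(1)])
  qed
  moreover have "((\<lambda>x. g (f x)) has_derivative (\<lambda>v. ?D' x (?D x v))) (at x)" if "x \<in> S" for x
    using has_derivative_compose[OF Ck_on_Suc_has_derivative[OF Suc.prems(1) that] g[OF that]] .
  ultimately show ?case using assms(1) by (intro Ck_on_SucI)
qed

text \<open>The derivative of \<open>inverse f\<close> contains \<open>inverse f\<close> itself, but
  only at the order already reached by the induction.\<close>

lemma Ck_on_inverse:
  fixes f :: "'a::euclidean_space \<Rightarrow> real"
  assumes "open S" "\<And>x. x \<in> S \<Longrightarrow> f x \<noteq> 0" "Ck_on k S f"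
  shows "Ck_on k S (\<lambda>x. inverse (f x))"
  using assms(3)
proof (induction k)
  case 0
  then show ?case using assms(2) by (auto intro!: continuous_on_inverse)
next
  case (Suc k)
  note IH = Suc.IH[OF Ck_on_SucD[OF Suc.prems]]
  show ?case
    by (rule Ck_on_SucI[OF assms(1) Deriv.has_derivative_inverse[OF assms(2)
          Ck_on_Suc_has_derivative[OF Suc.prems]]])
      (assumption, assumption,
        intro Ck_on_bounded_linear[OF bounded_linear_minus[OF bounded_linear_ident] assms(1)]
          Ck_on_bilinear[OF bounded_bilinear_mult assms(1)] IH Ck_on_Suc_deriv Suc.prems)
qed

lemma smooth_on_subset: "smooth_on S f \<Longrightarrow> T \<subseteq> S \<Longrightarrow> smooth_on T f"
  unfolding smooth_on_def using Ck_on_subset by blast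

lemma smooth_on_cong:
  "open S \<Longrightarrow> (\<And>x. x \<in> S \<Longrightarrow> f x = g x) \<Longrightarrow> smooth_on S f \<Longrightarrow> smooth_on S g"
  unfolding smooth_on_def using Ck_on_cong[of S f g] by blast

lemma smooth_on_local:
  assumes "\<And>x. x \<in> S \<Longrightarrow> \<exists>T. open T \<and> x \<in> T \<and> smooth_on T f"
  shows "smooth_on S f"
  unfolding smooth_on_def
proof
  fix k show "Ck_on k S f"
    by (rule Ck_on_local) (use assms in \<open>auto simp: smooth_on_def\<close>)
qed

lemma smooth_on_has_derivative:
  "smooth_on S f \<Longrightarrow> x \<in> S \<Longrightarrow> (f has_derivative frechet_derivative f (at x)) (at x)"
  unfolding smooth_on_def using Ck_on_Suc_has_derivative by blast

lemma smooth_on_linear_derivative: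
  assumes "smooth_on S f" "x \<in> S"
  shows "bounded_linear (frechet_derivative f (at x))"
  by (rule has_derivative_bounded_linear[OF smooth_on_has_derivative[OF assms]])

lemma smooth_on_deriv: "smooth_on S f \<Longrightarrow> smooth_on S (\<lambda>x. frechet_derivative f (at x) v)"
  unfolding smooth_on_def using Ck_on_Suc_deriv by blast

lemma smooth_on_imp_continuous_on: "smooth_on S f \<Longrightarrow> continuous_on S f"
  unfolding smooth_on_def by (metis Ck_on.simps(1))

lemma smooth_on_const: "open S \<Longrightarrow> smooth_on S (\<lambda>x. c)"
  and smooth_on_id: "open S \<Longrightarrow> smooth_on S (\<lambda>x. x)"
  and smooth_on_bounded_linear:
    "bounded_linear L \<Longrightarrow> open S \<Longrightarrow> smooth_on S f \<Longrightarrow> smooth_on S (\<lambda>x. L (f x))"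
  and smooth_on_add: "open S \<Longrightarrow> smooth_on S f \<Longrightarrow> smooth_on S g \<Longrightarrow> smooth_on S (\<lambda>x. f x + g x)"
  and smooth_on_bilinear: "bounded_bilinear p \<Longrightarrow> open S \<Longrightarrow> smooth_on S h \<Longrightarrow> smooth_on S h' \<Longrightarrow>
    smooth_on S (\<lambda>x. p (h x) (h' x))"
  and smooth_on_sum: "open S \<Longrightarrow> finite I \<Longrightarrow> (\<And>i. i \<in> I \<Longrightarrow> smooth_on S (F i)) \<Longrightarrow>
    smooth_on S (\<lambda>x. \<Sum>i\<in>I. F i x)"
  unfolding smooth_on_def
  by (simp_all add: Ck_on_const Ck_on_id Ck_on_bounded_linear Ck_on_add Ck_on_bilinear Ck_on_sum)

lemma smooth_on_compose:
  fixes f :: "'a::euclidean_space \<Rightarrow> 'b::euclidean_space"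
  shows "open S \<Longrightarrow> open T \<Longrightarrow> f ` S \<subseteq> T \<Longrightarrow> smooth_on S f \<Longrightarrow> smooth_on T g \<Longrightarrow>
    smooth_on S (\<lambda>x. g (f x))"
  unfolding smooth_on_def by (simp add: Ck_on_compose)

lemma smooth_on_componentwise:
  fixes f :: "'a::euclidean_space \<Rightarrow> 'b::euclidean_space"
  shows "open S \<Longrightarrow> (\<And>b. b \<in> Basis \<Longrightarrow> smooth_on S (\<lambda>x. f x \<bullet> b)) \<Longrightarrow> smooth_on S f"
  unfolding smooth_on_def by (simp add: Ck_on_componentwise)

lemma smooth_on_inner: "open S \<Longrightarrow> smooth_on S f \<Longrightarrow> smooth_on S (\<lambda>x. f x \<bullet> b)"
  by (rule smooth_on_bounded_linear[OF bounded_linear_inner_left])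

lemma smooth_on_mult:
  fixes f g :: "'a::euclidean_space \<Rightarrow> real"
  shows "open S \<Longrightarrow> smooth_on S f \<Longrightarrow> smooth_on S g \<Longrightarrow> smooth_on S (\<lambda>x. f x * g x)"
  by (rule smooth_on_bilinear[OF bounded_bilinear_mult])

lemma smooth_on_scaleR:
  "open S \<Longrightarrow> smooth_on S f \<Longrightarrow> smooth_on S g \<Longrightarrow> smooth_on S (\<lambda>x. f x *\<^sub>R g x)"
  by (rule smooth_on_bilinear[OF bounded_bilinear_scaleR])

lemma smooth_on_diff:
  assumes "open S" "smooth_on S f" "smooth_on S g"
  shows "smooth_on S (\<lambda>x. f x - g x)"
  using smooth_on_add[OF assms(1,2) smooth_on_bounded_linear[OF
        bounded_linear_minus[OF bounded_linear_ident] assms(1,3)]] by simp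

lemma smooth_on_inverse:
  fixes f :: "'a::euclidean_space \<Rightarrow> real"
  shows "open S \<Longrightarrow> (\<And>x. x \<in> S \<Longrightarrow> f x \<noteq> 0) \<Longrightarrow> smooth_on S f \<Longrightarrow> smooth_on S (\<lambda>x. inverse (f x))"
  unfolding smooth_on_def by (simp add: Ck_on_inverse)

lemma bounded_linear_expand:
  fixes f :: "'a::euclidean_space \<Rightarrow> 'b::real_normed_vector"
  assumes "bounded_linear f"
  shows "f v = (\<Sum>b\<in>Basis. (v \<bullet> b) *\<^sub>R f b)"
proof -
  interpret bounded_linear f by fact
  have "f v = f (\<Sum>b\<in>Basis. (v \<bullet> b) *\<^sub>R b)" by (simp add: euclidean_representation)
  then show ?thesis by (simp add: sum scaleR)
qed

lemma smooth_on_deriv_apply: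
  fixes f :: "'a::euclidean_space \<Rightarrow> 'b::real_normed_vector" and X :: "'a \<Rightarrow> 'a"
  assumes "open S" "smooth_on S f" "smooth_on S X"
  shows "smooth_on S (\<lambda>x. frechet_derivative f (at x) (X x))"
proof (rule smooth_on_cong[OF assms(1)])
  show "smooth_on S (\<lambda>x. \<Sum>b\<in>Basis. (X x \<bullet> b) *\<^sub>R frechet_derivative f (at x) b)"
    by (intro smooth_on_sum smooth_on_scaleR smooth_on_inner smooth_on_deriv assms finite_Basis)
  show "(\<Sum>b\<in>Basis. (X x \<bullet> b) *\<^sub>R frechet_derivative f (at x) b)
     = frechet_derivative f (at x) (X x)" if "x \<in> S" for x
    by (rule bounded_linear_expand[OF smooth_on_linear_derivative[OF assms(2) that], symmetric])
qed

section \<open>Smooth bump functions\<close>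

text \<open>The classical flat function is the case \<open>m = 0\<close>. The powers of
  \<open>inverse t\<close> are included so that the family is closed under differentiation.\<close>

definition flat_exp :: "nat \<Rightarrow> real \<Rightarrow> real" where
  "flat_exp m t = (if t \<le> 0 then 0 else inverse t ^ m * exp (- inverse t))"

text \<open>On the right, \<open>s = inverse y\<close> turns the expression into
  \<open>s ^ m / exp s\<close> with \<open>s\<close> tending to infinity.\<close>

lemma flat_exp_tendsto_0: "((\<lambda>y. flat_exp m y) \<longlongrightarrow> 0) (at 0)"
proof (rule filterlim_split_at)
  show "(flat_exp m \<longlongrightarrow> 0) (at_left 0)"
    by (rule tendsto_eventually) (auto simp: flat_exp_def eventually_at_filter)
  have "((\<lambda>y. inverse y ^ m / exp (inverse y)) \<longlongrightarrow> (0::real)) (at_right 0)"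
    by (rule filterlim_compose[OF tendsto_power_div_exp_0 filterlim_inverse_at_top_right])
  then show "(flat_exp m \<longlongrightarrow> 0) (at_right 0)"
    by (rule Lim_transform_eventually)
      (auto simp: flat_exp_def eventually_at_filter exp_minus divide_inverse)
qed

lemma flat_exp_deriv:
  "(flat_exp m has_field_derivative flat_exp (m + 2) t - real m * flat_exp (m + 1) t) (at t)"
proof -
  consider "t < 0" | "t = 0" | "t > 0" by linarith
  then show ?thesis
  proof cases
    case 1
    have "((\<lambda>_. 0) has_field_derivative 0) (at t)" by simp
    then have "(flat_exp m has_field_derivative 0) (at t)"
      by (rule has_field_derivative_transform_within_open[where S="{..<0}"])
        (use 1 in \<open>auto simp: flat_exp_def\<close>)
    then show ?thesis using 1 by (simp add: flat_exp_def)
  next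
    case 2
    \<comment> \<open>The difference quotient at \<open>0\<close> of one member of the family is the
      next member.\<close>
    have "((\<lambda>y. (flat_exp m y - flat_exp m 0) / (y - 0)) \<longlongrightarrow> 0) (at 0)"
      by (rule Lim_transform_eventually[OF flat_exp_tendsto_0[of "Suc m"]])
        (auto simp: flat_exp_def eventually_at_filter divide_inverse)
    then show ?thesis using 2 by (simp add: flat_exp_def has_field_derivative_iff)
  next
    case 3
    have pw: "t * t ^ (n - Suc 0) = t ^ n" if "n \<noteq> 0" for n
      using that by (cases n) auto
    have "((\<lambda>t. inverse t ^ m * exp (- inverse t)) has_field_derivative
        flat_exp (m + 2) t - real m * flat_exp (m + 1) t) (at t)"
      using 3 by (cases m)
        (auto intro!: derivative_eq_intros simp: flat_exp_def field_simps power2_eq_square, metis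
            pw)
    then show ?thesis
      by (rule has_field_derivative_transform_within_open[where S="{0<..}"])
        (use 3 in \<open>auto simp: flat_exp_def\<close>)
  qed
qed

lemma smooth_on_flat_exp: "smooth_on UNIV (flat_exp m)"
  unfolding smooth_on_def
proof
  fix k show "Ck_on k UNIV (flat_exp m)"
  proof (induction k arbitrary: m)
    case 0
    then show ?case
      using DERIV_continuous_on[of UNIV "flat_exp m", OF has_field_derivative_at_within[OF
          flat_exp_deriv]]
      by auto
  next
    case (Suc k)
    have "Ck_on k UNIV (\<lambda>t. (flat_exp (m + 2) t + (- real m) * flat_exp (m + 1) t) * v)" for v ::
        real
      by (intro Ck_on_bounded_linear[OF bounded_linear_mult_left] Ck_on_add
          Ck_on_bounded_linear[OF bounded_linear_mult_right] Suc open_UNIV)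
    then show ?case
      using flat_exp_deriv[of m, unfolded has_field_derivative_def]
      by (intro Ck_on_SucI) auto
  qed
qed

lemma smooth_bump_exists:
  fixes x0 :: "'a::euclidean_space"
  assumes "r > 0"
  shows "\<exists>\<rho> :: 'a \<Rightarrow> real. smooth_on UNIV \<rho> \<and> (\<forall>x\<in>ball x0 (r/2). \<rho> x = 1) \<and> (\<forall>x. x \<notin> ball x0 r \<longrightarrow> \<rho>
      x = 0)"
proof -
  let ?h = "flat_exp 0"
  \<comment> \<open>A smooth step: \<open>0\<close> for \<open>t \<le> 0\<close> and
    \<open>1\<close> for \<open>t \<ge> 1\<close>. The denominator never vanishes because
    \<open>t\<close> or \<open>1 - t\<close> is positive.\<close>
  define s where "s t = ?h t * inverse (?h t + ?h (1 - t))" for t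
  \<comment> \<open>The factor \<open>2\<close> is chosen so that \<open>u\<close> is at least
    \<open>3/2\<close>, hence beyond the step, on the ball of half the radius; outside the ball of
    radius \<open>r\<close> it is at most \<open>0\<close>.\<close>
  define u where "u x = (1 - (x - x0) \<bullet> (x - x0) / r\<^sup>2) * 2" for x
  have h: "?h t \<ge> 0" "?h t > 0 \<longleftrightarrow> t > 0" for t by (auto simp: flat_exp_def)
  have pos: "?h t + ?h (1 - t) \<noteq> 0" for t
    using h[of t] h[of "1 - t"] by (cases "t > 0") (auto simp: add_nonneg_eq_0_iff)
  have "smooth_on UNIV (\<lambda>t. ?h (1 - t))"
    by (rule smooth_on_compose[where T=UNIV])
      (auto intro!: smooth_on_flat_exp smooth_on_diff smooth_on_const smooth_on_id)
  then have s: "smooth_on UNIV s"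
    unfolding s_def
    by (intro smooth_on_mult smooth_on_inverse smooth_on_add smooth_on_flat_exp open_UNIV pos)
  have "smooth_on UNIV (\<lambda>x. (x - x0) \<bullet> (x - x0))"
    by (intro smooth_on_bilinear[OF bounded_bilinear_inner] smooth_on_diff smooth_on_const
        smooth_on_id open_UNIV)
  then have "smooth_on UNIV u" unfolding u_def
    by (intro smooth_on_bounded_linear[OF bounded_linear_mult_left] smooth_on_diff smooth_on_const
        smooth_on_bounded_linear[OF bounded_linear_divide] open_UNIV)
  then have "smooth_on UNIV (\<lambda>x. s (u x))"
    by (intro smooth_on_compose[OF open_UNIV open_UNIV subset_UNIV _ s])
  moreover have "s (u x) = 1" if "x \<in> ball x0 (r/2)" for x
  proof -
    have "(norm (x - x0))\<^sup>2 \<le> (r/2)\<^sup>2"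
      using that by (intro power_mono) (auto simp: dist_norm norm_minus_commute)
    then have "(norm (x - x0))\<^sup>2 / r\<^sup>2 \<le> 1 / 4"
      using assms by (simp add: divide_simps power2_eq_square)
    moreover have "q \<le> 1 / 4 \<Longrightarrow> 1 \<le> (1 - q) * 2" for q :: real by simp
    ultimately have "u x \<ge> 1" unfolding u_def dot_square_norm by blast
    then have "?h (1 - u x) = 0" "?h (u x) \<noteq> 0" by (auto simp: flat_exp_def)
    then show ?thesis by (simp add: s_def)
  qed
  moreover have "s (u x) = 0" if "x \<notin> ball x0 r" for x
  proof -
    have "(norm (x - x0))\<^sup>2 \<ge> r\<^sup>2"
      using that assms by (intro power_mono) (auto simp: dist_norm norm_minus_commute)
    then have "u x \<le> 0"
      using assms by (simp add: u_def dot_square_norm divide_simps power2_eq_square)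
    then show ?thesis by (auto simp: flat_exp_def s_def)
  qed
  ultimately show ?thesis by (intro exI[of _ "\<lambda>x. s (u x)"]) blast
qed

section \<open>Symmetry of second derivatives\<close>

text \<open>The second difference quotient of \<open>f\<close> is symmetric in \<open>a\<close> and \<open>b\<close> and tends to the mixed
  derivative.\<close>

lemma second_difference_limit:
  fixes f :: "'a::euclidean_space \<Rightarrow> real"
  assumes S: "open S" "x \<in> S" and f: "smooth_on S f" and "e > 0"
  shows "\<exists>d>0. \<forall>h. 0 < h \<and> h < d \<longrightarrow>
    \<bar>(f (x + h *\<^sub>R a + h *\<^sub>R b) - f (x + h *\<^sub>R a) - f (x + h *\<^sub>R b) + f x)
      - h\<^sup>2 * frechet_derivative (\<lambda>x. frechet_derivative f (at x) a) (at x) b\<bar> \<le> h\<^sup>2 * e"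
proof -
  define Da where "Da x = frechet_derivative f (at x) a" for x
  define G where "G x = frechet_derivative Da (at x) b" for x
  have Da: "smooth_on S Da" unfolding Da_def by (rule smooth_on_deriv[OF f])
  have G: "smooth_on S G" unfolding G_def by (rule smooth_on_deriv[OF Da])
  obtain d1 where d1: "d1 > 0" "\<And>y. dist y x < d1 \<Longrightarrow> y \<in> S"
    using S by (auto simp: open_dist)
  obtain d2 where d2: "d2 > 0" "\<And>y. y \<in> S \<Longrightarrow> dist y x < d2 \<Longrightarrow> \<bar>G y - G x\<bar> < e"
    using smooth_on_imp_continuous_on[OF G] S \<open>e > 0\<close>
    unfolding continuous_on_iff dist_real_def by blast
  \<comment> \<open>Displacements along \<open>a\<close> and \<open>b\<close> by at most
    \<open>h\<close> have total length at most \<open>h * M\<close>; the summand \<open>1\<close>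
    keeps \<open>M\<close> positive when \<open>a\<close> and \<open>b\<close> vanish.\<close>
  define M where "M = norm a + norm b + 1"
  have M: "M > 0" by (simp add: M_def add_nonneg_pos)
  define d where "d = min d1 d2 / M"
  have near: "dist (x + s *\<^sub>R a + t *\<^sub>R b) x < min d1 d2"
    if "0 \<le> s" "s \<le> h" "0 \<le> t" "t \<le> h" "h < d" for s t h
  proof -
    have "dist (x + s *\<^sub>R a + t *\<^sub>R b) x \<le> \<bar>s\<bar> * norm a + \<bar>t\<bar> * norm b"
      using norm_triangle_ineq[of "s *\<^sub>R a" "t *\<^sub>R b"] by (simp add: dist_norm)
    also have "\<dots> \<le> h * norm a + h * norm b"
      using that by (intro add_mono mult_right_mono) auto
    also have "\<dots> \<le> h * M" using that by (simp add: M_def algebra_simps)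
    also have "\<dots> < d * M" using that M by (intro mult_strict_right_mono) auto
    finally show ?thesis using M by (simp add: d_def)
  qed
  have fd: "((\<lambda>s. f (y + s *\<^sub>R a)) has_real_derivative Da (y + s *\<^sub>R a)) (at s)"
    if "y + s *\<^sub>R a \<in> S" for y s
  proof -
    have "((\<lambda>s. y + s *\<^sub>R a) has_derivative (\<lambda>v. v *\<^sub>R a)) (at s)"
      by (auto intro!: derivative_eq_intros)
    from has_derivative_compose[OF this smooth_on_has_derivative[OF f that]]
    show ?thesis
      unfolding has_field_derivative_def Da_def
      using linear_scale[OF bounded_linear.linear[OF smooth_on_linear_derivative[OF f that]]]
      by (simp add: mult.commute[of "frechet_derivative _ _ _"] fun_eq_iff o_def mult_commute_abs)
  qed
  have Dad: "((\<lambda>t. Da (y + t *\<^sub>R b)) has_real_derivative G (y + t *\<^sub>R b)) (at t)"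
    if "y + t *\<^sub>R b \<in> S" for y t
  proof -
    have "((\<lambda>s. y + s *\<^sub>R b) has_derivative (\<lambda>v. v *\<^sub>R b)) (at t)"
      by (auto intro!: derivative_eq_intros)
    from has_derivative_compose[OF this smooth_on_has_derivative[OF Da that]]
    show ?thesis
      unfolding has_field_derivative_def G_def
      using linear_scale[OF bounded_linear.linear[OF smooth_on_linear_derivative[OF Da that]]]
      by (simp add: mult_commute_abs)
  qed
  have "\<bar>(f (x + h *\<^sub>R a + h *\<^sub>R b) - f (x + h *\<^sub>R a) - f (x + h *\<^sub>R b) + f x) - h\<^sup>2 * G x\<bar> \<le> h\<^sup>2
      * e"
    if h: "0 < h" "h < d" for h
  proof -
    have in_S: "x + s *\<^sub>R a + t *\<^sub>R b \<in> S" if "0 \<le> s" "s \<le> h" "0 \<le> t" "t \<le> h" for s t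
      using near[OF that h(2)] d1(2) by auto
    have der: "((\<lambda>s. f (x + s *\<^sub>R a + h *\<^sub>R b) - f (x + s *\<^sub>R a)) has_real_derivative
        Da (x + s *\<^sub>R a + h *\<^sub>R b) - Da (x + s *\<^sub>R a)) (at s)" if "0 \<le> s" "s \<le> h" for s
      using fd[of "x + h *\<^sub>R b" s] fd[of x s] in_S[of s h] in_S[of s 0] that h
      by (auto intro!: DERIV_diff simp: algebra_simps)
    \<comment> \<open>Two mean value theorems: in direction \<open>a\<close> for the difference of
      \<open>f\<close> on two parallel segments, then in direction \<open>b\<close> for the
      derivative \<open>Da\<close>. They produce one point at which the second difference is exactly
      \<open>h\<^sup>2\<close> times the mixed derivative.\<close>
    obtain s where s: "0 < s" "s < h"
      "f (x + h *\<^sub>R a + h *\<^sub>R b) - f (x + h *\<^sub>R a) - (f (x + h *\<^sub>R b) - f x)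
        = h * (Da (x + s *\<^sub>R a + h *\<^sub>R b) - Da (x + s *\<^sub>R a))"
      using MVT2[OF h(1) der] by auto
    obtain t where t: "0 < t" "t < h"
      "Da (x + s *\<^sub>R a + h *\<^sub>R b) - Da (x + s *\<^sub>R a) = h * G (x + s *\<^sub>R a + t *\<^sub>R b)"
      using MVT2[OF h(1), of "\<lambda>t. Da (x + s *\<^sub>R a + t *\<^sub>R b)" "\<lambda>t. G (x + s *\<^sub>R a + t *\<^sub>R b)"]
        Dad[of "x + s *\<^sub>R a"] in_S[of s] s by auto
    let ?y = "x + s *\<^sub>R a + t *\<^sub>R b"
    have "\<bar>G ?y - G x\<bar> < e" using d2(2) in_S[of s t] near[of s h t] s t h by auto
    then have "h\<^sup>2 * \<bar>G ?y - G x\<bar> \<le> h\<^sup>2 * e" by (intro mult_left_mono) auto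
    moreover have "(f (x + h *\<^sub>R a + h *\<^sub>R b) - f (x + h *\<^sub>R a) - f (x + h *\<^sub>R b) + f x) - h\<^sup>2 * G x
       = h\<^sup>2 * (G ?y - G x)"
      using s(3) t(3) by (simp add: power2_eq_square algebra_simps)
    ultimately show ?thesis by (simp add: abs_mult)
  qed
  moreover have "d > 0" using M d1 d2 by (simp add: d_def)
  ultimately show ?thesis unfolding G_def Da_def by blast
qed

lemma mixed_derivatives_real:
  fixes f :: "'a::euclidean_space \<Rightarrow> real"
  assumes S: "open S" "x \<in> S" and f: "smooth_on S f"
  shows "frechet_derivative (\<lambda>x. frechet_derivative f (at x) a) (at x) b
       = frechet_derivative (\<lambda>x. frechet_derivative f (at x) b) (at x) a" (is "?A = ?B")
proof (rule ccontr)
  assume "?A \<noteq> ?B"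
  \<comment> \<open>Both mixed derivatives lie within \<open>e\<close> of one and the same quotient,
    so they differ by at most \<open>2 * e\<close>; a third of their distance is therefore small
    enough for a contradiction.\<close>
  define e where "e = \<bar>?A - ?B\<bar> / 3"
  have e: "e > 0" using \<open>?A \<noteq> ?B\<close> by (simp add: e_def)
  let ?F = "\<lambda>h. f (x + h *\<^sub>R a + h *\<^sub>R b) - f (x + h *\<^sub>R a) - f (x + h *\<^sub>R b) + f x"
  obtain d1 where d1: "d1 > 0" "\<And>h. 0 < h \<Longrightarrow> h < d1 \<Longrightarrow> \<bar>?F h - h\<^sup>2 * ?A\<bar> \<le> h\<^sup>2 * e"
    using second_difference_limit[OF S f e, of a b] by blast
  have "?F h = f (x + h *\<^sub>R b + h *\<^sub>R a) - f (x + h *\<^sub>R b) - f (x + h *\<^sub>R a) + f x" for h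
    by (simp add: algebra_simps)
  then obtain d2 where d2: "d2 > 0" "\<And>h. 0 < h \<Longrightarrow> h < d2 \<Longrightarrow> \<bar>?F h - h\<^sup>2 * ?B\<bar> \<le> h\<^sup>2 * e"
    using second_difference_limit[OF S f e, of b a] by auto
  define h where "h = min d1 d2 / 2"
  have h: "0 < h" "h < d1" "h < d2" using d1 d2 by (auto simp: h_def)
  have "h\<^sup>2 * \<bar>?A - ?B\<bar> = \<bar>h\<^sup>2 * ?A - h\<^sup>2 * ?B\<bar>"
    by (simp add: abs_mult flip: right_diff_distrib)
  also have "\<dots> \<le> 2 * (h\<^sup>2 * e)" using d1(2)[OF h(1,2)] d2(2)[OF h(1,3)] by linarith
  finally have "h\<^sup>2 * \<bar>?A - ?B\<bar> \<le> h\<^sup>2 * (2 * e)" by simp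
  then have "\<bar>?A - ?B\<bar> \<le> 2 * e" using h(1) by simp
  then show False using e by (simp add: e_def)
qed

lemma frechet_derivative_bounded_linear_compose:
  assumes "bounded_linear L" "f differentiable (at x)"
  shows "frechet_derivative (\<lambda>x. L (f x)) (at x) v = L (frechet_derivative f (at x) v)"
  using frechet_derivative_at[OF bounded_linear.has_derivative[OF assms(1)
        assms(2)[unfolded frechet_derivative_works]]] by metis

text \<open>The mean value argument requires real values, so the claim is checked on inner products
  with the basis vectors.\<close>

lemma mixed_derivatives:
  fixes f :: "'a::euclidean_space \<Rightarrow> 'b::euclidean_space"
  assumes S: "open S" "x \<in> S" and f: "smooth_on S f"
  shows "frechet_derivative (\<lambda>x. frechet_derivative f (at x) a) (at x) b
       = frechet_derivative (\<lambda>x. frechet_derivative f (at x) b) (at x) a"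
proof (rule euclidean_eqI)
  fix c :: 'b assume "c \<in> Basis"
  have *: "frechet_derivative (\<lambda>x. frechet_derivative f (at x) a) (at x) b \<bullet> c
    = frechet_derivative (\<lambda>x. frechet_derivative (\<lambda>x. f x \<bullet> c) (at x) a) (at x) b" for a b
  proof -
    have diff: "f differentiable (at y)" if "y \<in> S" for y
      using smooth_on_has_derivative[OF f that] by (auto simp: differentiable_def)
    have "frechet_derivative (\<lambda>x. frechet_derivative f (at x) a) (at x) b \<bullet> c
      = frechet_derivative (\<lambda>x. frechet_derivative f (at x) a \<bullet> c) (at x) b"
      by (rule frechet_derivative_bounded_linear_compose[OF bounded_linear_inner_left, symmetric])
        (use smooth_on_has_derivative[OF smooth_on_deriv[OF f] S(2)] in \<open>auto simp:
            differentiable_def\<close>)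
    also have "\<dots> = frechet_derivative (\<lambda>x. frechet_derivative (\<lambda>x. f x \<bullet> c) (at x) a) (at x) b"
      using frechet_derivative_cong_open(2)[OF S, of "\<lambda>x. frechet_derivative f (at x) a \<bullet> c"]
        frechet_derivative_bounded_linear_compose[OF bounded_linear_inner_left diff] by metis
    finally show ?thesis .
  qed
  show "frechet_derivative (\<lambda>x. frechet_derivative f (at x) a) (at x) b \<bullet> c
       = frechet_derivative (\<lambda>x. frechet_derivative f (at x) b) (at x) a \<bullet> c"
    unfolding * by (rule mixed_derivatives_real[OF S smooth_on_inner[OF S(1) f]])
qed

section \<open>Integrals along rays and Hadamard's lemma\<close>

text \<open>Differentiating under the integral sign brings out one more factor \<open>t\<close> by
  the chain rule. The weight \<open>t ^ m\<close> with arbitrary \<open>m\<close> makes the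
  statement stable under this and so carries the induction.\<close>

lemma Ck_on_ray_integral:
  fixes h :: "'a::euclidean_space \<Rightarrow> real"
  assumes "Ck_on k (ball x0 r) h"
  shows "Ck_on k (ball x0 r) (\<lambda>x. integral (cbox 0 1) (\<lambda>t. t ^ m * h (x0 + t *\<^sub>R (x - x0))))"
  using assms
proof (induction k arbitrary: h m)
  have ray: "x0 + t *\<^sub>R (x - x0) \<in> ball x0 r" if "x \<in> ball x0 r" "t \<in> cbox 0 1" for x and t :: real
  proof -
    have "\<bar>t\<bar> * norm (x - x0) \<le> norm (x - x0)"
      using that by (intro mult_left_le_one_le) auto
    then show ?thesis using that by (simp add: dist_norm norm_minus_commute)
  qed
  have cont: "continuous_on (ball x0 r \<times> cbox 0 1) (\<lambda>(x, t). t ^ m * h (x0 + t *\<^sub>R (x - x0)))"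
    if "continuous_on (ball x0 r) h" for h :: "'a \<Rightarrow> real" and m
    unfolding case_prod_beta using ray
    by (intro continuous_intros continuous_on_compose2[OF that]) auto
  {
    case 0
    then show ?case using integral_continuous_on_param[OF cont] by simp
  next
    case (Suc k)
    let ?B = "ball x0 r"
    have ch: "continuous_on ?B h"
      using Ck_on_Suc_has_derivative[OF Suc.prems]
      by (intro has_derivative_continuous_on) (auto intro: has_derivative_at_withinI)
    have cdh: "continuous_on ?B (\<lambda>x. frechet_derivative h (at x) v)" for v
    proof -
      have "Ck_on (Suc 0) ?B h"
        using Suc.prems by (induction k) (auto dest: Ck_on_SucD)
      then show ?thesis by (simp add: Ck_on.simps)
    qed
    \<comment> \<open>The derivative of the integrand is packaged as a bounded linear map, the form
      in which the Leibniz rule takes it; its joint continuity is then checked direction by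
      direction.\<close>
    define D where "D x t = Blinfun (\<lambda>v. t ^ Suc m * frechet_derivative h (at (x0 + t *\<^sub>R (x -
        x0))) v)"
      for x t
    have D: "blinfun_apply (D x t) = (\<lambda>v. t ^ Suc m * frechet_derivative h (at (x0 + t *\<^sub>R (x -
        x0))) v)"
      if "x \<in> ?B" "t \<in> cbox 0 1" for x t
      unfolding D_def
      by (intro bounded_linear_Blinfun_apply bounded_linear_const_mult
          has_derivative_bounded_linear[OF Ck_on_Suc_has_derivative[OF Suc.prems ray[OF that]]])
    have contD: "continuous_on (?B \<times> cbox 0 1) (\<lambda>(x, t). D x t)"
    proof (rule continuous_on_blinfun_componentwise)
      fix b :: 'a
      show "continuous_on (?B \<times> cbox 0 1) (\<lambda>z. (case z of (x, t) \<Rightarrow> D x t) b)"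
        by (rule continuous_on_eq[OF cont[OF cdh, of "Suc m" b]]) (auto simp: D)
    qed
    have int: "D x integrable_on cbox 0 1" if "x \<in> ?B" for x
    proof (rule integrable_continuous)
      have "continuous_on (cbox 0 1) (\<lambda>t. case (x, t) of (x, t) \<Rightarrow> D x t)"
        by (rule continuous_on_compose2[OF contD]) (use that in \<open>auto intro!: continuous_intros\<close>)
      then show "continuous_on (cbox 0 1) (D x)" by simp
    qed
    have der: "((\<lambda>x. integral (cbox 0 1) (\<lambda>t. t ^ m * h (x0 + t *\<^sub>R (x - x0)))) has_derivative
        integral (cbox 0 1) (D x)) (at x)" if "x \<in> ?B" for x
    proof -
      have "((\<lambda>x. integral (cbox 0 1) (\<lambda>t. t ^ m * h (x0 + t *\<^sub>R (x - x0)))) has_derivative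
        integral (cbox 0 1) (D x)) (at x within ?B)"
      proof (rule leibniz_rule[OF _ _ contD that convex_ball])
        fix x and t :: real assume xt: "x \<in> ?B" "t \<in> cbox 0 1"
        have lin: "linear (frechet_derivative h (at (x0 + t *\<^sub>R (x - x0))))"
          by (rule bounded_linear.linear[OF has_derivative_bounded_linear[OF
                  Ck_on_Suc_has_derivative[OF Suc.prems ray[OF xt]]]])
        have "((\<lambda>x. x0 + t *\<^sub>R (x - x0)) has_derivative (\<lambda>v. t *\<^sub>R v)) (at x)"
          by (auto intro!: derivative_eq_intros)
        note has_derivative_compose[OF this Ck_on_Suc_has_derivative[OF Suc.prems ray[OF xt]]]
        from has_derivative_mult_right[OF this, of "t ^ m"]
        have "((\<lambda>x. t ^ m * h (x0 + t *\<^sub>R (x - x0))) has_derivative D x t) (at x)"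
          unfolding D[OF xt] linear_scale[OF lin] by (simp add: ac_simps)
        then show "((\<lambda>x. t ^ m * h (x0 + t *\<^sub>R (x - x0))) has_derivative D x t) (at x within ?B)"
          by (rule has_derivative_at_withinI)
      next
        fix x assume "x \<in> ?B"
        then show "(\<lambda>t. t ^ m * h (x0 + t *\<^sub>R (x - x0))) integrable_on cbox 0 1"
          by (intro integrable_continuous)
            (auto intro!: continuous_intros continuous_on_compose2[OF ch] simp: ray[simplified])
      qed
      then show ?thesis using at_within_open[OF that] by simp
    qed
    show ?case
    proof (rule Ck_on_SucI[OF open_ball der])
      fix v
      show "Ck_on k ?B (\<lambda>x. integral (cbox 0 1) (D x) v)"
      proof (rule Ck_on_cong[OF open_ball _ Suc.IH[OF Ck_on_Suc_deriv[OF Suc.prems, of v], of "Suc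
          m"]])
        fix x assume x: "x \<in> ?B"
        show "integral (cbox 0 1) (\<lambda>t. t ^ Suc m * frechet_derivative h (at (x0 + t *\<^sub>R (x - x0)))
            v)
          = integral (cbox 0 1) (D x) v"
          unfolding blinfun_apply_integral[OF int[OF x]]
          by (rule integral_cong) (use D[OF x] in simp)
      qed
    qed
  }
qed

text \<open>Integrating the derivative of \<open>f\<close> along the ray from \<open>x0\<close> to
  \<open>x\<close> gives \<open>f x - f x0\<close>; \<open>g b\<close> is the integral of the
  derivative in direction \<open>b\<close>. The expansion is what a derivation is applied to in
  \<open>tangent_coord\<close>.\<close>

lemma hadamard:
  fixes f :: "'a::euclidean_space \<Rightarrow> real"
  assumes f: "smooth_on (ball x0 r) f" and "r > 0"
  obtains g where "\<And>b. smooth_on (ball x0 r) (g b)"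
    "\<And>b. g b x0 = frechet_derivative f (at x0) b"
    "\<And>x. x \<in> ball x0 r \<Longrightarrow> f x = f x0 + (\<Sum>b\<in>Basis. ((x - x0) \<bullet> b) * g b x)"
proof
  let ?B = "ball x0 r"
  \<comment> \<open>The factor \<open>t ^ 0\<close> brings the integral into the shape of
    \<open>Ck_on_ray_integral\<close>.\<close>
  define g where "g b x = integral (cbox 0 1) (\<lambda>t. t ^ 0 * frechet_derivative f (at (x0 + t *\<^sub>R (x
      - x0))) b)"
    for b x
  show "smooth_on ?B (g b)" for b
    using smooth_on_deriv[OF f] unfolding smooth_on_def g_def by (intro allI Ck_on_ray_integral)
        blast
  show "g b x0 = frechet_derivative f (at x0) b" for b by (simp add: g_def)
  fix x assume x: "x \<in> ?B"
  have ray: "x0 + t *\<^sub>R (x - x0) \<in> ?B" if "t \<in> {0..1}" for t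
  proof -
    have "\<bar>t\<bar> * norm (x - x0) \<le> norm (x - x0)"
      using that by (intro mult_left_le_one_le) auto
    then show ?thesis using that x by (simp add: dist_norm norm_minus_commute)
  qed
  let ?D = "\<lambda>t. frechet_derivative f (at (x0 + t *\<^sub>R (x - x0)))"
  have "((\<lambda>t. f (x0 + t *\<^sub>R (x - x0))) has_vector_derivative ?D t (x - x0)) (at t within {0..1})"
    if "t \<in> {0..1}" for t
  proof -
    have "((\<lambda>t. x0 + t *\<^sub>R (x - x0)) has_derivative (\<lambda>s. s *\<^sub>R (x - x0))) (at t)"
      by (auto intro!: derivative_eq_intros)
    from has_derivative_compose[OF this smooth_on_has_derivative[OF f ray[OF that]]]
    show ?thesis
      using linear_scale[OF bounded_linear.linear[OF smooth_on_linear_derivative[OF f ray[OF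
          that]]]]
      by (simp add: has_vector_derivative_def has_derivative_at_withinI)
  qed
  then have "((\<lambda>t. ?D t (x - x0)) has_integral
      f (x0 + 1 *\<^sub>R (x - x0)) - f (x0 + 0 *\<^sub>R (x - x0))) {0..1}"
    by (intro fundamental_theorem_of_calculus) auto
  then have "f x - f x0 = integral {0..1} (\<lambda>t. ?D t (x - x0))"
    by (simp add: integral_unique)
  also have "\<dots> = integral {0..1} (\<lambda>t. \<Sum>b\<in>Basis. ((x - x0) \<bullet> b) * ?D t b)"
    using bounded_linear_expand[OF smooth_on_linear_derivative[OF f ray], of _ "x - x0"]
    by (intro integral_cong) simp
  also have "\<dots> = (\<Sum>b\<in>Basis. integral {0..1} (\<lambda>t. ((x - x0) \<bullet> b) * ?D t b))"
    by (intro integral_sum finite_Basis integrable_continuous_real continuous_intros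
        continuous_on_compose2[OF smooth_on_imp_continuous_on[OF smooth_on_deriv[OF f]]])
      (use ray in auto)
  also have "\<dots> = (\<Sum>b\<in>Basis. ((x - x0) \<bullet> b) * g b x)"
    by (simp add: g_def)
  finally show "f x = f x0 + (\<Sum>b\<in>Basis. ((x - x0) \<bullet> b) * g b x)" by simp
qed

section \<open>Integrable total linear differential equations\<close>

text \<open>The equation \<open>du(h) = A(x)(h) u\<close>. A solution with prescribed value at \<open>x0\<close> is obtained by
  solving the ordinary differential equation along the rays from \<open>x0\<close>; integrability makes the
  increments in the other directions agree with \<open>A\<close>.\<close>

locale total_linear_ode =
  fixes A :: "'e::euclidean_space \<Rightarrow> 'e \<Rightarrow>\<^sub>L 'g \<Rightarrow>\<^sub>L 'g::banach"
    and A' :: "'e \<Rightarrow> 'e \<Rightarrow>\<^sub>L 'e \<Rightarrow>\<^sub>L 'g \<Rightarrow>\<^sub>L 'g"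
    and x0 :: 'e and r :: real and K :: real
  assumes r: "r > 0"
    and deriv: "\<And>x. x \<in> cball x0 r \<Longrightarrow> (A has_derivative A' x) (at x)"
    and cont: "continuous_on (cball x0 r) A'"
    and integrable: "\<And>x h k u. x \<in> cball x0 r \<Longrightarrow>
      A' x h k u + A x k (A x h u) = A' x k h u + A x h (A x k u)"
    and bound: "\<And>x. x \<in> cball x0 r \<Longrightarrow> norm (A x) \<le> K"
    and small: "K * r \<le> 1 / 2"
begin

definition ray :: "'e \<Rightarrow> real \<Rightarrow> 'e" where
  "ray x t = x0 + t *\<^sub>R (x - x0)"

lemma ray_0 [simp]: "ray x 0 = x0" and ray_1 [simp]: "ray x 1 = x"
  by (simp_all add: ray_def)

lemma ray_ray: "ray (ray x s) t = ray x (t * s)"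
  by (simp add: ray_def)

lemma ray_in: "x \<in> cball x0 r \<Longrightarrow> 0 \<le> t \<Longrightarrow> t \<le> 1 \<Longrightarrow> ray x t \<in> cball x0 r"
  using mult_left_le_one_le[of "norm (x - x0)" t]
  by (auto simp: ray_def dist_norm norm_minus_commute)

lemma contA: "continuous_on (cball x0 r) A"
  by (rule has_derivative_continuous_on[OF has_derivative_at_withinI[OF deriv]])

lemma K_nonneg: "K \<ge> 0"
  using order_trans[OF norm_ge_zero bound[of x0]] r by simp

lemma norm_A_apply:
  assumes "x \<in> cball x0 r" shows "norm (A x h u) \<le> K * norm h * norm u"
proof -
  have "norm (A x h u) \<le> norm (A x h) * norm u" by (rule norm_blinfun)
  also have "\<dots> \<le> (norm (A x) * norm h) * norm u" by (intro mult_right_mono norm_blinfun) auto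
  also have "\<dots> \<le> K * norm h * norm u" using bound[OF assms] by (intro mult_right_mono) auto
  finally show ?thesis .
qed

text \<open>The constant \<open>1 / 2\<close> serves twice: it makes \<open>picard\<close> a
  contraction, and in \<open>solution_exists\<close> it lets half of an error be absorbed on the
  other side.\<close>

lemma integrand_bound:
  assumes "x \<in> cball x0 r" "y \<in> cball x0 r"
  shows "norm (A x (y - x0) v) \<le> 1 / 2 * norm v"
proof -
  have "norm (A x (y - x0) v) \<le> K * norm (y - x0) * norm v" by (rule norm_A_apply[OF assms(1)])
  also have "\<dots> \<le> K * r * norm v"
    using assms(2) K_nonneg by (intro mult_right_mono mult_left_mono) (auto simp: dist_norm
        norm_minus_commute)
  also have "\<dots> \<le> 1 / 2 * norm v" using small by (intro mult_right_mono) auto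
  finally show ?thesis .
qed

text \<open>Retraction onto the closed ball. With it the integral operator acts on functions defined
  on the whole space, so that the fixed point theorem applies to the complete type of bounded
  continuous functions.\<close>

definition proj :: "'e \<Rightarrow> 'e" where
  "proj = closest_point (cball x0 r)"

lemma proj_in: "proj x \<in> cball x0 r"
  using r unfolding proj_def by (intro closest_point_in_set) auto

lemma proj_self: "x \<in> cball x0 r \<Longrightarrow> proj x = x"
  unfolding proj_def by (rule closest_point_self)

lemma cont_proj: "continuous_on S proj"
  unfolding proj_def using r by (intro continuous_on_closest_point) auto

text \<open>The integral form of the differential equations along all rays at once: the point
  \<open>x\<close> is also the end of its own ray, so a single fixed point solves the equation on
  every ray.\<close>

definition picard :: "'g \<Rightarrow> ('e \<Rightarrow> 'g) \<Rightarrow> 'e \<Rightarrow> 'g" where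
  "picard u0 w x = u0 + integral (cbox 0 1) (\<lambda>t. A (ray (proj x) t) (proj x - x0) (w (ray (proj x)
      t)))"

lemma cont_integrand:
  assumes "continuous_on UNIV w"
  shows "continuous_on (UNIV \<times> cbox 0 1) (\<lambda>(x, t). A (ray (proj x) t) (proj x - x0) (w (ray (proj
      x) t)))"
proof -
  have p: "continuous_on (UNIV \<times> cbox 0 1) (\<lambda>z. proj (fst z))"
    by (intro continuous_on_compose2[OF cont_proj] continuous_intros) auto
  have q: "continuous_on (UNIV \<times> cbox 0 1) (\<lambda>z. ray (proj (fst z)) (snd z))"
    unfolding ray_def by (intro continuous_intros p)
  show ?thesis
    unfolding case_prod_beta
    by (intro continuous_intros p continuous_on_compose2[OF contA q] continuous_on_compose2[OF
        assms q])
      (auto intro!: ray_in[OF proj_in, simplified])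
qed

lemma integrand_integrable:
  assumes "continuous_on UNIV w"
  shows "(\<lambda>t. A (ray (proj x) t) (proj x - x0) (w (ray (proj x) t))) integrable_on cbox 0 1"
proof (rule integrable_continuous)
  have "continuous_on (cbox 0 1) (\<lambda>t. case (x, t) of (x, t) \<Rightarrow> A (ray (proj x) t) (proj x - x0) (w
      (ray (proj x) t)))"
    by (rule continuous_on_compose2[OF cont_integrand[OF assms]]) (auto intro!: continuous_intros)
  then show "continuous_on (cbox 0 1) (\<lambda>t. A (ray (proj x) t) (proj x - x0) (w (ray (proj x) t)))"
      by simp
qed

lemma picard_lipschitz:
  assumes "continuous_on UNIV v" "continuous_on UNIV w" "\<And>x. norm (v x - w x) \<le> M"
  shows "norm (picard u0 v x - picard u0 w x) \<le> M / 2"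
proof -
  let ?I = "\<lambda>w t. A (ray (proj x) t) (proj x - x0) (w (ray (proj x) t))"
  have "picard u0 v x - picard u0 w x = integral (cbox 0 1) (\<lambda>t. ?I v t - ?I w t)"
    unfolding picard_def
    by (subst integral_diff[OF integrand_integrable[OF assms(1)] integrand_integrable[OF
        assms(2)]]) simp
  also have "\<dots> = integral (cbox 0 1) (?I (\<lambda>x. v x - w x))"
    by (simp add: blinfun.diff_right)
  finally have *: "picard u0 v x - picard u0 w x = integral (cbox 0 1) (?I (\<lambda>x. v x - w x))" .
  have "norm (integral (cbox 0 1) (?I (\<lambda>x. v x - w x))) \<le> (M / 2) * measure lborel (cbox 0
      (1::real))"
  proof (rule has_integral_bound[OF _ integrable_integral[OF integrand_integrable]])
    show "0 \<le> M / 2" using assms(3)[of x] norm_ge_zero[of "v x - w x"] by linarith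
    show "continuous_on UNIV (\<lambda>x. v x - w x)" by (intro continuous_intros assms)
    fix t :: real assume t: "t \<in> cbox 0 1"
    have "norm (?I (\<lambda>x. v x - w x) t) \<le> 1 / 2 * norm (v (ray (proj x) t) - w (ray (proj x) t))"
      by (rule integrand_bound) (use t in \<open>auto intro!: ray_in[OF proj_in, simplified]
          proj_in[simplified]\<close>)
    then show "norm (?I (\<lambda>x. v x - w x) t) \<le> M / 2" using assms(3)[of "ray (proj x) t"] by linarith
  qed
  then show ?thesis using * by simp
qed

lemma fixed_point_exists:
  obtains u where "continuous_on UNIV u" "\<And>x. u x = picard u0 u x" "bounded (range u)"
proof -
  have in_bc: "picard u0 w \<in> bcontfun" if "w \<in> bcontfun" for w
  proof -
    have w: "continuous_on UNIV w" "bounded (range w)" using that by (auto simp: bcontfun_def)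
    then obtain B where B: "\<And>x. norm (w x) \<le> B" by (auto simp: bounded_iff)
    \<comment> \<open>Boundedness reuses the contraction estimate: the image of the zero function is
      the constant \<open>u0\<close>.\<close>
    have "norm (picard u0 w x - picard u0 (\<lambda>_. 0) x) \<le> B / 2" for x
      by (rule picard_lipschitz) (use w B in auto)
    moreover have "picard u0 (\<lambda>_. 0) x = u0" for x by (simp add: picard_def)
    ultimately have "norm (picard u0 w x) \<le> norm u0 + B / 2" for x
      by (metis add.commute norm_triangle_sub order_trans add_left_mono)
    then have "bounded (range (picard u0 w))" by (auto simp: bounded_iff)
    moreover have "continuous_on UNIV (picard u0 w)"
      unfolding picard_def by (intro continuous_intros integral_continuous_on_param cont_integrand
          w)
    ultimately show ?thesis by (simp add: bcontfun_def)
  qed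
  define T where "T w = Bcontfun (picard u0 (apply_bcontfun w))" for w
  have T: "apply_bcontfun (T w) = picard u0 (apply_bcontfun w)" for w
    unfolding T_def by (rule Bcontfun_inverse[OF in_bc[OF apply_bcontfun]])
  have "\<exists>!w. T w = w"
  proof (rule banach_fix_type)
    show "\<forall>v w. dist (T v) (T w) \<le> 1 / 2 * dist v w"
    proof (intro allI dist_bound)
      fix v w :: "'e \<Rightarrow>\<^sub>C 'g" and x
      have "norm (picard u0 v x - picard u0 w x) \<le> dist v w / 2"
        by (rule picard_lipschitz) (auto simp flip: dist_norm intro: dist_bounded)
      then show "dist (T v x) (T w x) \<le> 1 / 2 * dist v w" by (simp add: T dist_norm)
    qed
  qed auto
  then obtain w where w: "T w = w" by blast
  show thesis
  proof
    show "continuous_on UNIV (apply_bcontfun w)" by simp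
    show "w x = picard u0 w x" for x using T[of w] w by simp
    show "bounded (range (apply_bcontfun w))" using apply_bcontfun[of w] by (simp add: bcontfun_def)
  qed
qed

text \<open>The ray to \<open>ray x s\<close> is an initial piece of the ray to \<open>x\<close>.
  After rescaling, the fixed point equation at \<open>ray x s\<close> expresses \<open>u\<close>
  there as \<open>u0\<close> plus an integral up to \<open>s\<close>, which is differentiated by the
  fundamental theorem.\<close>

lemma ray_derivative:
  assumes u: "continuous_on UNIV u" "\<And>x. u x = picard u0 u x"
    and x: "x \<in> cball x0 r" and s: "s \<in> {0..1}"
  shows "((\<lambda>s. u (ray x s)) has_vector_derivative A (ray x s) (x - x0) (u (ray x s))) (at s within
      {0..1})"
proof -
  define g where "g t = A (ray x t) (x - x0) (u (ray x t))" for t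
  have cr: "continuous_on {0..1} (ray x)" unfolding ray_def by (intro continuous_intros)
  have g: "continuous_on {0..1} g"
    unfolding g_def
    by (intro continuous_intros continuous_on_compose2[OF contA cr] continuous_on_compose2[OF u(1)
        cr])
      (auto intro!: ray_in[OF x, simplified])
  define G where "G t = integral {0..t} g" for t
  have G: "(G has_vector_derivative g t) (at t within {0..1})" if "t \<in> {0..1}" for t
    unfolding G_def by (rule integral_has_vector_derivative[OF g that])
  have eq: "u (ray x s) = u0 + G s" if s: "s \<in> {0..1}" for s
  proof -
    have rs: "ray x s \<in> cball x0 r" using ray_in[OF x] s by simp
    \<comment> \<open>The primitive \<open>G (t * s)\<close> is used in place of a change of
      variables, so \<open>s = 0\<close> needs no separate case.\<close>
    have "((\<lambda>t. s *\<^sub>R g (t * s)) has_integral G (1 * s) - G (0 * s)) {0..1}"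
    proof (rule fundamental_theorem_of_calculus)
      fix t :: real assume t: "t \<in> {0..1}"
      have ts: "t * s \<in> {0..1}" using s t by (auto intro: mult_le_one)
      have "(G has_vector_derivative g (t * s)) (at (t * s) within (\<lambda>t. t * s) ` {0..1})"
        by (rule has_vector_derivative_within_subset[OF G[OF ts]]) (use s in \<open>auto intro:
            mult_le_one\<close>)
      moreover have "((\<lambda>t. t * s) has_vector_derivative s) (at t within {0..1})"
        by (auto intro!: derivative_eq_intros)
      ultimately show "((\<lambda>t. G (t * s)) has_vector_derivative s *\<^sub>R g (t * s)) (at t within {0..1})"
        using vector_diff_chain_within[of "\<lambda>t. t * s" s t "{0..1}" G "g (t * s)"] by (simp add:
            o_def)
    qed simp
    from integral_unique[OF this] have "integral {0..1} (\<lambda>t. s *\<^sub>R g (t * s)) = G s"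
      by (simp add: G_def)
    moreover have "picard u0 u (ray x s) = u0 + integral {0..1} (\<lambda>t. s *\<^sub>R g (t * s))"
      by (simp add: picard_def proj_self[OF rs] ray_ray g_def) (simp add: ray_def
          blinfun.scaleR_right blinfun.scaleR_left)
    ultimately show ?thesis using u(2)[of "ray x s"] by simp
  qed
  have "((\<lambda>s. u0 + G s) has_vector_derivative g s) (at s within {0..1})"
    using G[OF s] by (auto intro!: derivative_eq_intros)
  then show ?thesis
    unfolding g_def by (rule has_vector_derivative_transform[rotated -1]) (use eq s in auto)
qed

text \<open>Uniform continuity of \<open>A'\<close> on the compact ball makes the first order
  remainder uniform in the base point. This uniformity is needed because \<open>A\<close> is
  expanded at all points of a ray simultaneously.\<close>

lemma linearization:
  assumes "e > 0"
  obtains d where "d > 0"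
    "\<And>a b. a \<in> cball x0 r \<Longrightarrow> b \<in> cball x0 r \<Longrightarrow> norm (b - a) < d \<Longrightarrow>
      norm (A b - A a - A' a (b - a)) \<le> e * norm (b - a)"
proof -
  have "uniformly_continuous_on (cball x0 r) A'"
    by (rule compact_uniformly_continuous[OF cont compact_cball])
  then obtain d where d: "d > 0" "\<And>a b. a \<in> cball x0 r \<Longrightarrow> b \<in> cball x0 r \<Longrightarrow> dist b a < d \<Longrightarrow> dist (A'
      b) (A' a) < e"
    unfolding uniformly_continuous_on_def using assms by blast
  show thesis
  proof (rule that[OF d(1)])
    fix a b assume ab: "a \<in> cball x0 r" "b \<in> cball x0 r" "norm (b - a) < d"
    have sub: "closed_segment a b \<subseteq> cball x0 r" using ab by (intro closed_segment_subset) auto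
    have "norm (A b - A a - A' a (b - a)) \<le> norm (b - a) * e"
    proof (rule differentiable_bound_linearization[where S = "closed_segment a b"])
      show "a + t *\<^sub>R (b - a) \<in> closed_segment a b" if "t \<in> {0..1}" for t
        using that by (auto simp: closed_segment_def algebra_simps intro!: exI[of _ t])
      show "(A has_derivative A' x) (at x within closed_segment a b)" if "x \<in> closed_segment a b"
          for x
        using deriv sub that by (blast intro: has_derivative_at_withinI)
      show "onorm (blinfun_apply (A' x) - blinfun_apply (A' a)) \<le> e" if "x \<in> closed_segment a b"
          for x
      proof -
        have "dist x a < d"
          using that ab(3) segment_bound1[OF that] by (simp add: dist_norm)
        then have "norm (A' x - A' a) < e" using d(2) ab sub that unfolding dist_norm by blast
        then show ?thesis by (simp add: norm_blinfun.rep_eq minus_blinfun.rep_eq fun_diff_def)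
      qed
    qed simp
    then show "norm (A b - A a - A' a (b - a)) \<le> e * norm (b - a)" by (simp add: mult.commute)
  qed
qed

lemma bound': obtains K' where "\<And>x. x \<in> cball x0 r \<Longrightarrow> norm (A' x) \<le> K'" "K' \<ge> 0"
proof -
  have "bounded (A' ` cball x0 r)"
    by (intro compact_imp_bounded compact_continuous_image cont compact_cball)
  then obtain K' where K': "\<And>x. x \<in> cball x0 r \<Longrightarrow> norm (A' x) \<le> K'"
    unfolding bounded_iff by blast
  have "K' \<ge> 0" using order_trans[OF norm_ge_zero K'[of x0]] r by simp
  with K' that show thesis by blast
qed

text \<open>For \<open>y\<close> near \<open>x\<close>, the solution on the ray to \<open>y\<close>
  is compared with its first order prediction from the ray to \<open>x\<close>. The error vanishes
  at time \<open>0\<close> and obeys a differential inequality whose inhomogeneous term is small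
  compared with \<open>norm (y - x)\<close>; its value at time \<open>1\<close> is the remainder in
  the claimed derivative.\<close>

lemma solution_exists:
  obtains u where "u x0 = u0" "\<And>x. x \<in> ball x0 r \<Longrightarrow> (u has_derivative (\<lambda>h. A x h (u x))) (at x)"
proof -
  obtain u where u: "continuous_on UNIV u" "\<And>x. u x = picard u0 u x" "bounded (range u)"
    using fixed_point_exists by blast
  obtain B where B: "\<And>x. norm (u x) \<le> B" using u(3) by (auto simp: bounded_iff)
  have B0: "B \<ge> 0" using order_trans[OF norm_ge_zero B] .
  obtain K' where K': "\<And>x. x \<in> cball x0 r \<Longrightarrow> norm (A' x) \<le> K'" "K' \<ge> 0" using bound' by blast
  have A'_apply: "norm (A' x h k v) \<le> K' * norm h * norm k * norm v" if "x \<in> cball x0 r" for x h k v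
  proof -
    have "norm (A' x h k v) \<le> norm (A' x h k) * norm v" by (rule norm_blinfun)
    also have "\<dots> \<le> (norm (A' x h) * norm k) * norm v" by (intro mult_right_mono norm_blinfun) auto
    also have "\<dots> \<le> (norm (A' x) * norm h * norm k) * norm v" by (intro mult_right_mono
        norm_blinfun) auto
    also have "\<dots> \<le> K' * norm h * norm k * norm v" using K'(1)[OF that] by (intro mult_right_mono)
        auto
    finally show ?thesis .
  qed
  have "u x0 = u0"
    using u(2)[of x0] r by (simp add: picard_def proj_self)
  moreover have "(u has_derivative (\<lambda>h. A x h (u x))) (at x)" if x: "x \<in> ball x0 r" for x
    unfolding has_derivative_at_alt
  proof (intro conjI allI impI)
    show "bounded_linear (\<lambda>h. A x h (u x))"
      by (rule bounded_linear_compose[OF blinfun.bounded_linear_left blinfun.bounded_linear_right])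
  next
    fix e :: real assume "e > 0"
    \<comment> \<open>The summands are the coefficients of the error terms estimated below: the
      remainder of \<open>A\<close> contributes those with \<open>r * (B + K * B)\<close>, the terms
      of second order in \<open>h\<close> the next three. The final \<open>1\<close> makes
      \<open>C\<close> positive.\<close>
    define C where "C = r * B + r * K * B + K * K * B + K' * B + K' * r * K * B + 1"
    have C: "C > 0" unfolding C_def using r K_nonneg B0 K'(2) by (intro add_nonneg_pos
        add_nonneg_nonneg mult_nonneg_nonneg) auto
    \<comment> \<open>Chosen so that \<open>2 * C * e' = e\<close>, the factor \<open>2\<close>
      coming from the absorption of half of the maximal error.\<close>
    define e' where "e' = e / (2 * C)"
    have e': "e' > 0" using C \<open>e > 0\<close> by (simp add: e'_def)
    obtain d1 where d1: "d1 > 0" "\<And>a b. a \<in> cball x0 r \<Longrightarrow> b \<in> cball x0 r \<Longrightarrow> norm (b - a) < d1 \<Longrightarrow>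
      norm (A b - A a - A' a (b - a)) \<le> e' * norm (b - a)"
      using linearization[OF e'] by blast
    obtain d2 where d2: "d2 > 0" "ball x d2 \<subseteq> ball x0 r"
      using x open_contains_ball_eq open_ball by metis
    \<comment> \<open>\<open>d1\<close> is for the linearization, \<open>d2\<close> keeps
      \<open>y\<close> in the ball, \<open>e'\<close> turns a square of \<open>norm (y - x)\<close>
      into \<open>e'\<close> times that norm, and \<open>1\<close> bounds the predicted
      value.\<close>
    define d where "d = Min {d1, d2, e', 1}"
    have "d > 0" using d1 d2 e' by (simp add: d_def)
    moreover have "norm (u y - u x - A x (y - x) (u x)) \<le> e * norm (y - x)" if y: "norm (y - x) <
        d" for y
    proof -
      let ?n = "norm (y - x)"
      have n: "?n < d1" "?n < d2" "?n \<le> e'" "?n \<le> 1" "?n \<ge> 0" using y by (auto simp: d_def)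
      have xc: "x \<in> cball x0 r" using x by auto
      have yc: "y \<in> cball x0 r" using d2(2) n(2) by (auto simp: dist_norm norm_minus_commute)
      define h where "h = y - x"
      define p where "p = ray x"
      define q where "q = ray y"
      have pc: "p t \<in> cball x0 r" and qc: "q t \<in> cball x0 r" if "t \<in> {0..1}" for t
        using ray_in[OF xc] ray_in[OF yc] that unfolding p_def q_def by auto
      have qp: "q t - p t = t *\<^sub>R h" for t by (simp add: p_def q_def ray_def h_def algebra_simps)
      \<comment> \<open>The error of the first order expansion along the ray to \<open>y\<close>; in its derivative the
        terms linear in \<open>h\<close> cancel by integrability.\<close>
      define z where "z t = u (q t) - u (p t) - t *\<^sub>R A (p t) h (u (p t))" for t
      define z' where "z' t = A (q t) (y - x0) (u (q t)) - A (p t) (x - x0) (u (p t))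
        - (A (p t) h (u (p t)) + t *\<^sub>R (A (p t) h (A (p t) (x - x0) (u (p t))) + A' (p t) (x - x0)
            h (u (p t))))" for t
      have dp: "((\<lambda>s. u (p s)) has_vector_derivative A (p s) (x - x0) (u (p s))) (at s within
          {0..1})"
        and dq: "((\<lambda>s. u (q s)) has_vector_derivative A (q s) (y - x0) (u (q s))) (at s within
            {0..1})"
        if "s \<in> {0..1}" for s
        unfolding p_def q_def using ray_derivative[OF u(1,2) xc that] ray_derivative[OF u(1,2) yc
            that] .
      have dAp: "((\<lambda>s. A (p s)) has_vector_derivative A' (p s) (x - x0)) (at s within {0..1})"
        if "s \<in> {0..1}" for s
      proof -
        have "(p has_derivative (\<lambda>t. t *\<^sub>R (x - x0))) (at s)"
          unfolding p_def ray_def by (auto intro!: derivative_eq_intros)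
        from has_derivative_compose[OF this deriv[OF pc[OF that]]]
        show ?thesis by (simp add: has_vector_derivative_def blinfun.scaleR_right
            has_derivative_at_withinI)
      qed
      have dz: "(z has_vector_derivative z' s) (at s within {0..1})" if s: "s \<in> {0..1}" for s
      proof -
        have "((\<lambda>s. A (p s) h) has_vector_derivative A' (p s) (x - x0) h) (at s within {0..1})"
          by (rule bounded_linear.has_vector_derivative[OF blinfun.bounded_linear_left dAp[OF s]])
        from blinfun.has_vector_derivative[OF this dp[OF s]]
        have "((\<lambda>s. A (p s) h (u (p s))) has_vector_derivative
          A (p s) h (A (p s) (x - x0) (u (p s))) + A' (p s) (x - x0) h (u (p s))) (at s within
              {0..1})" .
        from has_vector_derivative_scaleR[OF DERIV_ident this]
        have "((\<lambda>s. s *\<^sub>R A (p s) h (u (p s))) has_vector_derivative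
          s *\<^sub>R (A (p s) h (A (p s) (x - x0) (u (p s))) + A' (p s) (x - x0) h (u (p s)))
            + 1 *\<^sub>R A (p s) h (u (p s))) (at s within {0..1})" .
        from has_vector_derivative_diff[OF has_vector_derivative_diff[OF dq[OF s] dp[OF s]] this]
        show ?thesis unfolding z_def z'_def by (simp add: add.commute)
      qed
      have cz: "continuous_on {0..1} z"
        unfolding continuous_on_eq_continuous_within
        by (intro ballI has_vector_derivative_continuous[OF dz])
      \<comment> \<open>The derivative of \<open>z\<close> will be bounded by means of the maximum
        of \<open>norm z\<close>, so that a plain mean value inequality takes the place of
        Gronwall's lemma.\<close>
      obtain s where s: "s \<in> {0..1}" "\<And>t. t \<in> {0..1} \<Longrightarrow> norm (z t) \<le> norm (z s)"
        using continuous_attains_sup[OF compact_Icc _ continuous_on_norm[OF cz]] by fastforce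
      have z'_bound: "norm (z' t) \<le> 1 / 2 * norm (z s) + C * e' * ?n" if t: "t \<in> {0..1}" for t
      proof -
        let ?Ap = "A (p t)" and ?Aq = "A (q t)" and ?up = "u (p t)" and ?X = "x - x0"
        define rho where "rho = ?Aq - ?Ap - A' (p t) (t *\<^sub>R h)"
        have Aq: "?Aq = ?Ap + t *\<^sub>R A' (p t) h + rho" by (simp add: rho_def blinfun.scaleR_right)
        have th: "norm (t *\<^sub>R h) \<le> ?n" using t by (auto simp: h_def intro: mult_left_le_one_le)
        have rho: "norm rho \<le> e' * ?n"
        proof -
          have "norm rho \<le> e' * norm (q t - p t)"
            unfolding rho_def qp[symmetric] using d1(2)[OF pc[OF t] qc[OF t]] th n(1) by (simp
                add: qp)
          also have "\<dots> \<le> e' * ?n" using th e' by (simp add: qp)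
          finally show ?thesis .
        qed
        have uq: "u (q t) = z t + (?up + t *\<^sub>R ?Ap h ?up)" by (simp add: z_def)
        have yX: "y - x0 = ?X + h" by (simp add: h_def)
        define v where "v = ?up + t *\<^sub>R ?Ap h ?up"
        \<comment> \<open>The derivative is sorted into a part linear in \<open>z\<close>, the
          remainder of \<open>A\<close>, terms of second order in \<open>h\<close>, and a difference
          in which \<open>h\<close> and \<open>x - x0\<close> are exchanged; that difference is
          \<open>0\<close> by \<open>integrable\<close>.\<close>
        have "z' t = ?Aq (y - x0) (z t) + rho (y - x0) v + t *\<^sub>R (?Ap h (?Ap h ?up) + A' (p t) h h
            ?up
            + t *\<^sub>R A' (p t) h (y - x0) (?Ap h ?up))
            + t *\<^sub>R ((A' (p t) h ?X ?up + ?Ap ?X (?Ap h ?up)) - (A' (p t) ?X h ?up + ?Ap h (?Ap ?X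
                ?up)))"
          unfolding z'_def uq v_def[symmetric] unfolding Aq yX
          by (simp add: v_def blinfun.bilinear_simps algebra_simps)
        also have "\<dots> = ?Aq (y - x0) (z t) + (rho (y - x0) v + t *\<^sub>R (?Ap h (?Ap h ?up) + A' (p t)
            h h ?up
            + t *\<^sub>R A' (p t) h (y - x0) (?Ap h ?up)))"
          using integrable[OF pc[OF t], of h ?X ?up] by simp
        finally have z'_eq: "z' t = ?Aq (y - x0) (z t) + (rho (y - x0) v + t *\<^sub>R (?Ap h (?Ap h
            ?up) + A' (p t) h h ?up
            + t *\<^sub>R A' (p t) h (y - x0) (?Ap h ?up)))" .
        have nh: "norm h = ?n" by (simp add: h_def)
        have yr: "norm (y - x0) \<le> r" using yc by (simp add: dist_norm norm_minus_commute)
        have Ah: "norm (?Ap h w) \<le> K * ?n * norm w" for w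
          using norm_A_apply[OF pc[OF t], of h w] by (simp add: nh)
        have Ahu: "norm (?Ap h ?up) \<le> K * ?n * B"
          using order_trans[OF Ah mult_left_mono[OF B]] K_nonneg by simp
        have scal: "norm (t *\<^sub>R w) \<le> norm w" for w :: 'g
          using t by (auto intro: mult_left_le_one_le)
        have v: "norm v \<le> B + K * B"
        proof -
          have "norm v \<le> norm ?up + norm (t *\<^sub>R ?Ap h ?up)" unfolding v_def by (rule
              norm_triangle_ineq)
          also have "\<dots> \<le> B + K * ?n * B" using B scal Ahu by (intro add_mono) (auto intro:
              order_trans)
          also have "\<dots> \<le> B + K * 1 * B" using n K_nonneg B0 by (intro add_mono mult_right_mono
              mult_left_mono) auto
          finally show ?thesis by simp
        qed
        have 1: "norm (rho (y - x0) v) \<le> (e' * ?n) * r * (B + K * B)"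
        proof -
          have "norm (rho (y - x0) v) \<le> norm (rho (y - x0)) * norm v" by (rule norm_blinfun)
          also have "\<dots> \<le> (norm rho * norm (y - x0)) * norm v" by (intro mult_right_mono
              norm_blinfun) auto
          also have "\<dots> \<le> ((e' * ?n) * r) * (B + K * B)"
            using rho yr v e' r by (intro mult_mono) auto
          finally show ?thesis .
        qed
        have 2: "norm (?Ap h (?Ap h ?up)) \<le> (K * K * B) * (?n * ?n)"
          using order_trans[OF Ah mult_left_mono[OF Ahu]] K_nonneg n by (simp add: ac_simps)
        have 3: "norm (A' (p t) h h ?up) \<le> (K' * B) * (?n * ?n)"
          using order_trans[OF A'_apply[OF pc[OF t], of h h ?up] mult_left_mono[OF B]] K'(2) n by
              (simp add: ac_simps nh)
        have 4: "norm (t *\<^sub>R A' (p t) h (y - x0) (?Ap h ?up)) \<le> (K' * r * K * B) * (?n * ?n)"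
        proof -
          have "norm (t *\<^sub>R A' (p t) h (y - x0) (?Ap h ?up)) \<le> norm (A' (p t) h (y - x0) (?Ap h
              ?up))" by (rule scal)
          also have "\<dots> \<le> K' * norm h * norm (y - x0) * norm (?Ap h ?up)" by (rule A'_apply[OF
              pc[OF t]])
          also have "\<dots> \<le> K' * ?n * r * (K * ?n * B)"
            unfolding nh using yr Ahu K'(2) n r by (intro mult_mono) auto
          finally show ?thesis by (simp add: ac_simps)
        qed
        have "norm (rho (y - x0) v + t *\<^sub>R (?Ap h (?Ap h ?up) + A' (p t) h h ?up + t *\<^sub>R A' (p t)
            h (y - x0) (?Ap h ?up)))
          \<le> norm (rho (y - x0) v) + norm (?Ap h (?Ap h ?up) + A' (p t) h h ?up + t *\<^sub>R A' (p t) h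
              (y - x0) (?Ap h ?up))"
          using norm_triangle_ineq scal by (meson add_left_mono order_trans)
        also have "\<dots> \<le> norm (rho (y - x0) v) + (norm (?Ap h (?Ap h ?up)) + norm (A' (p t) h h ?up)
            + norm (t *\<^sub>R A' (p t) h (y - x0) (?Ap h ?up)))"
          by (intro add_left_mono order_trans[OF norm_triangle_ineq] add_right_mono
              norm_triangle_ineq)
        also have "\<dots> \<le> (e' * ?n) * r * (B + K * B) + ((K * K * B) * (?n * ?n) + (K' * B) * (?n *
            ?n) + (K' * r * K * B) * (?n * ?n))"
          by (intro add_mono 1 2 3 4)
        also have "\<dots> \<le> (e' * ?n) * r * (B + K * B) + ((K * K * B) * (e' * ?n) + (K' * B) * (e' *
            ?n) + (K' * r * K * B) * (e' * ?n))"
          using n K_nonneg B0 K'(2) r by (intro add_mono mult_left_mono mult_right_mono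
              order_refl) auto
        also have "\<dots> \<le> C * e' * ?n" unfolding C_def using e' n(5) by (simp add: algebra_simps)
        finally have R: "norm (rho (y - x0) v + t *\<^sub>R (?Ap h (?Ap h ?up) + A' (p t) h h ?up + t
            *\<^sub>R A' (p t) h (y - x0) (?Ap h ?up))) \<le> C * e' * ?n" .
        have "norm (?Aq (y - x0) (z t)) \<le> 1 / 2 * norm (z t)"
          by (rule integrand_bound[OF qc[OF t] yc])
        also have "\<dots> \<le> 1 / 2 * norm (z s)" using s(2)[OF t] by simp
        finally show ?thesis unfolding z'_eq using R by (meson add_mono norm_triangle_ineq
            order_trans)
      qed
      \<comment> \<open>Both rays start at \<open>x0\<close>, so \<open>z 0 = 0\<close>, and half of
        \<open>norm (z s)\<close> can be moved to the left.\<close>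
      have "norm (z s - z 0) \<le> (1 / 2 * norm (z s) + C * e' * ?n) * norm (s - 0)"
      proof (rule differentiable_bound[of "{0..1}" z "\<lambda>t v. v *\<^sub>R z' t"])
        fix t :: real assume t: "t \<in> {0..1}"
        show "(z has_derivative (\<lambda>v. v *\<^sub>R z' t)) (at t within {0..1})"
          using dz[OF t] by (simp add: has_vector_derivative_def)
        show "onorm (\<lambda>v. v *\<^sub>R z' t) \<le> 1 / 2 * norm (z s) + C * e' * ?n"
          using z'_bound[OF t] C e' n(5) by (intro onorm_bound) (auto simp: mult.commute intro!:
              mult_left_mono add_nonneg_nonneg)
      qed (use s in auto)
      also have "\<dots> \<le> (1 / 2 * norm (z s) + C * e' * ?n) * 1"
        using s(1) C e' n(5) by (intro mult_left_mono) auto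
      finally have "norm (z s) \<le> 2 * C * e' * ?n" by (simp add: z_def p_def q_def)
      moreover have "norm (z 1) \<le> norm (z s)" by (rule s(2)) auto
      moreover have "2 * C * e' = e" using C by (simp add: e'_def)
      ultimately show ?thesis by (simp add: z_def p_def q_def h_def)
    qed
    ultimately show "\<exists>d>0. \<forall>y. norm (y - x) < d \<longrightarrow> norm (u y - u x - A x (y - x) (u x)) \<le> e * norm
        (y - x)"
      by blast
  qed
  ultimately show thesis by (rule that)
qed

end

section \<open>Local solutions of integrable linear systems\<close>

lemma total_linear_ode_local_solution:
  fixes A :: "'e::euclidean_space \<Rightarrow> 'e \<Rightarrow>\<^sub>L 'g \<Rightarrow>\<^sub>L 'g::banach"
    and A' :: "'e \<Rightarrow> 'e \<Rightarrow>\<^sub>L 'e \<Rightarrow>\<^sub>L 'g \<Rightarrow>\<^sub>L 'g"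
  assumes S: "open S" "x0 \<in> S"
    and deriv: "\<And>x. x \<in> S \<Longrightarrow> (A has_derivative A' x) (at x)"
    and cont: "continuous_on S A'"
    and integrable: "\<And>x h k u. x \<in> S \<Longrightarrow>
      A' x h k u + A x k (A x h u) = A' x k h u + A x h (A x k u)"
  obtains r u where "r > 0" "ball x0 r \<subseteq> S" "u x0 = u0"
    "\<And>x. x \<in> ball x0 r \<Longrightarrow> (u has_derivative (\<lambda>h. A x h (u x))) (at x)"
proof -
  obtain R where R: "R > 0" "cball x0 R \<subseteq> S" using S open_contains_cball_eq by metis
  have "continuous_on (cball x0 R) A"
    by (rule has_derivative_continuous_on[OF has_derivative_at_withinI[OF deriv]]) (use R in auto)
  then have "bounded (A ` cball x0 R)"
    by (intro compact_imp_bounded compact_continuous_image compact_cball)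
  then obtain K where K: "\<And>x. x \<in> cball x0 R \<Longrightarrow> norm (A x) \<le> K"
    unfolding bounded_iff by blast
  have K0: "K \<ge> 0" using order_trans[OF norm_ge_zero K[of x0]] R by simp
  \<comment> \<open>\<open>K + 1\<close> keeps the denominator positive. The bound \<open>K\<close>
    was obtained on the larger ball and is inherited by the smaller one.\<close>
  define r where "r = min R (1 / (2 * (K + 1)))"
  have r: "r > 0" "cball x0 r \<subseteq> cball x0 R" using R K0 by (auto simp: r_def)
  have "K * r \<le> K * (1 / (2 * (K + 1)))" using K0 by (intro mult_left_mono) (auto simp: r_def)
  also have "\<dots> \<le> 1 / 2" using K0 by (simp add: divide_simps)
  finally have small: "K * r \<le> 1 / 2" .
  interpret total_linear_ode A A' x0 r K
    by unfold_locales (use r R K deriv small integrable continuous_on_subset[OF cont] in blast)+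
  obtain u where "u x0 = u0" "\<And>x. x \<in> ball x0 r \<Longrightarrow> (u has_derivative (\<lambda>h. A x h (u x))) (at x)"
    using solution_exists by blast
  moreover have "ball x0 r \<subseteq> S" using \<open>cball x0 r \<subseteq> cball x0 R\<close> R(2) ball_subset_cball[of x0 r] by
      blast
  ultimately show thesis using that r(1) by blast
qed

lemma bilinear_expand:
  fixes h :: "'a::euclidean_space" and k :: "'b::euclidean_space"
  assumes "bilinear p"
  shows "p h k = (\<Sum>b\<in>Basis. \<Sum>c\<in>Basis. ((h \<bullet> b) * (k \<bullet> c)) *\<^sub>R p b c)"
proof -
  have "p (\<Sum>b\<in>Basis. (h \<bullet> b) *\<^sub>R b) (\<Sum>c\<in>Basis. (k \<bullet> c) *\<^sub>R c)
    = (\<Sum>b\<in>Basis. \<Sum>c\<in>Basis. p ((h \<bullet> b) *\<^sub>R b) ((k \<bullet> c) *\<^sub>R c))"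
    by (simp add: bilinear_sum[OF assms] sum.cartesian_product)
  then show ?thesis
    by (simp add: euclidean_representation bilinear_lmul[OF assms] bilinear_rmul[OF assms]
        mult.commute)
qed

lemma continuous_on_Blinfun_derivative:
  assumes "smooth_on S f"
  shows "continuous_on S (\<lambda>x. Blinfun (frechet_derivative f (at x)))"
proof (rule continuous_on_blinfun_componentwise)
  fix b
  show "continuous_on S (\<lambda>x. Blinfun (frechet_derivative f (at x)) b)"
    by (rule continuous_on_eq[OF smooth_on_imp_continuous_on[OF smooth_on_deriv[OF assms, of b]]])
      (simp add: bounded_linear_Blinfun_apply smooth_on_linear_derivative[OF assms])
qed

text \<open>Here the coefficients are given, as for Christoffel symbols, by functions that are
  smooth for each fixed pair of arguments; the operator-valued coefficient of the preceding lemma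
  has to be assembled from them.\<close>

lemma linear_pde_local_solution:
  fixes \<Phi> :: "'e::euclidean_space \<Rightarrow> 'e \<Rightarrow> 'g \<Rightarrow> 'g::euclidean_space"
  assumes S: "open S" "x0 \<in> S"
    and bil: "\<And>x. x \<in> S \<Longrightarrow> bilinear (\<Phi> x)"
    and smooth: "\<And>h u. smooth_on S (\<lambda>x. \<Phi> x h u)"
    and integrable: "\<And>x h k u. x \<in> S \<Longrightarrow>
      frechet_derivative (\<lambda>x. \<Phi> x k u) (at x) h + \<Phi> x k (\<Phi> x h u)
        = frechet_derivative (\<lambda>x. \<Phi> x h u) (at x) k + \<Phi> x h (\<Phi> x k u)"
  obtains r u where "r > 0" "ball x0 r \<subseteq> S" "u x0 = u0" "smooth_on (ball x0 r) u"
    "\<And>x. x \<in> ball x0 r \<Longrightarrow> (u has_derivative (\<lambda>h. \<Phi> x h (u x))) (at x)"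
proof -
  \<comment> \<open>Matrix units: \<open>A\<close> becomes a finite combination of constant
    operators with the scalar coefficients \<open>\<Phi> x b c \<bullet> d\<close>, so its
    smoothness is that of these coefficients.\<close>
  define N :: "'e \<Rightarrow> 'g \<Rightarrow> 'g \<Rightarrow> 'e \<Rightarrow>\<^sub>L 'g \<Rightarrow>\<^sub>L 'g"
    where "N b c d = Blinfun (\<lambda>h. (h \<bullet> b) *\<^sub>R Blinfun (\<lambda>u. (u \<bullet> c) *\<^sub>R d))" for b c d
  have N: "N b c d h u = ((h \<bullet> b) * (u \<bullet> c)) *\<^sub>R d" for b c d h u
    unfolding N_def
    by (simp add: bounded_linear_Blinfun_apply bounded_linear_scaleR_const bounded_linear_inner_left
        scaleR_blinfun.rep_eq)
  define A where "A x = (\<Sum>b\<in>Basis. \<Sum>c\<in>Basis. \<Sum>d\<in>Basis. (\<Phi> x b c \<bullet> d) *\<^sub>R N b c d)" for x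
  have sA: "smooth_on S A"
    unfolding A_def
    by (intro smooth_on_sum smooth_on_scaleR smooth_on_const smooth_on_inner smooth S(1)
        finite_Basis)
  have A: "A x h u = \<Phi> x h u" if "x \<in> S" for x h u
  proof -
    have "A x h u = (\<Sum>b\<in>Basis. \<Sum>c\<in>Basis. ((h \<bullet> b) * (u \<bullet> c)) *\<^sub>R (\<Sum>d\<in>Basis. (\<Phi> x b c \<bullet> d) *\<^sub>R d))"
      by (simp add: A_def blinfun.sum_left blinfun.scaleR_left N scaleR_sum_right ac_simps)
    then show ?thesis
      using bilinear_expand[OF bil[OF that], of h u] by (simp add: euclidean_representation)
  qed
  define A' where "A' x = Blinfun (frechet_derivative A (at x))" for x
  have A'_apply: "blinfun_apply (A' x) = frechet_derivative A (at x)" if "x \<in> S" for x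
    unfolding A'_def by (rule bounded_linear_Blinfun_apply[OF smooth_on_linear_derivative[OF sA
        that]])
  have A': "A' x h k u = frechet_derivative (\<lambda>x. \<Phi> x k u) (at x) h" if x: "x \<in> S" for x h k u
  proof -
    have "frechet_derivative (\<lambda>x. \<Phi> x k u) (at x) h = frechet_derivative (\<lambda>x. A x k u) (at x) h"
      using frechet_derivative_cong_open(2)[OF S(1) x, of "\<lambda>x. \<Phi> x k u" "\<lambda>x. A x k u"] A by simp
    also have "\<dots> = frechet_derivative A (at x) h k u"
      by (rule frechet_derivative_bounded_linear_compose[of "\<lambda>T. blinfun_apply (blinfun_apply T k)
          u" A x])
        (use smooth_on_has_derivative[OF sA x] in \<open>auto simp: differentiable_def
          intro: bounded_linear_compose[OF blinfun.bounded_linear_left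
              blinfun.bounded_linear_left]\<close>)
    finally show ?thesis using A'_apply[OF x] by simp
  qed
  obtain r u where r: "r > 0" "ball x0 r \<subseteq> S" and u0: "u x0 = u0"
    and u: "\<And>x. x \<in> ball x0 r \<Longrightarrow> (u has_derivative (\<lambda>h. A x h (u x))) (at x)"
  proof (rule total_linear_ode_local_solution[OF S, of A A' u0])
    show "(A has_derivative A' x) (at x)" if "x \<in> S" for x
      using smooth_on_has_derivative[OF sA that] A'_apply[OF that] by simp
    show "continuous_on S A'"
      unfolding A'_def by (rule continuous_on_Blinfun_derivative[OF sA])
    show "A' x h k u + A x k (A x h u) = A' x k h u + A x h (A x k u)" if "x \<in> S" for x h k u
      using integrable[OF that] by (simp add: A[OF that] A'[OF that])
  qed blast
  have u': "(u has_derivative (\<lambda>h. \<Phi> x h (u x))) (at x)" if "x \<in> ball x0 r" for x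
    using u[OF that] A[of x] r that by (simp add: subset_iff)
  \<comment> \<open>The right hand side of the equation is as smooth as \<open>u\<close>, hence so is \<open>du\<close>.\<close>
  have "Ck_on k (ball x0 r) u" for k
  proof (induction k)
    case 0
    then show ?case
      using has_derivative_continuous_on[of "ball x0 r" u, OF has_derivative_at_withinI[OF u']] by
          simp
  next
    case (Suc k)
    show ?case
    proof (rule Ck_on_SucI[OF open_ball u'])
      fix h
      \<comment> \<open>The argument \<open>u x\<close> moves with \<open>x\<close>, whereas
        \<open>smooth\<close> speaks of fixed arguments; linearity separates the two
        dependences.\<close>
      have eq: "\<Phi> x h (u x) = (\<Sum>c\<in>Basis. (u x \<bullet> c) *\<^sub>R \<Phi> x h c)" if "x \<in> ball x0 r" for x
      proof -
        have "linear (\<Phi> x h)" using bil[of x] that r by (auto simp: bilinear_def)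
        then show ?thesis
          using bounded_linear_expand[of "\<Phi> x h" "u x"] by (simp add: linear_conv_bounded_linear)
      qed
      have s: "Ck_on k (ball x0 r) (\<lambda>x. \<Phi> x h c)" for c
        using smooth r Ck_on_subset unfolding smooth_on_def by blast
      show "Ck_on k (ball x0 r) (\<lambda>x. \<Phi> x h (u x))"
      proof (rule Ck_on_cong[OF open_ball])
        show "Ck_on k (ball x0 r) (\<lambda>x. \<Sum>c\<in>Basis. (u x \<bullet> c) *\<^sub>R \<Phi> x h c)"
          by (intro Ck_on_sum[OF open_ball] Ck_on_bilinear[OF bounded_bilinear_scaleR open_ball]
              Ck_on_bounded_linear[OF bounded_linear_inner_left open_ball] Suc s finite_Basis)
      qed (simp add: eq)
    qed
  qed
  then have "smooth_on (ball x0 r) u" by (simp add: smooth_on_def)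
  with r u0 u' that show thesis by blast
qed

section \<open>Local inverses and flat coordinates\<close>

text \<open>The inverse function theorem is used for a differentiable inverse \<open>g\<close> only.
  As the inverse of the derivative is given beforehand as a smooth field \<open>C\<close>, the
  derivative of \<open>g\<close> at \<open>y\<close> is \<open>C (g y)\<close>, and the order of
  differentiability of \<open>g\<close> climbs by induction.\<close>

lemma smooth_local_inverse:
  fixes f :: "'e::euclidean_space \<Rightarrow> 'e" and C :: "'e \<Rightarrow> 'e \<Rightarrow> 'e"
  assumes S: "open S" "x0 \<in> S" and f: "smooth_on S f"
    and C: "\<And>k. smooth_on S (\<lambda>x. C x k)" "\<And>x. x \<in> S \<Longrightarrow> linear (C x)"
    and inv: "\<And>x k. x \<in> S \<Longrightarrow> C x (frechet_derivative f (at x) k) = k"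
  obtains V where "open V" "x0 \<in> V" "V \<subseteq> S" "inj_on f V" "open (f ` V)"
    "smooth_on (f ` V) (inv_into V f)"
    "\<And>x. x \<in> V \<Longrightarrow> (inv_into V f has_derivative C x) (at (f x))"
proof -
  define f' where "f' x = Blinfun (frechet_derivative f (at x))" for x
  have f': "blinfun_apply (f' x) = frechet_derivative f (at x)" if "x \<in> S" for x
    unfolding f'_def by (rule bounded_linear_Blinfun_apply[OF smooth_on_linear_derivative[OF f
        that]])
  have C': "bounded_linear (C x)" if "x \<in> S" for x using C(2)[OF that] by (simp add:
      linear_conv_bounded_linear)
  obtain U V g g' where U: "open U" "U \<subseteq> S" "x0 \<in> U" and V: "open V" and hom: "homeomorphism U V f
      g"
    and g: "\<And>y. y \<in> V \<Longrightarrow> (g has_derivative (g' y)) (at y)"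
    and g': "\<And>y. y \<in> V \<Longrightarrow> g' y = Hilbert_Choice.inv (blinfun_apply (f' (g y)))"
    and bij: "\<And>y. y \<in> V \<Longrightarrow> bij (blinfun_apply (f' (g y)))"
  proof (rule inverse_function_theorem[OF S(1) _ _ S(2), of f f' "Blinfun (C x0)"])
    show "(f has_derivative blinfun_apply (f' x)) (at x)" if "x \<in> S" for x
      using smooth_on_has_derivative[OF f that] f'[OF that] by simp
    show "continuous_on S f'" unfolding f'_def by (rule continuous_on_Blinfun_derivative[OF f])
    show "Blinfun (C x0) o\<^sub>L f' x0 = id_blinfun"
      by (rule blinfun_eqI) (simp add: bounded_linear_Blinfun_apply C' S f' inv)
  qed blast
  have inj: "inj_on f U" and img: "f ` U = V"
    using hom by (auto simp: homeomorphism_def inj_on_def) metis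
  have inv_g: "inv_into U f y = g y" if "y \<in> V" for y
    using inj that hom img by (metis homeomorphism_apply1 f_inv_into_f inv_into_into)
  have gU: "g y \<in> U" if "y \<in> V" for y using that hom by (auto simp: homeomorphism_def)
  have gf: "g (f x) = x" if "x \<in> U" for x using that hom by (auto simp: homeomorphism_def)
  have gd: "(g has_derivative C (g y)) (at y)" if y: "y \<in> V" for y
  proof -
    have "g y \<in> S" using gU[OF y] U by blast
    \<comment> \<open>\<open>C\<close> is given as a left inverse; bijectivity of the derivative at
      points of the image makes it the inverse.\<close>
    have "g' y = C (g y)"
    proof
      fix k
      obtain v where v: "k = f' (g y) v" using bij[OF y] by (metis bij_pointE)
      have "g' y k = v" unfolding g'[OF y] v using bij[OF y] by (simp add: bij_is_inj)
      then show "g' y k = C (g y) k" using inv[OF \<open>g y \<in> S\<close>] v f'[OF \<open>g y \<in> S\<close>] by simp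
    qed
    then show ?thesis using g[OF y] by simp
  qed
  have "Ck_on k V g" for k
  proof (induction k)
    case 0
    then show ?case using has_derivative_continuous_on[of V g, OF has_derivative_at_withinI[OF
        gd]] by simp
  next
    case (Suc k)
    show ?case
    proof (rule Ck_on_SucI[OF V gd])
      fix v
      show "Ck_on k V (\<lambda>x. C (g x) v)"
        by (rule Ck_on_compose[OF V S(1) _ Suc])
          (use gU U C(1) in \<open>auto simp: smooth_on_def\<close>)
    qed
  qed
  then have "smooth_on V g" by (simp add: smooth_on_def)
  then have "smooth_on V (inv_into U f)" by (rule smooth_on_cong[OF V, rotated]) (simp add: inv_g)
  moreover have "(inv_into U f has_derivative C x) (at (f x))" if "x \<in> U" for x
  proof -
    have "f x \<in> V" using img that by auto
    from gd[OF this] have "(g has_derivative C x) (at (f x))" by (simp add: gf[OF that])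
    then show ?thesis
      by (rule has_derivative_transform_within_open[OF _ V \<open>f x \<in> V\<close>]) (simp add: inv_g)
  qed
  ultimately show thesis using that[of U] U V inj img by simp
qed

text \<open>\<open>\<Gamma> x h k\<close> are Christoffel symbols, the components of \<open>f\<close> are affine functions, and the columns
  of \<open>C x\<close> are parallel vector fields.\<close>

lemma flat_coordinates:
  fixes \<Gamma> :: "'e::euclidean_space \<Rightarrow> 'e \<Rightarrow> 'e \<Rightarrow> 'e"
  assumes S: "open S" "x0 \<in> S"
    and bil: "\<And>x. x \<in> S \<Longrightarrow> bilinear (\<Gamma> x)"
    and smooth: "\<And>h k. smooth_on S (\<lambda>x. \<Gamma> x h k)"
    and sym: "\<And>x h k. x \<in> S \<Longrightarrow> \<Gamma> x h k = \<Gamma> x k h"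
    and flat: "\<And>x h k l. x \<in> S \<Longrightarrow>
      frechet_derivative (\<lambda>x. \<Gamma> x k l) (at x) h + \<Gamma> x h (\<Gamma> x k l)
        = frechet_derivative (\<lambda>x. \<Gamma> x h l) (at x) k + \<Gamma> x k (\<Gamma> x h l)"
  obtains V f C r where "open V" "x0 \<in> V" "V \<subseteq> ball x0 r" "ball x0 r \<subseteq> S" "smooth_on V f" "inj_on
      f V"
    "open (f ` V)" "smooth_on (f ` V) (inv_into V f)"
    "\<And>x. x \<in> V \<Longrightarrow> (inv_into V f has_derivative C x) (at (f x))"
    "\<And>v x. \<forall>x\<in>ball x0 r. (v has_derivative (\<lambda>h. - \<Gamma> x h (v x))) (at x) \<Longrightarrow>
       x \<in> ball x0 r \<Longrightarrow> v x = C x (v x0)"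
    "\<And>x k. x \<in> ball x0 r \<Longrightarrow> ((\<lambda>x. C x k) has_derivative (\<lambda>h. - \<Gamma> x h (C x k))) (at x)"
    "\<And>k. C x0 k = k"
proof -
  have dG: "((\<lambda>x. \<Gamma> x h k) has_derivative frechet_derivative (\<lambda>x. \<Gamma> x h k) (at x)) (at x)" if "x \<in>
      S" for x h k
    by (rule smooth_on_has_derivative[OF smooth that])
  have dG_diff: "(\<lambda>x. \<Gamma> x h k) differentiable (at x)" if "x \<in> S" for x h k
    using dG[OF that] by (auto simp: differentiable_def)
  \<comment> \<open>The unknown is a function together with its differential. Covectors are
    represented by vectors through the inner product, so composition with
    \<open>\<Gamma> x h\<close> becomes its adjoint, written out in the basis.\<close>
  define \<Phi> where "\<Phi> x h u = (snd u \<bullet> h, \<Sum>d\<in>Basis. (\<Gamma> x h d \<bullet> snd u) *\<^sub>R d)" for x h and u :: "real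
      \<times> 'e"
  have inner: "(\<Sum>d\<in>Basis. (\<Gamma> x h d \<bullet> w) *\<^sub>R d) \<bullet> k = \<Gamma> x h k \<bullet> w" if "x \<in> S" for x h k w
  proof -
    have "linear (\<Gamma> x h)" using bil[OF that] by (auto simp: bilinear_def)
    then have "\<Gamma> x h k = (\<Sum>d\<in>Basis. (k \<bullet> d) *\<^sub>R \<Gamma> x h d)"
      using bounded_linear_expand[of "\<Gamma> x h" k] by (simp add: linear_conv_bounded_linear)
    then show ?thesis by (simp add: inner_sum_left inner_commute[of k] mult.commute)
  qed
  have "\<forall>b. \<exists>r u. r > 0 \<and> ball x0 r \<subseteq> S \<and> u x0 = (0, b) \<and> smooth_on (ball x0 r) u \<and>
    (\<forall>x\<in>ball x0 r. (u has_derivative (\<lambda>h. \<Phi> x h (u x))) (at x))"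
  proof
    fix b
    have der: "frechet_derivative (\<lambda>x. \<Phi> x k u) (at x) h
        = (0, \<Sum>d\<in>Basis. (frechet_derivative (\<lambda>x. \<Gamma> x k d) (at x) h \<bullet> snd u) *\<^sub>R d)" if "x \<in> S" for
            x h k u
    proof -
      have "((\<lambda>x. \<Phi> x k u) has_derivative
        (\<lambda>h. (0, \<Sum>d\<in>Basis. (frechet_derivative (\<lambda>x. \<Gamma> x k d) (at x) h \<bullet> snd u) *\<^sub>R d))) (at x)"
        unfolding \<Phi>_def
        by (intro has_derivative_Pair has_derivative_const has_derivative_sum
            has_derivative_scaleR_left has_derivative_inner_left dG[OF that])
      from fun_cong[OF frechet_derivative_at[OF this], of h] show ?thesis by simp
    qed
    have snd_\<Phi>: "(snd (\<Phi> x h u)) \<bullet> k = \<Gamma> x h k \<bullet> snd u" if "x \<in> S" for x h k u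
      using inner[OF that] by (simp add: \<Phi>_def)
    show "\<exists>r u. r > 0 \<and> ball x0 r \<subseteq> S \<and> u x0 = (0, b) \<and> smooth_on (ball x0 r) u \<and>
      (\<forall>x\<in>ball x0 r. (u has_derivative (\<lambda>h. \<Phi> x h (u x))) (at x))"
    proof (rule linear_pde_local_solution[OF S, of \<Phi> "(0, b)"])
      show "bilinear (\<Phi> x)" if "x \<in> S" for x
        unfolding \<Phi>_def bilinear_def using bil[OF that]
        by (auto intro!: linearI simp: bilinear_ladd bilinear_lmul inner_add_right inner_add_left
            scaleR_add_left sum.distrib scaleR_sum_right)
      have pair: "smooth_on S (\<lambda>x. (c, w x) :: real \<times> 'e)" if "smooth_on S w" for c w
      proof -
        have "smooth_on S (\<lambda>x. (c, 0) + (0, w x))"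
          by (intro smooth_on_add smooth_on_const S smooth_on_bounded_linear[OF _ S(1) that]
              bounded_linear_Pair bounded_linear_zero bounded_linear_ident)
        then show ?thesis by simp
      qed
      show "smooth_on S (\<lambda>x. \<Phi> x h u)" for h u
        unfolding \<Phi>_def
        by (intro pair smooth_on_sum smooth_on_scaleR smooth_on_inner smooth_on_const smooth S
            finite_Basis)
      show "frechet_derivative (\<lambda>x. \<Phi> x k u) (at x) h + \<Phi> x k (\<Phi> x h u)
        = frechet_derivative (\<lambda>x. \<Phi> x h u) (at x) k + \<Phi> x h (\<Phi> x k u)" if x: "x \<in> S" for x h k u
      proof -
        \<comment> \<open>Compatibility splits by components: the first is the symmetry of
          \<open>\<Gamma>\<close>, that is vanishing torsion, and the second is \<open>flat\<close>,
          that is vanishing curvature, paired with \<open>snd u\<close>.\<close>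
        have "\<Phi> x k (\<Phi> x h u) = (\<Gamma> x h k \<bullet> snd u, \<Sum>d\<in>Basis. (\<Gamma> x h (\<Gamma> x k d) \<bullet> snd u) *\<^sub>R d)" for
            h k
          unfolding \<Phi>_def[of x k] using snd_\<Phi>[OF x, of h u] by (simp add: inner_commute)
        moreover have "(\<Sum>d\<in>Basis. (frechet_derivative (\<lambda>x. \<Gamma> x k d) (at x) h \<bullet> snd u) *\<^sub>R d)
            + (\<Sum>d\<in>Basis. (\<Gamma> x h (\<Gamma> x k d) \<bullet> snd u) *\<^sub>R d)
          = (\<Sum>d\<in>Basis. (frechet_derivative (\<lambda>x. \<Gamma> x h d) (at x) k \<bullet> snd u) *\<^sub>R d)
            + (\<Sum>d\<in>Basis. (\<Gamma> x k (\<Gamma> x h d) \<bullet> snd u) *\<^sub>R d)"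
          unfolding sum.distrib[symmetric] scaleR_add_left[symmetric] inner_add_left[symmetric]
          by (intro sum.cong refl) (simp add: flat[OF x])
        ultimately show ?thesis using sym[OF x, of h k] by (simp add: der[OF x])
      qed
    qed blast
  qed
  from choice[OF this] obtain r1 where "\<forall>b. \<exists>u. r1 b > 0 \<and> ball x0 (r1 b) \<subseteq> S \<and> u x0 = (0, b) \<and>
    smooth_on (ball x0 (r1 b)) u \<and>
    (\<forall>x\<in>ball x0 (r1 b). (u has_derivative (\<lambda>h. \<Phi> x h (u x))) (at x))"
    by blast
  from choice[OF this] obtain u where u: "\<And>b. r1 b > 0" "\<And>b. ball x0 (r1 b) \<subseteq> S" "\<And>b. u b x0 = (0,
      b)"
      "\<And>b. smooth_on (ball x0 (r1 b)) (u b)"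
      "\<And>b x. x \<in> ball x0 (r1 b) \<Longrightarrow> (u b has_derivative (\<lambda>h. \<Phi> x h (u b x))) (at x)"
    by blast
  \<comment> \<open>The second system, for parallel vector fields. Its sign is opposite to that of
    the covector system, which will make pairings of solutions constant.\<close>
  have "\<forall>b. \<exists>r v. r > 0 \<and> ball x0 r \<subseteq> S \<and> v x0 = b \<and> smooth_on (ball x0 r) v \<and>
    (\<forall>x\<in>ball x0 r. (v has_derivative (\<lambda>h. - \<Gamma> x h (v x))) (at x))"
  proof (intro allI, rule linear_pde_local_solution[OF S, of "\<lambda>x h v. - \<Gamma> x h v"])
    show "bilinear (\<lambda>h v. - \<Gamma> x h v)" if "x \<in> S" for x
      using bil[OF that] unfolding bilinear_def by (auto intro: linear_compose_neg)
    show "smooth_on S (\<lambda>x. - \<Gamma> x h v)" for h v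
      by (rule smooth_on_bounded_linear[OF bounded_linear_minus[OF bounded_linear_ident] S(1)
          smooth])
    show "frechet_derivative (\<lambda>x. - \<Gamma> x k v) (at x) h + - \<Gamma> x k (- \<Gamma> x h v)
      = frechet_derivative (\<lambda>x. - \<Gamma> x h v) (at x) k + - \<Gamma> x h (- \<Gamma> x k v)" if x: "x \<in> S" for x h k v
    proof -
      have "frechet_derivative (\<lambda>x. - \<Gamma> x h v) (at x) k = - frechet_derivative (\<lambda>x. \<Gamma> x h v) (at
          x) k" for h k
        by (rule frechet_derivative_bounded_linear_compose[OF bounded_linear_minus[OF
            bounded_linear_ident] dG_diff[OF x]])
      then show ?thesis
        using flat[OF x, of k v h] by (simp add: bilinear_rneg[OF bil[OF x]] algebra_simps)
    qed
  qed blast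
  from choice[OF this] obtain r2 where "\<forall>b. \<exists>v. r2 b > 0 \<and> ball x0 (r2 b) \<subseteq> S \<and> v x0 = b \<and>
    smooth_on (ball x0 (r2 b)) v \<and>
    (\<forall>x\<in>ball x0 (r2 b). (v has_derivative (\<lambda>h. - \<Gamma> x h (v x))) (at x))"
    by blast
  from choice[OF this] obtain \<gamma> where \<gamma>: "\<And>b. r2 b > 0" "\<And>b. ball x0 (r2 b) \<subseteq> S" "\<And>b. \<gamma> b x0 = b"
      "\<And>b. smooth_on (ball x0 (r2 b)) (\<gamma> b)"
      "\<And>b x. x \<in> ball x0 (r2 b) \<Longrightarrow> (\<gamma> b has_derivative (\<lambda>h. - \<Gamma> x h (\<gamma> b x))) (at x)"
    by blast
  \<comment> \<open>The domain of each solution depends on its initial value; only initial values in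
    the finite \<open>Basis\<close> are used, so a common radius exists.\<close>
  define r where "r = Min ((\<lambda>b. min (r1 b) (r2 b)) ` Basis)"
  have r: "r > 0" using u(1) \<gamma>(1) by (auto simp: r_def)
  have r_le: "r \<le> r1 b" "r \<le> r2 b" if "b \<in> Basis" for b
    using that Min_le[of "(\<lambda>b. min (r1 b) (r2 b)) ` Basis" "min (r1 b) (r2 b)"] by (auto simp:
        r_def)
  let ?B = "ball x0 r"
  have sub: "?B \<subseteq> ball x0 (r1 b)" "?B \<subseteq> ball x0 (r2 b)" if "b \<in> Basis" for b
    using r_le[OF that] by auto
  obtain b0 :: 'e where b0: "b0 \<in> Basis" using nonempty_Basis by blast
  have BS: "?B \<subseteq> S" using sub[OF b0] \<gamma>(2)[of b0] by blast
  define \<beta> where "\<beta> b x = snd (u b x)" for b x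
  define f where "f x = (\<Sum>b\<in>Basis. fst (u b x) *\<^sub>R b)" for x
  \<comment> \<open>\<open>C x\<close> has the parallel fields as columns; \<open>D x\<close> has
    the covectors \<open>\<beta> b\<close> as rows and is the derivative of
    \<open>f\<close>.\<close>
  define C where "C x k = (\<Sum>b\<in>Basis. (k \<bullet> b) *\<^sub>R \<gamma> b x)" for x k
  define D where "D x k = (\<Sum>b\<in>Basis. (\<beta> b x \<bullet> k) *\<^sub>R b)" for x k
  have \<beta>_der: "(\<beta> b has_derivative (\<lambda>h. \<Sum>d\<in>Basis. (\<Gamma> x h d \<bullet> \<beta> b x) *\<^sub>R d)) (at x)"
    if "b \<in> Basis" "x \<in> ?B" for b x
    using has_derivative_snd[OF u(5)[of x b]] sub(1)[OF that(1)] that(2)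
    unfolding \<beta>_def \<Phi>_def by (auto simp: subset_iff)
  have f_der: "(f has_derivative D x) (at x)" if "x \<in> ?B" for x
  proof -
    have "((\<lambda>x. fst (u b x)) has_derivative (\<lambda>h. \<beta> b x \<bullet> h)) (at x)" if "b \<in> Basis" for b
      using has_derivative_fst[OF u(5)[of x b]] sub(1)[OF that] \<open>x \<in> ?B\<close>
      unfolding \<beta>_def \<Phi>_def by (auto simp: subset_iff)
    then show ?thesis
      unfolding f_def D_def by (auto intro!: has_derivative_sum has_derivative_scaleR_left)
  qed
  have f_smooth: "smooth_on ?B f"
    unfolding f_def
    by (intro smooth_on_sum smooth_on_scaleR smooth_on_const open_ball finite_Basis
        smooth_on_bounded_linear[OF bounded_linear_fst] smooth_on_subset[OF u(4)] sub)
  have C_smooth: "smooth_on ?B (\<lambda>x. C x k)" for k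
    unfolding C_def
    by (intro smooth_on_sum smooth_on_scaleR smooth_on_const open_ball finite_Basis
        smooth_on_subset[OF \<gamma>(4)] sub)
  have D_linear: "linear (D x)" for x
    unfolding D_def by (auto intro!: linearI simp: inner_add_right scaleR_add_left sum.distrib
        scaleR_sum_right)
  have C_linear: "linear (C x)" for x
    unfolding C_def by (auto intro!: linearI simp: inner_add_left scaleR_add_left sum.distrib
        scaleR_sum_right)
  \<comment> \<open>For each \<open>b\<close> the pairing \<open>\<beta> b x \<bullet> v x\<close>
    has derivative \<open>0\<close> on the ball, so it keeps its value at \<open>x0\<close>, the
    component of \<open>v x0\<close> along \<open>b\<close>.\<close>
  have parallel: "D x (v x) = v x0"
    if v: "\<And>x. x \<in> ?B \<Longrightarrow> (v has_derivative (\<lambda>h. - \<Gamma> x h (v x))) (at x)" and x: "x \<in> ?B" for v x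
  proof -
    have "\<beta> b x \<bullet> v x = \<beta> b x0 \<bullet> v x0" if b: "b \<in> Basis" for b
    proof (rule has_derivative_zero_unique[of ?B "\<lambda>x. \<beta> b x \<bullet> v x" x x0])
      show "((\<lambda>x. \<beta> b x \<bullet> v x) has_derivative (\<lambda>h. 0)) (at y within ?B)" if y: "y \<in> ?B" for y
      proof -
        have "y \<in> S" using BS y by blast
        have "((\<lambda>x. \<beta> b x \<bullet> v x) has_derivative
          (\<lambda>h. \<beta> b y \<bullet> - \<Gamma> y h (v y) + (\<Sum>d\<in>Basis. (\<Gamma> y h d \<bullet> \<beta> b y) *\<^sub>R d) \<bullet> v y)) (at y within ?B)"
          by (rule has_derivative_at_withinI[OF has_derivative_inner[OF \<beta>_der[OF b y] v[OF y]]])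
        then show ?thesis unfolding inner[OF \<open>y \<in> S\<close>] by (simp add: inner_commute)
      qed
    qed (use x r in auto)
    then have "D x (v x) = (\<Sum>b\<in>Basis. (\<beta> b x0 \<bullet> v x0) *\<^sub>R b)" by (simp add: D_def)
    also have "\<dots> = (\<Sum>b\<in>Basis. (v x0 \<bullet> b) *\<^sub>R b)" using u(3) by (simp add: \<beta>_def inner_commute)
    finally show ?thesis by (simp add: euclidean_representation)
  qed
  have \<gamma>_der: "(\<gamma> b has_derivative (\<lambda>h. - \<Gamma> x h (\<gamma> b x))) (at x)" if "b \<in> Basis" "x \<in> ?B" for b x
    using \<gamma>(5)[of x b] sub(2)[OF that(1)] that(2) by blast
  have DC: "D x (C x k) = k" if x: "x \<in> ?B" for x k
  proof -
    have "D x (C x k) = (\<Sum>b\<in>Basis. (k \<bullet> b) *\<^sub>R D x (\<gamma> b x))"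
      unfolding C_def by (simp add: linear_sum[OF D_linear] linear_scale[OF D_linear])
    also have "\<dots> = (\<Sum>b\<in>Basis. (k \<bullet> b) *\<^sub>R b)"
      using parallel[OF \<gamma>_der x] \<gamma>(3) by (intro sum.cong refl) simp
    finally show ?thesis by (simp add: euclidean_representation)
  qed
  \<comment> \<open>In finite dimension the one-sided inverse is two-sided. This order of the
    factors gives both the hypothesis of \<open>smooth_local_inverse\<close> and the formula that
    recovers a parallel field from its value at \<open>x0\<close>.\<close>
  have CD: "C x (D x k) = k" if x: "x \<in> ?B" for x k
  proof -
    have "D x \<circ> C x = id" using DC[OF x] by auto
    then have "C x \<circ> D x = id" using linear_inverse_left[OF C_linear D_linear] by metis
    then show ?thesis by (metis comp_apply id_apply)
  qed
  obtain V where V: "open V" "x0 \<in> V" "V \<subseteq> ?B" "inj_on f V" "open (f ` V)"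
    "smooth_on (f ` V) (inv_into V f)" "\<And>x. x \<in> V \<Longrightarrow> (inv_into V f has_derivative C x) (at (f x))"
  proof (rule smooth_local_inverse[OF open_ball _ f_smooth C_smooth C_linear])
    show "C x (frechet_derivative f (at x) k) = k" if "x \<in> ?B" for x k
      using CD[OF that] frechet_derivative_at[OF f_der[OF that]] by metis
  qed (use r in auto)
  have C_der: "((\<lambda>x. C x k) has_derivative (\<lambda>h. - \<Gamma> x h (C x k))) (at x)" if x: "x \<in> ?B" for x k
  proof -
    have "linear (\<Gamma> x h)" for h using bil BS x by (auto simp: bilinear_def)
    then have eq: "(\<lambda>h. - \<Gamma> x h (C x k)) = (\<lambda>h. \<Sum>b\<in>Basis. (k \<bullet> b) *\<^sub>R - \<Gamma> x h (\<gamma> b x))"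
      by (simp add: fun_eq_iff C_def linear_sum linear_scale sum_negf)
    show ?thesis
      unfolding eq unfolding C_def by (intro has_derivative_sum has_derivative_scaleR_right \<gamma>_der x)
  qed
  have "v x = C x (v x0)" if "\<forall>x\<in>?B. (v has_derivative (\<lambda>h. - \<Gamma> x h (v x))) (at x)" "x \<in> ?B" for v x
    using parallel[of v x] CD[OF that(2), of "v x"] that by simp
  moreover have "C x0 k = k" for k by (simp add: C_def \<gamma>(3) euclidean_representation)
  ultimately show thesis
    using that[of V r f C] V BS smooth_on_subset[OF f_smooth V(3)] C_der by blast
qed

section \<open>Charts and tangent vectors\<close>

lemma frechet_derivative_eqI: "(f has_derivative D) (at x) \<Longrightarrow> frechet_derivative f (at x) = D"
  using frechet_derivative_at by metis

locale smooth_manifold =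
  fixes A :: "('a::t2_space, 'e::euclidean_space) atlas"
  assumes smooth_structure: "smooth_structure A"
begin

lemma chart_on: "(U, \<phi>) \<in> A \<Longrightarrow> chart_on U \<phi>"
  and charts_cover: "\<exists>(U, \<phi>)\<in>A. p \<in> U"
  and charts_compatible: "(U, \<phi>) \<in> A \<Longrightarrow> (V, \<psi>) \<in> A \<Longrightarrow> compatible U \<phi> V \<psi>"
  and chartI: "chart_on U \<phi> \<Longrightarrow> (\<And>V \<psi>. (V, \<psi>) \<in> A \<Longrightarrow> compatible U \<phi> V \<psi>) \<Longrightarrow> (U, \<phi>) \<in> A"
proof -
  note s = smooth_structure[unfolded smooth_structure_def]
  show "(U, \<phi>) \<in> A \<Longrightarrow> chart_on U \<phi>" using s[THEN conjunct1] by blast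
  show "\<exists>(U, \<phi>)\<in>A. p \<in> U" using s[THEN conjunct2, THEN conjunct1] ..
  show "(U, \<phi>) \<in> A \<Longrightarrow> (V, \<psi>) \<in> A \<Longrightarrow> compatible U \<phi> V \<psi>"
    using s[THEN conjunct2, THEN conjunct2, THEN conjunct1] by blast
  show "chart_on U \<phi> \<Longrightarrow> (\<And>V \<psi>. (V, \<psi>) \<in> A \<Longrightarrow> compatible U \<phi> V \<psi>) \<Longrightarrow> (U, \<phi>) \<in> A"
    using s[THEN conjunct2, THEN conjunct2, THEN conjunct2] by blast
qed

lemma chart_at: obtains U \<phi> where "(U, \<phi>) \<in> A" "p \<in> U"
  using charts_cover[of p] by blast

lemma chart_homeomorphism: "(U, \<phi>) \<in> A \<Longrightarrow> homeomorphism U (\<phi> ` U) \<phi> (inv_into U \<phi>)"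
  and chart_open: "(U, \<phi>) \<in> A \<Longrightarrow> open U"
  and chart_open_image: "(U, \<phi>) \<in> A \<Longrightarrow> open (\<phi> ` U)"
  using chart_on[of U \<phi>] unfolding chart_on_def by blast+

lemma chart_inv [simp]: "(U, \<phi>) \<in> A \<Longrightarrow> q \<in> U \<Longrightarrow> inv_into U \<phi> (\<phi> q) = q"
  using chart_homeomorphism[of U \<phi>] unfolding homeomorphism_def by blast

lemma chart_inj: "(U, \<phi>) \<in> A \<Longrightarrow> inj_on \<phi> U"
  by (metis chart_inv inj_on_inverseI)

lemma open_chart_image:
  assumes "(U, \<phi>) \<in> A" "open W" "W \<subseteq> U" shows "open (\<phi> ` W)"
proof -
  have "\<phi> ` W = \<phi> ` U \<inter> inv_into U \<phi> -` W"
    using assms by (auto simp: image_iff)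
  moreover have "open (\<phi> ` U \<inter> inv_into U \<phi> -` W)"
    using chart_homeomorphism[OF assms(1)] chart_open_image[OF assms(1)] assms(2)
    by (intro continuous_open_preimage) (auto simp: homeomorphism_def)
  ultimately show ?thesis by simp
qed

lemma transition_smooth:
  assumes "(U, \<phi>) \<in> A" "(V, \<psi>) \<in> A"
  shows "smooth_on (\<psi> ` (U \<inter> V)) (\<lambda>y. \<phi> (inv_into V \<psi> y))"
  using charts_compatible[OF assms] unfolding compatible_def by (simp add: o_def)

text \<open>Maximality of the atlas is the source of all new charts. A diffeomorphism of a
  coordinate image gives a chart once it is compatible with every chart, and its transition maps
  factor through those of \<open>\<phi>\<close>.\<close>

lemma chart_change:
  fixes f :: "'e \<Rightarrow> 'e"
  assumes c: "(U, \<phi>) \<in> A" and V: "open V" "V \<subseteq> U"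
    and f: "smooth_on (\<phi> ` V) f" "inj_on f (\<phi> ` V)" "open (f ` \<phi> ` V)"
    and g: "smooth_on (f ` \<phi> ` V) (inv_into (\<phi> ` V) f)"
  shows "(V, f \<circ> \<phi>) \<in> A"
    and "\<And>y. y \<in> f ` \<phi> ` V \<Longrightarrow> inv_into V (f \<circ> \<phi>) y = inv_into U \<phi> (inv_into (\<phi> ` V) f y)"
proof -
  let ?g = "inv_into (\<phi> ` V) f"
  have inj: "inj_on (f \<circ> \<phi>) V"
    using comp_inj_on[OF inj_on_subset[OF chart_inj[OF c] V(2)] f(2)] .
  show inv: "inv_into V (f \<circ> \<phi>) y = inv_into U \<phi> (?g y)" if "y \<in> f ` \<phi> ` V" for y
  proof -
    obtain q where q: "q \<in> V" "y = (f \<circ> \<phi>) q" using \<open>y \<in> f ` \<phi> ` V\<close> by auto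
    have "inv_into V (f \<circ> \<phi>) y = q" unfolding q(2) by (rule inv_into_f_f[OF inj q(1)])
    moreover have "?g y = \<phi> q" using q by (simp add: inv_into_f_f[OF f(2)])
    ultimately show ?thesis using chart_inv[OF c] q V by auto
  qed
  have g_img: "?g ` (f ` \<phi> ` W) = \<phi> ` W" if "W \<subseteq> V" for W
    by (rule inv_into_image_cancel[OF f(2)]) (use that in auto)
  have opn: "open (f ` \<phi> ` W)" if W: "open W" "W \<subseteq> V" for W
  proof -
    have "f ` \<phi> ` W = f ` \<phi> ` V \<inter> ?g -` (\<phi> ` W)"
    proof (intro equalityI subsetI)
      fix y assume "y \<in> f ` \<phi> ` W"
      then obtain w where "w \<in> W" "y = f (\<phi> w)" by auto
      then show "y \<in> f ` \<phi> ` V \<inter> ?g -` (\<phi> ` W)" using W(2) by (auto simp: inv_into_f_f[OF f(2)])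
    next
      fix y assume "y \<in> f ` \<phi> ` V \<inter> ?g -` (\<phi> ` W)"
      then have "f (?g y) = y" "?g y \<in> \<phi> ` W" using f_inv_into_f[of y f "\<phi> ` V"] by auto
      then show "y \<in> f ` \<phi> ` W" by (metis imageI)
    qed
    moreover have "open (f ` \<phi> ` V \<inter> ?g -` (\<phi> ` W))"
      by (rule continuous_open_preimage[OF smooth_on_imp_continuous_on[OF g] f(3)])
        (use open_chart_image[OF c W(1)] W V in auto)
    ultimately show ?thesis by simp
  qed
  have "homeomorphism V ((f \<circ> \<phi>) ` V) (f \<circ> \<phi>) (inv_into V (f \<circ> \<phi>))"
  proof -
    have 1: "continuous_on V (f \<circ> \<phi>)"
      using smooth_on_imp_continuous_on[OF f(1)] chart_homeomorphism[OF c] V(2)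
      by (intro continuous_on_compose) (auto simp: homeomorphism_def intro: continuous_on_subset)
    have 2: "continuous_on ((f \<circ> \<phi>) ` V) (inv_into V (f \<circ> \<phi>))"
    proof (rule continuous_on_eq)
      show "continuous_on ((f \<circ> \<phi>) ` V) (\<lambda>y. inv_into U \<phi> (?g y))"
      proof (rule continuous_on_compose2[of "\<phi> ` U"])
        show "continuous_on (\<phi> ` U) (inv_into U \<phi>)"
          using chart_homeomorphism[OF c] by (auto simp: homeomorphism_def)
        show "continuous_on ((f \<circ> \<phi>) ` V) ?g"
          using smooth_on_imp_continuous_on[OF g] by (simp add: image_comp)
        show "?g ` (f \<circ> \<phi>) ` V \<subseteq> \<phi> ` U" unfolding image_comp[symmetric] g_img[OF subset_refl]
            using V(2) by auto
      qed
    qed (auto simp: inv)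
    show ?thesis
      unfolding homeomorphism_def
    proof (intro conjI ballI 1 2 refl)
      show "inv_into V (f \<circ> \<phi>) ` (f \<circ> \<phi>) ` V = V" by (rule inv_into_image_cancel[OF inj
          subset_refl])
      show "inv_into V (f \<circ> \<phi>) ((f \<circ> \<phi>) x) = x" if "x \<in> V" for x by (rule inv_into_f_f[OF inj that])
      show "(f \<circ> \<phi>) (inv_into V (f \<circ> \<phi>) y) = y" if "y \<in> (f \<circ> \<phi>) ` V" for y by (rule
          f_inv_into_f[OF that])
    qed
  qed
  then have "chart_on V (f \<circ> \<phi>)"
    using V f(3) unfolding chart_on_def image_comp[symmetric] by blast
  moreover have "compatible V (f \<circ> \<phi>) W \<psi>" if W: "(W, \<psi>) \<in> A" for W \<psi>
    unfolding compatible_def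
  proof
    have opn_VW: "open (f ` \<phi> ` (V \<inter> W))" using V chart_open[OF W] by (intro opn) auto
    show "smooth_on ((f \<circ> \<phi>) ` (V \<inter> W)) (\<psi> \<circ> inv_into V (f \<circ> \<phi>))"
      unfolding image_comp[symmetric]
    proof (rule smooth_on_cong[OF opn_VW])
      show "smooth_on (f ` \<phi> ` (V \<inter> W)) (\<lambda>y. \<psi> (inv_into U \<phi> (?g y)))"
      proof (rule smooth_on_compose[OF opn_VW, of "\<phi> ` (V \<inter> W)" ?g "\<lambda>x. \<psi> (inv_into U \<phi> x)"])
        show "open (\<phi> ` (V \<inter> W))" using V chart_open[OF W] by (intro open_chart_image[OF c]) auto
        show "?g ` f ` \<phi> ` (V \<inter> W) \<subseteq> \<phi> ` (V \<inter> W)" using g_img[of "V \<inter> W"] by auto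
        show "smooth_on (f ` \<phi> ` (V \<inter> W)) ?g" by (rule smooth_on_subset[OF g]) auto
        show "smooth_on (\<phi> ` (V \<inter> W)) (\<lambda>x. \<psi> (inv_into U \<phi> x))"
          by (rule smooth_on_subset[OF transition_smooth[OF W c]]) (use V in auto)
      qed
    qed (auto simp: inv)
    have opn_W: "open (\<psi> ` (V \<inter> W))" using V chart_open[OF W] by (intro open_chart_image[OF W]) auto
    show "smooth_on (\<psi> ` (V \<inter> W)) (f \<circ> \<phi> \<circ> inv_into W \<psi>)"
      unfolding o_def
    proof (rule smooth_on_compose[OF opn_W, of "\<phi> ` V" "\<lambda>x. \<phi> (inv_into W \<psi> x)" f])
      show "open (\<phi> ` V)" by (rule open_chart_image[OF c V])
      show "(\<lambda>x. \<phi> (inv_into W \<psi> x)) ` \<psi> ` (V \<inter> W) \<subseteq> \<phi> ` V" using chart_inv[OF W] by auto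
      show "smooth_on (\<psi> ` (V \<inter> W)) (\<lambda>x. \<phi> (inv_into W \<psi> x))"
        by (rule smooth_on_subset[OF transition_smooth[OF c W]]) (use V in auto)
    qed (rule f(1))
  qed
  ultimately show "(V, f \<circ> \<phi>) \<in> A" by (rule chartI)
qed

lemma smooth_funsD: "f \<in> smooth_funs A \<Longrightarrow> (U, \<phi>) \<in> A \<Longrightarrow> smooth_on (\<phi> ` U) (\<lambda>x. f (inv_into U \<phi> x))"
  unfolding smooth_funs_def by (auto simp: o_def)

lemma smooth_funsI:
  "(\<And>U \<phi>. (U, \<phi>) \<in> A \<Longrightarrow> smooth_on (\<phi> ` U) (\<lambda>x. f (inv_into U \<phi> x))) \<Longrightarrow> f \<in> smooth_funs A"
  unfolding smooth_funs_def by (auto simp: o_def)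

lemma smooth_funs_const: "(\<lambda>_. c) \<in> smooth_funs A"
  by (intro smooth_funsI smooth_on_const chart_open_image)

lemma smooth_funs_add: "f \<in> smooth_funs A \<Longrightarrow> g \<in> smooth_funs A \<Longrightarrow> f + g \<in> smooth_funs A"
  by (rule smooth_funsI) (simp add: smooth_on_add chart_open_image smooth_funsD)

lemma smooth_funs_mult: "f \<in> smooth_funs A \<Longrightarrow> g \<in> smooth_funs A \<Longrightarrow> f * g \<in> smooth_funs A"
  by (rule smooth_funsI) (simp add: smooth_on_mult chart_open_image smooth_funsD)

lemma smooth_funs_scale:
  assumes "f \<in> smooth_funs A" shows "(\<lambda>q. c * f q) \<in> smooth_funs A"
  using smooth_funs_mult[OF smooth_funs_const[of c] assms] by (simp add: times_fun_def)

lemma smooth_funs_sum: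
  "finite I \<Longrightarrow> (\<And>i. i \<in> I \<Longrightarrow> f i \<in> smooth_funs A) \<Longrightarrow> (\<Sum>i\<in>I. f i) \<in> smooth_funs A"
  by (induction I rule: finite_induct) (auto intro: smooth_funs_add smooth_funs_const simp:
      zero_fun_def)

text \<open>A single cut-off, vanishing outside \<open>W\<close>, serves for all \<open>g\<close> at
  once, so that several local data are extended with agreement on one and the same ball.\<close>

lemma extend_smooth:
  assumes c: "(U, \<phi>) \<in> A" and p: "p \<in> U" "p \<in> W" and W: "open W"
  obtains r and \<rho> :: "'e \<Rightarrow> real" where "r > 0" "ball (\<phi> p) r \<subseteq> \<phi> ` U"
    "\<And>x. x \<in> ball (\<phi> p) r \<Longrightarrow> \<rho> x = 1" "\<And>q. q \<in> U \<Longrightarrow> q \<notin> W \<Longrightarrow> \<rho> (\<phi> q) = 0"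
    "\<And>g. smooth_on (\<phi> ` U) g \<Longrightarrow> (\<lambda>q. if q \<in> U then \<rho> (\<phi> q) * g (\<phi> q) else 0) \<in> smooth_funs A"
proof -
  have "open (\<phi> ` (U \<inter> W))" using chart_open[OF c] W by (intro open_chart_image[OF c]) auto
  then obtain R where R: "R > 0" "cball (\<phi> p) R \<subseteq> \<phi> ` (U \<inter> W)"
    using p open_contains_cball_eq by blast
  obtain \<rho> :: "'e \<Rightarrow> real" where \<rho>: "smooth_on UNIV \<rho>" "\<And>x. x \<in> ball (\<phi> p) (R/2) \<Longrightarrow> \<rho> x = 1"
    "\<And>x. x \<notin> ball (\<phi> p) R \<Longrightarrow> \<rho> x = 0" using smooth_bump_exists[OF R(1)] by metis
  \<comment> \<open>Off \<open>K\<close> the extension is \<open>0\<close>. As \<open>K\<close> is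
    compact in a Hausdorff space it is closed, so every point outside \<open>U\<close> has a
    neighbourhood on which the extension vanishes.\<close>
  define K where "K = inv_into U \<phi> ` cball (\<phi> p) R"
  have "compact K"
    unfolding K_def using chart_homeomorphism[OF c] R
    by (intro compact_continuous_image) (auto simp: homeomorphism_def intro: continuous_on_subset)
  then have K: "closed K" by (rule compact_imp_closed)
  have KU: "K \<subseteq> U" using R chart_inv[OF c] by (fastforce simp: K_def)
  have "(\<lambda>q. if q \<in> U then \<rho> (\<phi> q) * g (\<phi> q) else 0) \<in> smooth_funs A" (is "?G \<in> _")
    if g: "smooth_on (\<phi> ` U) g" for g
  proof (rule smooth_funsI)
    fix V \<psi> assume V: "(V, \<psi>) \<in> A"
    show "smooth_on (\<psi> ` V) (\<lambda>y. ?G (inv_into V \<psi> y))"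
    proof (rule smooth_on_local)
      fix y assume "y \<in> \<psi> ` V"
      then obtain q where q: "q \<in> V" "y = \<psi> q" by auto
      show "\<exists>T. open T \<and> y \<in> T \<and> smooth_on T (\<lambda>y. ?G (inv_into V \<psi> y))"
      proof (cases "q \<in> U")
        case True
        let ?T = "\<psi> ` (U \<inter> V)"
        have T: "open ?T" using chart_open[OF c] chart_open[OF V] by (intro open_chart_image[OF
            V]) auto
        have "smooth_on ?T (\<lambda>y. ?G (inv_into V \<psi> y))"
        proof (rule smooth_on_cong[OF T])
          show "smooth_on ?T (\<lambda>y. \<rho> (\<phi> (inv_into V \<psi> y)) * g (\<phi> (inv_into V \<psi> y)))"
            by (rule smooth_on_compose[OF T chart_open_image[OF c] _ transition_smooth[OF c V], of
                "\<lambda>x. \<rho> x * g x"])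
              (use chart_inv[OF V] in \<open>auto intro!: smooth_on_mult chart_open_image[OF c] g
                  smooth_on_subset[OF \<rho>(1)]\<close>)
        qed (use chart_inv[OF V] in auto)
        then show ?thesis using T q True by blast
      next
        case False
        let ?T = "\<psi> ` (V - K)"
        have T: "open ?T" using chart_open[OF V] K by (intro open_chart_image[OF V] open_Diff) auto
        have "smooth_on ?T (\<lambda>y. ?G (inv_into V \<psi> y))"
        proof (rule smooth_on_cong[OF T _ smooth_on_const[OF T, of 0]])
          fix y assume "y \<in> ?T"
          then obtain q' where q': "q' \<in> V" "q' \<notin> K" "y = \<psi> q'" by auto
          have "\<rho> (\<phi> q') = 0" if "q' \<in> U"
          proof (rule \<rho>(3))
            show "\<phi> q' \<notin> ball (\<phi> p) R"
              using q'(2) chart_inv[OF c that] unfolding K_def by (metis ball_subset_cball imageI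
                  subsetD)
          qed
          then show "0 = ?G (inv_into V \<psi> y)" using q' chart_inv[OF V] by simp
        qed
        then show ?thesis using T q False KU by blast
      qed
    qed
  qed
  moreover have "\<rho> (\<phi> q) = 0" if "q \<in> U" "q \<notin> W" for q
  proof (rule \<rho>(3))
    show "\<phi> q \<notin> ball (\<phi> p) R"
      using R(2) that chart_inj[OF c] ball_subset_cball by (auto simp: inj_on_def subset_iff
          image_iff) blast
  qed
  moreover have "ball (\<phi> p) (R / 2) \<subseteq> cball (\<phi> p) R" using R(1) by auto
  then have "ball (\<phi> p) (R / 2) \<subseteq> \<phi> ` U" using R(2) by blast
  ultimately show thesis
    using that[of "R / 2" \<rho>] R(1) \<rho> by auto
qed

lemma tangent_add: "v \<in> tangent_space A p \<Longrightarrow> f \<in> smooth_funs A \<Longrightarrow> g \<in> smooth_funs A \<Longrightarrow> v (f + g) = v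
    f + v g"
  and tangent_scale: "v \<in> tangent_space A p \<Longrightarrow> f \<in> smooth_funs A \<Longrightarrow> v (\<lambda>q. c * f q) = c * v f"
  and tangent_mult: "v \<in> tangent_space A p \<Longrightarrow> f \<in> smooth_funs A \<Longrightarrow> g \<in> smooth_funs A \<Longrightarrow>
    v (f * g) = f p * v g + g p * v f"
  and tangent_not_smooth: "v \<in> tangent_space A p \<Longrightarrow> f \<notin> smooth_funs A \<Longrightarrow> v f = 0"
  by (auto simp: tangent_space_def)

lemma tangent_zero: assumes "v \<in> tangent_space A p" shows "v (\<lambda>_. 0) = 0"
  using tangent_scale[OF assms smooth_funs_const, of 0 0] by simp

lemma tangent_const: assumes "v \<in> tangent_space A p" shows "v (\<lambda>_. c) = 0"
proof -
  have "v (\<lambda>_. 1) = 0"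
    using tangent_mult[OF assms smooth_funs_const[of 1] smooth_funs_const[of 1]] by (simp add:
        times_fun_def)
  then show ?thesis using tangent_scale[OF assms smooth_funs_const, of c 1] by simp
qed

lemma tangent_sum:
  assumes "v \<in> tangent_space A p" "finite I" "\<And>i. i \<in> I \<Longrightarrow> f i \<in> smooth_funs A"
  shows "v (\<Sum>i\<in>I. f i) = (\<Sum>i\<in>I. v (f i))"
  using assms(2,3)
  by (induction I rule: finite_induct)
    (auto simp: tangent_add[OF assms(1)] smooth_funs_sum zero_fun_def tangent_zero[OF assms(1)])

lemma bump_at:
  assumes "open W" "p \<in> W"
  obtains b where "b \<in> smooth_funs A" "b p = 1" "\<And>q. q \<notin> W \<Longrightarrow> b q = (0::real)"
proof -
  obtain U \<phi> where c: "(U, \<phi>) \<in> A" "p \<in> U" using chart_at by blast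
  obtain r and \<rho> :: "'e \<Rightarrow> real" where r: "r > 0" "ball (\<phi> p) r \<subseteq> \<phi> ` U"
    and r1: "\<And>x. x \<in> ball (\<phi> p) r \<Longrightarrow> \<rho> x = 1"
    and z: "\<And>q. q \<in> U \<Longrightarrow> q \<notin> W \<Longrightarrow> \<rho> (\<phi> q) = 0"
    and s: "\<And>g. smooth_on (\<phi> ` U) g \<Longrightarrow> (\<lambda>q. if q \<in> U then \<rho> (\<phi> q) * g (\<phi> q) else 0) \<in> smooth_funs A"
    by (rule extend_smooth[OF c assms(2,1)]) (rule that)
  show thesis
    using that[of "\<lambda>q. if q \<in> U then \<rho> (\<phi> q) * 1 else 0"]
      s[OF smooth_on_const[OF chart_open_image[OF c(1)], of 1]] c(2) r r1 z by auto
qed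

text \<open>A cut-off \<open>b\<close> vanishing off \<open>W\<close> gives
  \<open>b * (f - g) = 0\<close>. In the Leibniz rule at \<open>p\<close>, where \<open>b\<close> is
  \<open>1\<close> and \<open>f - g\<close> is \<open>0\<close>, only \<open>v (f - g)\<close>
  survives.\<close>

lemma tangent_local:
  assumes v: "v \<in> tangent_space A p" and f: "f \<in> smooth_funs A" and g: "g \<in> smooth_funs A"
    and W: "open W" "p \<in> W" and eq: "\<And>q. q \<in> W \<Longrightarrow> f q = g q"
  shows "v f = v g"
proof -
  obtain b where b: "b \<in> smooth_funs A" "b p = 1" "\<And>q. q \<notin> W \<Longrightarrow> b q = (0::real)"
    using bump_at[OF W] by blast
  have g': "(\<lambda>q. (-1) * g q) \<in> smooth_funs A" by (rule smooth_funs_scale[OF g])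
  define d where "d = f + (\<lambda>q. (-1) * g q)"
  have d: "d \<in> smooth_funs A" unfolding d_def by (rule smooth_funs_add[OF f g'])
  have "b * d = (\<lambda>_. 0)" using b(3) eq by (fastforce simp: d_def)
  then have "0 = b p * v d + d p * v b"
    using tangent_mult[OF v b(1) d] tangent_zero[OF v] by simp
  moreover have "d p = 0" using eq[OF W(2)] by (simp add: d_def)
  ultimately have "v d = 0" using b(2) by simp
  then show ?thesis
    unfolding d_def tangent_add[OF v f g'] tangent_scale[OF v g] by simp
qed

lemma smooth_fun_has_derivative:
  assumes "f \<in> smooth_funs A" "(U, \<phi>) \<in> A" "p \<in> U"
  shows "((\<lambda>x. f (inv_into U \<phi> x)) has_derivative
    frechet_derivative (\<lambda>x. f (inv_into U \<phi> x)) (at (\<phi> p))) (at (\<phi> p))"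
  by (rule smooth_on_has_derivative[OF smooth_funsD[OF assms(1,2)]]) (use assms(3) in auto)

lemma coord_vec_apply:
  "f \<in> smooth_funs A \<Longrightarrow> coord_vec A U \<phi> b p f = frechet_derivative (\<lambda>x. f (inv_into U \<phi> x)) (at (\<phi>
      p)) b"
  by (simp add: coord_vec_def o_def)

lemma coord_vec_tangent:
  assumes c: "(U, \<phi>) \<in> A" "p \<in> U"
  shows "coord_vec A U \<phi> b p \<in> tangent_space A p"
proof -
  let ?D = "\<lambda>f. frechet_derivative (\<lambda>x. f (inv_into U \<phi> x)) (at (\<phi> p))"
  have "coord_vec A U \<phi> b p (f + g) = coord_vec A U \<phi> b p f + coord_vec A U \<phi> b p g"
    and "coord_vec A U \<phi> b p (f * g) = f p * coord_vec A U \<phi> b p g + g p * coord_vec A U \<phi> b p f"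
    if "f \<in> smooth_funs A" "g \<in> smooth_funs A" for f g
    using frechet_derivative_eqI[OF has_derivative_add[OF smooth_fun_has_derivative[OF that(1) c]
          smooth_fun_has_derivative[OF that(2) c]]]
      frechet_derivative_eqI[OF has_derivative_mult[OF smooth_fun_has_derivative[OF that(1) c]
          smooth_fun_has_derivative[OF that(2) c]]]
    by (simp_all add: coord_vec_apply smooth_funs_add smooth_funs_mult that c)
  moreover have "coord_vec A U \<phi> b p (\<lambda>q. k * f q) = k * coord_vec A U \<phi> b p f"
    if "f \<in> smooth_funs A" for f k
    using frechet_derivative_eqI[OF has_derivative_mult_right[OF smooth_fun_has_derivative[OF
        that(1) c], of k]]
    by (simp add: coord_vec_apply smooth_funs_scale that)
  ultimately show ?thesis by (simp add: tangent_space_def coord_vec_def)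
qed

lemma coord_vec_linear:
  assumes c: "(U, \<phi>) \<in> A" "p \<in> U"
  shows "coord_vec A U \<phi> (b + b') p = coord_vec A U \<phi> b p + coord_vec A U \<phi> b' p"
    and "coord_vec A U \<phi> (k *\<^sub>R b) p = tscale k (coord_vec A U \<phi> b p)"
    and "coord_vec A U \<phi> (b - b') p = coord_vec A U \<phi> b p - coord_vec A U \<phi> b' p"
proof -
  have lin: "linear (frechet_derivative (\<lambda>x. f (inv_into U \<phi> x)) (at (\<phi> p)))" if "f \<in> smooth_funs
      A" for f
    using has_derivative_bounded_linear[OF smooth_fun_has_derivative[OF that c]] by (rule
        bounded_linear.linear)
  show "coord_vec A U \<phi> (b + b') p = coord_vec A U \<phi> b p + coord_vec A U \<phi> b' p"
    "coord_vec A U \<phi> (k *\<^sub>R b) p = tscale k (coord_vec A U \<phi> b p)"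
    "coord_vec A U \<phi> (b - b') p = coord_vec A U \<phi> b p - coord_vec A U \<phi> b' p"
    using linear_add[OF lin] linear_scale[OF lin] linear_diff[OF lin]
    by (auto simp: fun_eq_iff tscale_def coord_vec_def o_def)
qed

lemma coord_vec_zero: "(U, \<phi>) \<in> A \<Longrightarrow> p \<in> U \<Longrightarrow> coord_vec A U \<phi> 0 p = 0"
  using coord_vec_linear(3)[of U \<phi> p 0 0] by simp

lemma zero_tangent: "0 \<in> tangent_space A p"
  by (simp add: tangent_space_def)

text \<open>Linear coordinates live on the chart only. These global substitutes agree with them near
  \<open>p\<close> and allow the components of a tangent vector to be read off.\<close>

lemma coord_functions:
  assumes c: "(U, \<phi>) \<in> A" "p \<in> U"
  obtains r y where "r > 0" "ball (\<phi> p) r \<subseteq> \<phi> ` U" "\<And>b. y b \<in> smooth_funs A"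
    "\<And>b x. x \<in> ball (\<phi> p) r \<Longrightarrow> y b (inv_into U \<phi> x) = x \<bullet> b"
    "\<And>b b' q. q \<in> U \<Longrightarrow> \<phi> q \<in> ball (\<phi> p) r \<Longrightarrow> coord_vec A U \<phi> b' q (y b) = b' \<bullet> b"
proof -
  obtain r and \<rho> :: "'e \<Rightarrow> real" where r: "r > 0" "ball (\<phi> p) r \<subseteq> \<phi> ` U"
    and r1: "\<And>x. x \<in> ball (\<phi> p) r \<Longrightarrow> \<rho> x = 1"
    and z: "\<And>q. q \<in> U \<Longrightarrow> q \<notin> UNIV \<Longrightarrow> \<rho> (\<phi> q) = 0"
    and s: "\<And>g. smooth_on (\<phi> ` U) g \<Longrightarrow> (\<lambda>q. if q \<in> U then \<rho> (\<phi> q) * g (\<phi> q) else 0) \<in> smooth_funs A"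
    by (rule extend_smooth[OF c UNIV_I open_UNIV]) (rule that)
  define y where "y b q = (if q \<in> U then \<rho> (\<phi> q) * (\<phi> q \<bullet> b) else 0)" for b q
  have y: "y b \<in> smooth_funs A" for b
    unfolding y_def by (intro s smooth_on_inner smooth_on_id chart_open_image[OF c(1)])
  have ye: "y b (inv_into U \<phi> x) = x \<bullet> b" if "x \<in> ball (\<phi> p) r" for b x
    using that r(2) r1 chart_inv[OF c(1)] by (auto simp: y_def subset_iff image_iff)
  have "coord_vec A U \<phi> b' q (y b) = b' \<bullet> b" if "\<phi> q \<in> ball (\<phi> p) r" for b b' q
  proof -
    have "((\<lambda>x. x \<bullet> b) has_derivative (\<lambda>h. h \<bullet> b)) (at (\<phi> q))"
      by (auto intro!: derivative_eq_intros)
    then have "((\<lambda>x. y b (inv_into U \<phi> x)) has_derivative (\<lambda>h. h \<bullet> b)) (at (\<phi> q))"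
      by (rule has_derivative_transform_within_open[OF _ open_ball that]) (simp add: ye)
    then show ?thesis by (simp add: coord_vec_apply[OF y] frechet_derivative_eqI)
  qed
  with r y ye show thesis by (intro that)
qed

lemma coord_vec_inject:
  assumes c: "(U, \<phi>) \<in> A" "p \<in> U" and "coord_vec A U \<phi> b p = coord_vec A U \<phi> b' p"
  shows "b = b'"
proof -
  obtain r y where "r > 0" "\<And>b b' q. q \<in> U \<Longrightarrow> \<phi> q \<in> ball (\<phi> p) r \<Longrightarrow> coord_vec A U \<phi> b' q (y b) = b'
      \<bullet> b"
    using coord_functions[OF c] by metis
  then have "b \<bullet> d = b' \<bullet> d" for d using assms(3) c(2) by (metis centre_in_ball)
  then show ?thesis using vector_eq_rdot by blast
qed

text \<open>Restriction is the change of coordinates by the identity.\<close>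

lemma restrict_chart:
  assumes "(U, \<phi>) \<in> A" "open V" "V \<subseteq> U"
  shows "(V, \<phi>) \<in> A"
proof -
  have o: "open (\<phi> ` V)" by (rule open_chart_image[OF assms])
  have "smooth_on (id ` \<phi> ` V) (inv_into (\<phi> ` V) id)"
    by (rule smooth_on_cong[OF _ _ smooth_on_id]) (auto simp: o inv_into_f_f[of id, simplified])
  then have "(V, id \<circ> \<phi>) \<in> A"
    by (intro chart_change(1)[OF assms]) (auto simp: o smooth_on_id id_def)
  then show ?thesis by simp
qed

text \<open>Hadamard's lemma writes \<open>f\<close> near \<open>p\<close> as \<open>f p\<close>
  plus a sum of products \<open>y d * G d\<close> with \<open>y d p = 0\<close>. A derivation kills
  the constant and turns each product into \<open>v (y d)\<close> times a partial derivative of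
  \<open>f\<close>, so the numbers \<open>v (y d)\<close> are the components of
  \<open>v\<close>.\<close>

lemma tangent_coord:
  assumes c: "(U, \<phi>) \<in> A" "p \<in> U" and v: "v \<in> tangent_space A p"
  obtains b where "v = coord_vec A U \<phi> b p"
proof -
  obtain R where R: "R > 0" "ball (\<phi> p) R \<subseteq> \<phi> ` U"
    using chart_open_image[OF c(1)] c(2) open_contains_ball_eq by blast
  \<comment> \<open>The chart is shrunk until its image is a ball: \<open>hadamard\<close> gives
    factors smooth on a ball, and extending them requires smoothness on the whole image of the
    chart.\<close>
  define V where "V = U \<inter> \<phi> -` ball (\<phi> p) R"
  have V: "open V" "V \<subseteq> U" "p \<in> V" "\<phi> ` V = ball (\<phi> p) R"
    using R c(2) chart_homeomorphism[OF c(1)] chart_open[OF c(1)]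
    by (auto simp: V_def homeomorphism_def intro!: continuous_open_preimage)
  have cV: "(V, \<phi>) \<in> A" by (rule restrict_chart[OF c(1) V(1,2)])
  have inv_eq: "inv_into V \<phi> x = inv_into U \<phi> x" if "x \<in> ball (\<phi> p) R" for x
    using that V chart_inv[OF cV] chart_inv[OF c(1)] by (metis imageE subsetD)
  obtain r and \<rho> :: "'e \<Rightarrow> real" where r: "r > 0" "ball (\<phi> p) r \<subseteq> \<phi> ` V"
    and r1: "\<And>x. x \<in> ball (\<phi> p) r \<Longrightarrow> \<rho> x = 1"
    and z: "\<And>q. q \<in> V \<Longrightarrow> q \<notin> UNIV \<Longrightarrow> \<rho> (\<phi> q) = 0"
    and s: "\<And>g. smooth_on (\<phi> ` V) g \<Longrightarrow> (\<lambda>q. if q \<in> V then \<rho> (\<phi> q) * g (\<phi> q) else 0) \<in> smooth_funs A"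
    by (rule extend_smooth[OF cV V(3) UNIV_I open_UNIV]) (rule that)
  define y where "y b = (\<lambda>q. if q \<in> V then \<rho> (\<phi> q) * ((\<phi> q - \<phi> p) \<bullet> b) else 0)" for b
  have y: "y b \<in> smooth_funs A" for b
    unfolding y_def by (intro s smooth_on_inner smooth_on_diff smooth_on_const smooth_on_id
        chart_open_image[OF cV])
  define b where "b = (\<Sum>d\<in>Basis. v (y d) *\<^sub>R d)"
  have "v f = coord_vec A U \<phi> b p f" if f: "f \<in> smooth_funs A" for f
  proof -
    have sf: "smooth_on (ball (\<phi> p) R) (\<lambda>x. f (inv_into V \<phi> x))" using smooth_funsD[OF f cV] V(4)
        by simp
    obtain g where g: "\<And>d. smooth_on (ball (\<phi> p) R) (g d)"
      "\<And>d. g d (\<phi> p) = frechet_derivative (\<lambda>x. f (inv_into V \<phi> x)) (at (\<phi> p)) d"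
      "\<And>x. x \<in> ball (\<phi> p) R \<Longrightarrow> f (inv_into V \<phi> x) = f (inv_into V \<phi> (\<phi> p)) + (\<Sum>d\<in>Basis. ((x - \<phi> p)
          \<bullet> d) * g d x)"
      by (rule hadamard[OF sf R(1)]) (rule that)
    define G where "G d = (\<lambda>q. if q \<in> V then \<rho> (\<phi> q) * g d (\<phi> q) else 0)" for d
    have G: "G d \<in> smooth_funs A" for d unfolding G_def by (rule s) (use g(1) V(4) in simp)
    define T where "T = (\<lambda>_. f p) + (\<Sum>d\<in>Basis. y d * G d)"
    have T: "T \<in> smooth_funs A"
      unfolding T_def by (intro smooth_funs_add smooth_funs_const smooth_funs_sum smooth_funs_mult
          y G finite_Basis)
    have sum_apply: "(\<Sum>d\<in>Basis. y d * G d) q = (\<Sum>d\<in>Basis. y d q * G d q)" for q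
      by (induction rule: infinite_finite_induct[of _ "Basis :: 'e set"]) auto
    have "open (V \<inter> \<phi> -` ball (\<phi> p) r)"
      using chart_homeomorphism[OF cV] by (intro continuous_open_preimage V) (auto simp:
          homeomorphism_def)
    moreover have "f q = T q" if q: "q \<in> V \<inter> \<phi> -` ball (\<phi> p) r" for q
    proof -
      have "\<phi> q \<in> ball (\<phi> p) R" using q V(4) by auto
      have "y d q = (\<phi> q - \<phi> p) \<bullet> d" "G d q = g d (\<phi> q)" for d
        using q r1 by (simp_all add: y_def G_def)
      with g(3)[OF \<open>\<phi> q \<in> ball (\<phi> p) R\<close>] show ?thesis
        using q chart_inv[OF cV] V(3) by (simp add: T_def sum_apply)
    qed
    ultimately have "v f = v T"
      using tangent_local[OF v f T, of "V \<inter> \<phi> -` ball (\<phi> p) r"] V(3) r(1) by auto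
    also have "\<dots> = (\<Sum>d\<in>Basis. v (y d * G d))"
      unfolding T_def by (simp add: tangent_add[OF v] tangent_sum[OF v] tangent_const[OF v]
          smooth_funs_const
          smooth_funs_sum smooth_funs_mult y G)
    also have "\<dots> = (\<Sum>d\<in>Basis. frechet_derivative (\<lambda>x. f (inv_into V \<phi> x)) (at (\<phi> p)) d * v (y d))"
    proof (intro sum.cong refl)
      fix d
      have "y d p = 0" "G d p = g d (\<phi> p)" using V(3) r r1 by (simp_all add: y_def G_def)
      then show "v (y d * G d) = frechet_derivative (\<lambda>x. f (inv_into V \<phi> x)) (at (\<phi> p)) d * v (y d)"
        by (simp add: tangent_mult[OF v y G] g(2))
    qed
    also have "\<dots> = (\<Sum>d\<in>Basis. (b \<bullet> d) *\<^sub>R frechet_derivative (\<lambda>x. f (inv_into V \<phi> x)) (at (\<phi> p)) d)"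
      by (intro sum.cong refl) (simp add: b_def mult.commute inner_sum_left_Basis)
    also have "\<dots> = frechet_derivative (\<lambda>x. f (inv_into V \<phi> x)) (at (\<phi> p)) b"
      by (rule bounded_linear_expand[symmetric, OF has_derivative_bounded_linear[OF
          smooth_fun_has_derivative[OF f cV V(3)]]])
    also have "\<dots> = coord_vec A U \<phi> b p f"
      unfolding coord_vec_apply[OF f]
      using frechet_derivative_cong_open(2)[OF open_ball, of "\<phi> p" "\<phi> p" R "\<lambda>x. f (inv_into V \<phi> x)"
          "\<lambda>x. f (inv_into U \<phi> x)"] R(1) inv_eq by simp
    finally show ?thesis .
  qed
  then have "v = coord_vec A U \<phi> b p"
    using tangent_not_smooth[OF v] by (auto simp: fun_eq_iff coord_vec_def)
  then show thesis by (rule that)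
qed

end

text \<open>In the first summand the direction is frozen at \<open>X x\<close>. This separates a
  pure second derivative, to which \<open>mixed_derivatives\<close> applies, from the derivative of
  the field.\<close>

lemma has_derivative_deriv_apply:
  fixes f :: "'a::euclidean_space \<Rightarrow> 'b::real_normed_vector" and X :: "'a \<Rightarrow> 'a"
  assumes S: "open S" "x \<in> S" and f: "smooth_on S f" and X: "smooth_on S X"
  shows "frechet_derivative (\<lambda>x. frechet_derivative f (at x) (X x)) (at x) a
    = frechet_derivative (\<lambda>y. frechet_derivative f (at y) (X x)) (at x) a
      + frechet_derivative f (at x) (frechet_derivative X (at x) a)"
proof -
  let ?D = "\<lambda>x. frechet_derivative f (at x)"
  have expand: "?D y v = (\<Sum>b\<in>Basis. (v \<bullet> b) *\<^sub>R ?D y b)" if "y \<in> S" for y v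
    by (rule bounded_linear_expand[OF smooth_on_linear_derivative[OF f that]])
  have D2: "((\<lambda>y. ?D y b) has_derivative frechet_derivative (\<lambda>y. ?D y b) (at x)) (at x)" for b
    by (rule smooth_on_has_derivative[OF smooth_on_deriv[OF f] S(2)])
  have DX: "((\<lambda>y. X y \<bullet> b) has_derivative (\<lambda>h. frechet_derivative X (at x) h \<bullet> b)) (at x)" for b
    by (rule has_derivative_inner_left[OF smooth_on_has_derivative[OF X S(2)]])
  have 1: "((\<lambda>y. \<Sum>b\<in>Basis. (X y \<bullet> b) *\<^sub>R ?D y b) has_derivative (\<lambda>h. \<Sum>b\<in>Basis.
      (X x \<bullet> b) *\<^sub>R frechet_derivative (\<lambda>y. ?D y b) (at x) h
        + (frechet_derivative X (at x) h \<bullet> b) *\<^sub>R ?D x b)) (at x)"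
    by (intro has_derivative_sum has_derivative_scaleR DX D2)
  have 2: "((\<lambda>y. \<Sum>b\<in>Basis. (X x \<bullet> b) *\<^sub>R ?D y b) has_derivative (\<lambda>h. \<Sum>b\<in>Basis.
      (X x \<bullet> b) *\<^sub>R frechet_derivative (\<lambda>y. ?D y b) (at x) h)) (at x)"
    by (intro has_derivative_sum has_derivative_scaleR_right D2)
  have "frechet_derivative (\<lambda>y. ?D y (X y)) (at x) a = frechet_derivative (\<lambda>y. \<Sum>b\<in>Basis. (X y \<bullet> b)
      *\<^sub>R ?D y b) (at x) a"
    by (rule fun_cong[OF frechet_derivative_cong_open(2)[OF S]]) (rule expand)
  moreover have "frechet_derivative (\<lambda>y. ?D y (X x)) (at x) a = frechet_derivative (\<lambda>y. \<Sum>b\<in>Basis.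
      (X x \<bullet> b) *\<^sub>R ?D y b) (at x) a"
    by (rule fun_cong[OF frechet_derivative_cong_open(2)[OF S]]) (rule expand)
  ultimately show ?thesis
    unfolding frechet_derivative_eqI[OF 1] frechet_derivative_eqI[OF 2]
      expand[OF S(2), of "frechet_derivative X (at x) a"] by (simp add: sum.distrib)
qed

context smooth_manifold
begin

section \<open>Vector fields in coordinates\<close>

text \<open>The description is meaningful for \<open>v\<close> tangent at \<open>p\<close>:
  existence is \<open>tangent_coord\<close>, uniqueness is \<open>coord_vec_inject\<close>.\<close>

definition tcomp :: "'a set \<Rightarrow> ('a \<Rightarrow> 'e) \<Rightarrow> 'a \<Rightarrow> 'a tvec \<Rightarrow> 'e" where
  "tcomp U \<phi> p v = (THE b. v = coord_vec A U \<phi> b p)"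

definition vcomp :: "'a set \<Rightarrow> ('a \<Rightarrow> 'e) \<Rightarrow> 'a vfield \<Rightarrow> 'e \<Rightarrow> 'e" where
  "vcomp U \<phi> X x = tcomp U \<phi> (inv_into U \<phi> x) (X (inv_into U \<phi> x))"

lemma tcomp_coord: "(U, \<phi>) \<in> A \<Longrightarrow> p \<in> U \<Longrightarrow> tcomp U \<phi> p (coord_vec A U \<phi> b p) = b"
  unfolding tcomp_def by (rule the_equality) (auto dest: coord_vec_inject)

lemma coord_tcomp: "(U, \<phi>) \<in> A \<Longrightarrow> p \<in> U \<Longrightarrow> v \<in> tangent_space A p \<Longrightarrow> coord_vec A U \<phi> (tcomp U \<phi> p v) p
    = v"
  using tangent_coord[of U \<phi> p v] tcomp_coord by metis

lemma tcomp_add: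
  assumes c: "(U, \<phi>) \<in> A" "p \<in> U" and "v \<in> tangent_space A p" "w \<in> tangent_space A p"
  shows "tcomp U \<phi> p (v + w) = tcomp U \<phi> p v + tcomp U \<phi> p w"
  using tcomp_coord[OF c, of "tcomp U \<phi> p v + tcomp U \<phi> p w"]
  by (simp add: coord_vec_linear[OF c] coord_tcomp[OF c] assms)

lemma tcomp_diff:
  assumes c: "(U, \<phi>) \<in> A" "p \<in> U" and "v \<in> tangent_space A p" "w \<in> tangent_space A p"
  shows "tcomp U \<phi> p (v - w) = tcomp U \<phi> p v - tcomp U \<phi> p w"
  using tcomp_coord[OF c, of "tcomp U \<phi> p v - tcomp U \<phi> p w"]
  by (simp add: coord_vec_linear[OF c] coord_tcomp[OF c] assms)

lemma tcomp_scale: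
  assumes c: "(U, \<phi>) \<in> A" "p \<in> U" and "v \<in> tangent_space A p"
  shows "tcomp U \<phi> p (tscale k v) = k *\<^sub>R tcomp U \<phi> p v"
  using tcomp_coord[OF c, of "k *\<^sub>R tcomp U \<phi> p v"]
  by (simp add: coord_vec_linear[OF c] coord_tcomp[OF c] assms)

lemma tangent_space_add:
  assumes "v \<in> tangent_space A p" "w \<in> tangent_space A p"
  shows "v + w \<in> tangent_space A p"
proof -
  obtain U \<phi> where c: "(U, \<phi>) \<in> A" "p \<in> U" using chart_at by blast
  obtain b b' where b: "v = coord_vec A U \<phi> b p" "w = coord_vec A U \<phi> b' p"
    using tangent_coord[OF c assms(1)] tangent_coord[OF c assms(2)] by metis
  show ?thesis
    unfolding b coord_vec_linear(1)[OF c, symmetric] by (rule coord_vec_tangent[OF c])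
qed

lemma tangent_space_scale:
  assumes "v \<in> tangent_space A p"
  shows "tscale k v \<in> tangent_space A p"
proof -
  obtain U \<phi> where c: "(U, \<phi>) \<in> A" "p \<in> U" using chart_at by blast
  obtain b where b: "v = coord_vec A U \<phi> b p" using tangent_coord[OF c assms] .
  show ?thesis
    unfolding b coord_vec_linear(2)[OF c, symmetric] by (rule coord_vec_tangent[OF c])
qed

lemma vf_tangent: "X \<in> vector_fields A \<Longrightarrow> X p \<in> tangent_space A p"
  and vf_smooth: "X \<in> vector_fields A \<Longrightarrow> f \<in> smooth_funs A \<Longrightarrow> (\<lambda>p. X p f) \<in> smooth_funs A"
  by (auto simp: vector_fields_def)

lemma vf_zero: "0 \<in> vector_fields A"
  using zero_tangent smooth_funs_const[of 0] by (auto simp: vector_fields_def)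

lemma vf_add: assumes "X \<in> vector_fields A" "Y \<in> vector_fields A" shows "X + Y \<in> vector_fields A"
proof -
  have "(\<lambda>p. (X + Y) p f) \<in> smooth_funs A" if "f \<in> smooth_funs A" for f
    using smooth_funs_add[OF vf_smooth[OF assms(1) that] vf_smooth[OF assms(2) that]]
    by (simp add: plus_fun_def)
  then show ?thesis using assms tangent_space_add by (simp add: vector_fields_def)
qed

lemma vf_fscale: assumes "h \<in> smooth_funs A" "X \<in> vector_fields A" shows "fscale h X \<in>
    vector_fields A"
proof -
  have "(\<lambda>p. (fscale h X) p f) \<in> smooth_funs A" if "f \<in> smooth_funs A" for f
    using smooth_funs_mult[OF assms(1) vf_smooth[OF assms(2) that]]
    by (simp add: times_fun_def fscale_def tscale_def)
  then show ?thesis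
    using tangent_space_scale[OF vf_tangent[OF assms(2)]]
    by (simp add: vector_fields_def fscale_def)
qed

lemma vf_diff: assumes "X \<in> vector_fields A" "Y \<in> vector_fields A" shows "X - Y \<in> vector_fields A"
proof -
  have eq: "X - Y = X + fscale (\<lambda>_. -1) Y" by (auto simp: fun_eq_iff fscale_def tscale_def)
  show ?thesis unfolding eq by (intro vf_add vf_fscale smooth_funs_const assms)
qed

lemma vf_sum: "finite I \<Longrightarrow> (\<And>i. i \<in> I \<Longrightarrow> X i \<in> vector_fields A) \<Longrightarrow> (\<Sum>i\<in>I. X i) \<in> vector_fields A"
  by (induction I rule: finite_induct) (auto intro: vf_add vf_zero)

lemma chart_point:
  assumes "(U, \<phi>) \<in> A" "x \<in> \<phi> ` U" shows "inv_into U \<phi> x \<in> U" "\<phi> (inv_into U \<phi> x) = x"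
  using assms by (auto intro: inv_into_into f_inv_into_f)

lemma vcomp_coord:
  assumes "(U, \<phi>) \<in> A" "x \<in> \<phi> ` U" "X \<in> vector_fields A"
  shows "X (inv_into U \<phi> x) = coord_vec A U \<phi> (vcomp U \<phi> X x) (inv_into U \<phi> x)"
  unfolding vcomp_def using coord_tcomp[OF assms(1) chart_point(1)[OF assms(1,2)] vf_tangent[OF
      assms(3)]] by simp

lemma vf_apply:
  assumes "(U, \<phi>) \<in> A" "x \<in> \<phi> ` U" "X \<in> vector_fields A" "f \<in> smooth_funs A"
  shows "X (inv_into U \<phi> x) f = frechet_derivative (\<lambda>x. f (inv_into U \<phi> x)) (at x) (vcomp U \<phi> X x)"
  by (subst vcomp_coord[OF assms(1-3)]) (simp add: coord_vec_apply[OF assms(4)] chart_point[OF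
      assms(1,2)])

lemma vcomp_eqI:
  assumes "(U, \<phi>) \<in> A" "x \<in> \<phi> ` U" "X (inv_into U \<phi> x) = coord_vec A U \<phi> b (inv_into U \<phi> x)"
  shows "vcomp U \<phi> X x = b"
  unfolding vcomp_def assms(3) by (rule tcomp_coord[OF assms(1) chart_point(1)[OF assms(1,2)]])

lemma vcomp_zero: "(U, \<phi>) \<in> A \<Longrightarrow> x \<in> \<phi> ` U \<Longrightarrow> vcomp U \<phi> 0 x = 0"
  by (rule vcomp_eqI) (simp_all add: coord_vec_zero chart_point)

lemma vcomp_add:
  assumes "(U, \<phi>) \<in> A" "x \<in> \<phi> ` U" "X \<in> vector_fields A" "Y \<in> vector_fields A"
  shows "vcomp U \<phi> (X + Y) x = vcomp U \<phi> X x + vcomp U \<phi> Y x"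
proof -
  have "(X + Y) q = X q + Y q" for q by (simp add: fun_eq_iff)
  then show ?thesis
    unfolding vcomp_def by (metis tcomp_add[OF assms(1) chart_point(1)[OF assms(1,2)]] vf_tangent
        assms(3,4))
qed

lemma vcomp_diff:
  assumes "(U, \<phi>) \<in> A" "x \<in> \<phi> ` U" "X \<in> vector_fields A" "Y \<in> vector_fields A"
  shows "vcomp U \<phi> (X - Y) x = vcomp U \<phi> X x - vcomp U \<phi> Y x"
proof -
  have "(X - Y) q = X q - Y q" for q by (simp add: fun_eq_iff)
  then show ?thesis
    unfolding vcomp_def by (metis tcomp_diff[OF assms(1) chart_point(1)[OF assms(1,2)]] vf_tangent
        assms(3,4))
qed

lemma vcomp_fscale:
  assumes "(U, \<phi>) \<in> A" "x \<in> \<phi> ` U" "X \<in> vector_fields A"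
  shows "vcomp U \<phi> (fscale h X) x = h (inv_into U \<phi> x) *\<^sub>R vcomp U \<phi> X x"
  unfolding vcomp_def fscale_def
  by (rule tcomp_scale[OF assms(1) chart_point(1)[OF assms(1,2)]]) (intro vf_tangent assms)+

lemma vcomp_sum:
  assumes "(U, \<phi>) \<in> A" "x \<in> \<phi> ` U" "finite I" "\<And>i. i \<in> I \<Longrightarrow> X i \<in> vector_fields A"
  shows "vcomp U \<phi> (\<Sum>i\<in>I. X i) x = (\<Sum>i\<in>I. vcomp U \<phi> (X i) x)"
  using assms(3,4)
  by (induction I rule: finite_induct) (auto simp: vcomp_zero vcomp_add vf_sum assms(1,2))

lemma vf_eq_iff:
  assumes "(U, \<phi>) \<in> A" "x \<in> \<phi> ` U" "X \<in> vector_fields A" "Y \<in> vector_fields A"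
  shows "X (inv_into U \<phi> x) = Y (inv_into U \<phi> x) \<longleftrightarrow> vcomp U \<phi> X x = vcomp U \<phi> Y x"
  using vcomp_coord[OF assms(1,2)] assms(3,4) by (metis vcomp_def)

text \<open>Near each point the components are the values of \<open>X\<close> on global functions
  that agree with linear coordinates, and vector fields map smooth functions to smooth
  functions.\<close>

lemma vcomp_smooth:
  assumes c: "(U, \<phi>) \<in> A" and X: "X \<in> vector_fields A"
  shows "smooth_on (\<phi> ` U) (vcomp U \<phi> X)"
proof (rule smooth_on_local)
  fix x0 assume "x0 \<in> \<phi> ` U"
  then obtain p where p: "p \<in> U" "x0 = \<phi> p" by auto
  obtain r y where r: "r > 0" "ball (\<phi> p) r \<subseteq> \<phi> ` U" and y: "\<And>b. y b \<in> smooth_funs A"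
    "\<And>b x. x \<in> ball (\<phi> p) r \<Longrightarrow> y b (inv_into U \<phi> x) = x \<bullet> b"
    "\<And>b b' q. q \<in> U \<Longrightarrow> \<phi> q \<in> ball (\<phi> p) r \<Longrightarrow> coord_vec A U \<phi> b' q (y b) = b' \<bullet> b"
    by (rule coord_functions[OF c p(1)]) (rule that)
  have "smooth_on (ball (\<phi> p) r) (vcomp U \<phi> X)"
  proof (rule smooth_on_componentwise[OF open_ball])
    fix b :: 'e
    show "smooth_on (ball (\<phi> p) r) (\<lambda>x. vcomp U \<phi> X x \<bullet> b)"
    proof (rule smooth_on_cong[OF open_ball])
      show "smooth_on (ball (\<phi> p) r) (\<lambda>x. X (inv_into U \<phi> x) (y b))"
        by (rule smooth_on_subset[OF smooth_funsD[OF vf_smooth[OF X y(1)] c] r(2)])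
      fix x assume x: "x \<in> ball (\<phi> p) r"
      then have "x \<in> \<phi> ` U" using r by blast
      from vcomp_coord[OF c this X] chart_point[OF c this] show "X (inv_into U \<phi> x) (y b) = vcomp
          U \<phi> X x \<bullet> b"
        using y(3)[of "inv_into U \<phi> x"] x by simp
    qed
  qed
  then show "\<exists>T. open T \<and> x0 \<in> T \<and> smooth_on T (vcomp U \<phi> X)"
    using r p by (intro exI[of _ "ball (\<phi> p) r"]) auto
qed

text \<open>The passage from coordinate data to global objects. The ball depends neither on
  \<open>g\<close> nor on \<open>\<xi>\<close>, so a whole frame can be extended with agreement on a
  common ball.\<close>

lemma local_extensions:
  assumes c: "(U, \<phi>) \<in> A" "p \<in> U"
  obtains r where "r > 0" "ball (\<phi> p) r \<subseteq> \<phi> ` U"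
    "\<And>g. smooth_on (\<phi> ` U) g \<Longrightarrow> \<exists>f\<in>smooth_funs A. \<forall>x\<in>ball (\<phi> p) r. f (inv_into U \<phi> x) = g x"
    "\<And>\<xi>. smooth_on (\<phi> ` U) \<xi> \<Longrightarrow> \<exists>X\<in>vector_fields A. \<forall>x\<in>ball (\<phi> p) r. vcomp U \<phi> X x = \<xi> x"
proof -
  obtain r and \<rho> :: "'e \<Rightarrow> real" where r: "r > 0" "ball (\<phi> p) r \<subseteq> \<phi> ` U"
    and r1: "\<And>x. x \<in> ball (\<phi> p) r \<Longrightarrow> \<rho> x = 1"
    and z: "\<And>q. q \<in> U \<Longrightarrow> q \<notin> UNIV \<Longrightarrow> \<rho> (\<phi> q) = 0"
    and s: "\<And>g. smooth_on (\<phi> ` U) g \<Longrightarrow> (\<lambda>q. if q \<in> U then \<rho> (\<phi> q) * g (\<phi> q) else 0) \<in> smooth_funs A"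
    by (rule extend_smooth[OF c UNIV_I open_UNIV]) (rule that)
  have pt: "inv_into U \<phi> x \<in> U" "\<phi> (inv_into U \<phi> x) = x" if "x \<in> ball (\<phi> p) r" for x
    using chart_point[OF c(1)] that r(2) by blast+
  show thesis
  proof (rule that[OF r])
    fix g :: "'e \<Rightarrow> real" assume "smooth_on (\<phi> ` U) g"
    from s[OF this] show "\<exists>f\<in>smooth_funs A. \<forall>x\<in>ball (\<phi> p) r. f (inv_into U \<phi> x) = g x"
      by (rule rev_bexI) (simp add: pt r1)
  next
    fix \<xi> :: "'e \<Rightarrow> 'e" assume \<xi>: "smooth_on (\<phi> ` U) \<xi>"
    define X where "X q = (if q \<in> U then coord_vec A U \<phi> (\<rho> (\<phi> q) *\<^sub>R \<xi> (\<phi> q)) q else 0)" for q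
    have "X \<in> vector_fields A"
      unfolding vector_fields_def
    proof (intro CollectI conjI allI ballI)
      show "X q \<in> tangent_space A q" for q
        using coord_vec_tangent[OF c(1)] zero_tangent by (simp add: X_def)
      fix f assume f: "f \<in> smooth_funs A"
      have "(\<lambda>q. X q f) = (\<lambda>q. if q \<in> U then \<rho> (\<phi> q) * frechet_derivative (\<lambda>x. f (inv_into U \<phi> x))
          (at (\<phi> q)) (\<xi> (\<phi> q)) else 0)"
        by (auto simp: X_def fun_eq_iff coord_vec_linear[OF c(1)] tscale_def coord_vec_apply[OF f])
      also have "\<dots> \<in> smooth_funs A"
        by (intro s smooth_on_deriv_apply chart_open_image[OF c(1)] smooth_funsD[OF f c(1)] \<xi>)
      finally show "(\<lambda>q. X q f) \<in> smooth_funs A" .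
    qed
    moreover have "vcomp U \<phi> X x = \<xi> x" if "x \<in> ball (\<phi> p) r" for x
      by (rule vcomp_eqI[OF c(1)]) (use that r(2) in \<open>auto simp: X_def pt r1\<close>)
    ultimately show "\<exists>X\<in>vector_fields A. \<forall>x\<in>ball (\<phi> p) r. vcomp U \<phi> X x = \<xi> x" by blast
  qed
qed

text \<open>The two iterated derivatives contain the second derivative of \<open>f\<close> with its
  directions exchanged. These terms cancel, and what remains is of first order in
  \<open>f\<close>.\<close>

lemma lie_bracket_coord:
  assumes c: "(U, \<phi>) \<in> A" "x \<in> \<phi> ` U" and X: "X \<in> vector_fields A" and Y: "Y \<in> vector_fields A"
  shows "lie_bracket X Y (inv_into U \<phi> x) = coord_vec A U \<phi>
    (frechet_derivative (vcomp U \<phi> Y) (at x) (vcomp U \<phi> X x)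
      - frechet_derivative (vcomp U \<phi> X) (at x) (vcomp U \<phi> Y x)) (inv_into U \<phi> x)" (is "?L =
          coord_vec A U \<phi> ?b ?p")
proof
  fix f
  show "?L f = coord_vec A U \<phi> ?b ?p f"
  proof (cases "f \<in> smooth_funs A")
    case True
    let ?f = "\<lambda>x. f (inv_into U \<phi> x)"
    have sf: "smooth_on (\<phi> ` U) ?f" by (rule smooth_funsD[OF True c(1)])
    have o: "open (\<phi> ` U)" by (rule chart_open_image[OF c(1)])
    have "X ?p (deriv_along Y f) = frechet_derivative (\<lambda>y. frechet_derivative ?f (at y) (vcomp U \<phi>
        Y x)) (at x) (vcomp U \<phi> X x)
        + frechet_derivative ?f (at x) (frechet_derivative (vcomp U \<phi> Y) (at x) (vcomp U \<phi> X x))"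
      if X: "X \<in> vector_fields A" and Y: "Y \<in> vector_fields A" for X Y
    proof -
      have "X ?p (deriv_along Y f) = frechet_derivative (\<lambda>x. Y (inv_into U \<phi> x) f) (at x) (vcomp U
          \<phi> X x)"
        unfolding deriv_along_def by (rule vf_apply[OF c X vf_smooth[OF Y True]])
      also have "\<dots> = frechet_derivative (\<lambda>x. frechet_derivative ?f (at x) (vcomp U \<phi> Y x)) (at x)
          (vcomp U \<phi> X x)"
        using frechet_derivative_cong_open(2)[OF o c(2), of "\<lambda>x. Y (inv_into U \<phi> x) f"]
            vf_apply[OF c(1) _ Y True] by simp
      finally show ?thesis
        using has_derivative_deriv_apply[OF o c(2) sf vcomp_smooth[OF c(1) Y]] by simp
    qed
    note this[OF X Y] this[OF Y X]
    then have "?L f = frechet_derivative ?f (at x) (frechet_derivative (vcomp U \<phi> Y) (at x) (vcomp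
        U \<phi> X x))
        - frechet_derivative ?f (at x) (frechet_derivative (vcomp U \<phi> X) (at x) (vcomp U \<phi> Y x))"
      using mixed_derivatives[OF o c(2) sf, of "vcomp U \<phi> Y x" "vcomp U \<phi> X x"] by (simp add:
          lie_bracket_def)
    also have "\<dots> = frechet_derivative ?f (at x) ?b"
      by (rule linear_diff[symmetric, OF bounded_linear.linear[OF smooth_on_linear_derivative[OF
          sf c(2)]]])
    finally show ?thesis by (simp add: coord_vec_apply[OF True] chart_point[OF c])
  next
    case False
    \<comment> \<open>Tangent vectors are \<open>0\<close> on functions that are not smooth, so the
      inner derivatives are the zero function, which the outer vectors annihilate.\<close>
    then have "deriv_along X f = (\<lambda>_. 0)" "deriv_along Y f = (\<lambda>_. 0)"
      using tangent_not_smooth[OF vf_tangent[OF X]] tangent_not_smooth[OF vf_tangent[OF Y]]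
      by (simp_all add: deriv_along_def)
    then show ?thesis
      using False tangent_zero[OF vf_tangent[OF X]] tangent_zero[OF vf_tangent[OF Y]]
      by (simp add: lie_bracket_def coord_vec_def)
  qed
qed

lemma vcomp_lie_bracket:
  assumes "(U, \<phi>) \<in> A" "x \<in> \<phi> ` U" "X \<in> vector_fields A" "Y \<in> vector_fields A"
  shows "vcomp U \<phi> (lie_bracket X Y) x = frechet_derivative (vcomp U \<phi> Y) (at x) (vcomp U \<phi> X x)
      - frechet_derivative (vcomp U \<phi> X) (at x) (vcomp U \<phi> Y x)"
  by (rule vcomp_eqI[OF assms(1,2)]) (rule lie_bracket_coord[OF assms])

lemma vf_lie_bracket:
  assumes X: "X \<in> vector_fields A" and Y: "Y \<in> vector_fields A"
  shows "lie_bracket X Y \<in> vector_fields A"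
  unfolding vector_fields_def
proof (intro CollectI conjI allI ballI)
  fix p
  obtain U \<phi> where c: "(U, \<phi>) \<in> A" "p \<in> U" using chart_at by blast
  then show "lie_bracket X Y p \<in> tangent_space A p"
    using lie_bracket_coord[OF c(1) imageI[OF c(2)] X Y] coord_vec_tangent[OF c] by simp
next
  fix f assume f: "f \<in> smooth_funs A"
  have "(\<lambda>p. X p (deriv_along Y f)) + (\<lambda>p. (-1) * Y p (deriv_along X f)) \<in> smooth_funs A"
    unfolding deriv_along_def
    by (rule smooth_funs_add[OF vf_smooth[OF X vf_smooth[OF Y f]]
          smooth_funs_scale[OF vf_smooth[OF Y vf_smooth[OF X f]]]])
  then show "(\<lambda>p. lie_bracket X Y p f) \<in> smooth_funs A" by (simp add: lie_bracket_def plus_fun_def)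
qed

end

section \<open>Christoffel symbols\<close>

locale smooth_connection = smooth_manifold A for A :: "('a::t2_space, 'e::euclidean_space) atlas" +
  fixes nabla :: "'a connection"
  assumes linear_connection: "linear_connection A nabla"
begin

lemma nabla_vf: "X \<in> vector_fields A \<Longrightarrow> Y \<in> vector_fields A \<Longrightarrow> nabla X Y \<in> vector_fields A"
  and nabla_add_left: "X \<in> vector_fields A \<Longrightarrow> X' \<in> vector_fields A \<Longrightarrow> Y \<in> vector_fields A \<Longrightarrow>
    nabla (X + X') Y = nabla X Y + nabla X' Y"
  and nabla_fscale_left: "h \<in> smooth_funs A \<Longrightarrow> X \<in> vector_fields A \<Longrightarrow> Y \<in> vector_fields A \<Longrightarrow>
    nabla (fscale h X) Y = fscale h (nabla X Y)"
  and nabla_add_right: "X \<in> vector_fields A \<Longrightarrow> Y \<in> vector_fields A \<Longrightarrow> Y' \<in> vector_fields A \<Longrightarrow>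
    nabla X (Y + Y') = nabla X Y + nabla X Y'"
  and nabla_fscale_right: "h \<in> smooth_funs A \<Longrightarrow> X \<in> vector_fields A \<Longrightarrow> Y \<in> vector_fields A \<Longrightarrow>
    nabla X (fscale h Y) = fscale (deriv_along X h) Y + fscale h (nabla X Y)"
  using linear_connection by (auto simp: linear_connection_def)

lemma nabla_zero: assumes "X \<in> vector_fields A" shows "nabla 0 X = 0" "nabla X 0 = 0"
  using nabla_add_left[OF vf_zero vf_zero assms] nabla_add_right[OF assms vf_zero vf_zero] by
      simp_all

lemma nabla_sum:
  assumes "finite I" "\<And>i. i \<in> I \<Longrightarrow> X i \<in> vector_fields A" "Y \<in> vector_fields A"
  shows "nabla (\<Sum>i\<in>I. X i) Y = (\<Sum>i\<in>I. nabla (X i) Y)" "nabla Y (\<Sum>i\<in>I. X i) = (\<Sum>i\<in>I. nabla Y (X i))"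
  using assms(1,2)
  by (induction I rule: finite_induct) (auto simp: nabla_zero nabla_add_left nabla_add_right
      vf_sum assms(3))

text \<open>After multiplication by a cut-off the fields agree globally. In the first argument
  \<open>nabla\<close> is linear over functions; in the second, the additional Leibniz term
  multiplies \<open>Y\<close> and \<open>Y'\<close> by the same function and these agree at
  \<open>p\<close>. Evaluating at \<open>p\<close>, where the cut-off is \<open>1\<close>, removes
  it.\<close>

lemma nabla_local:
  assumes vf: "X \<in> vector_fields A" "X' \<in> vector_fields A" "Y \<in> vector_fields A" "Y' \<in>
      vector_fields A"
    and W: "open W" "p \<in> W" and eq: "\<And>q. q \<in> W \<Longrightarrow> X q = X' q" "\<And>q. q \<in> W \<Longrightarrow> Y q = Y' q"
  shows "nabla X Y p = nabla X' Y' p"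
proof -
  obtain b where b: "b \<in> smooth_funs A" "b p = 1" "\<And>q. q \<notin> W \<Longrightarrow> b q = (0::real)"
    using bump_at[OF W] by blast
  have one: "tscale 1 v = v" for v :: "'a tvec" by (simp add: tscale_def)
  have zero: "tscale 0 v = 0" for v :: "'a tvec" by (simp add: tscale_def fun_eq_iff)
  have cut: "fscale b Z = fscale b Z'" if "\<And>q. q \<in> W \<Longrightarrow> Z q = Z' q" for Z Z'
  proof
    fix q show "fscale b Z q = fscale b Z' q"
      using that[of q] b(3)[of q] by (cases "q \<in> W") (simp_all add: fscale_def zero)
  qed
  have "fscale b X = fscale b X'" "fscale b Y = fscale b Y'"
    by (rule cut, rule eq, assumption)+
  then have "fscale b (nabla X Y) = fscale b (nabla X' Y)"
    and "fscale (deriv_along X' b) Y + fscale b (nabla X' Y) = fscale (deriv_along X' b) Y' +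
        fscale b (nabla X' Y')"
    using nabla_fscale_left[OF b(1) vf(1,3)] nabla_fscale_left[OF b(1) vf(2,3)]
      nabla_fscale_right[OF b(1) vf(2,3)] nabla_fscale_right[OF b(1) vf(2,4)] by simp_all
  from fun_cong[OF this(1), of p] fun_cong[OF this(2), of p] show ?thesis
    using eq(2)[OF W(2)] b(2) by (simp add: fscale_def one)
qed

text \<open>The coordinates of vector fields can be prescribed arbitrarily only on a smaller set \<open>B\<close>, since
  they have to be cut off to give global vector fields.\<close>

definition christoffel_on :: "'a set \<Rightarrow> ('a \<Rightarrow> 'e) \<Rightarrow> 'e set \<Rightarrow> ('e \<Rightarrow> 'e \<Rightarrow> 'e \<Rightarrow> 'e) \<Rightarrow> bool" where
  "christoffel_on U \<phi> B \<Gamma> \<longleftrightarrow> B \<subseteq> \<phi> ` U \<and> (\<forall>x. bilinear (\<Gamma> x)) \<and>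
     (\<forall>h k. smooth_on B (\<lambda>x. \<Gamma> x h k)) \<and>
     (\<forall>\<xi>. smooth_on (\<phi> ` U) \<xi> \<longrightarrow> (\<exists>X\<in>vector_fields A. \<forall>x\<in>B. vcomp U \<phi> X x = \<xi> x)) \<and>
     (\<forall>X\<in>vector_fields A. \<forall>Y\<in>vector_fields A. \<forall>x\<in>B.
        vcomp U \<phi> (nabla X Y) x = frechet_derivative (vcomp U \<phi> Y) (at x) (vcomp U \<phi> X x)
          + \<Gamma> x (vcomp U \<phi> X x) (vcomp U \<phi> Y x))"

lemma christoffel_onD:
  assumes "christoffel_on U \<phi> B \<Gamma>"
  shows "B \<subseteq> \<phi> ` U" "bilinear (\<Gamma> x)" "smooth_on B (\<lambda>x. \<Gamma> x h k)"
  using assms by (simp_all add: christoffel_on_def)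

lemma nabla_coord:
  assumes "christoffel_on U \<phi> B \<Gamma>" "X \<in> vector_fields A" "Y \<in> vector_fields A" "x \<in> B"
  shows "vcomp U \<phi> (nabla X Y) x = frechet_derivative (vcomp U \<phi> Y) (at x) (vcomp U \<phi> X x)
    + \<Gamma> x (vcomp U \<phi> X x) (vcomp U \<phi> Y x)"
  using assms by (simp add: christoffel_on_def)

lemma constant_fields:
  assumes "(U, \<phi>) \<in> A" "christoffel_on U \<phi> B \<Gamma>"
  obtains E where "\<And>h. E h \<in> vector_fields A" "\<And>h x. x \<in> B \<Longrightarrow> vcomp U \<phi> (E h) x = h"
proof -
  have "\<forall>h. \<exists>X. X \<in> vector_fields A \<and> (\<forall>x\<in>B. vcomp U \<phi> X x = h)"
    using assms(2) smooth_on_const[OF chart_open_image[OF assms(1)]]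
    unfolding christoffel_on_def by blast
  from choice[OF this] show thesis using that by blast
qed

text \<open>Global fields \<open>E b\<close> with constant components on the ball stand in for the
  coordinate fields. On the ball \<open>X\<close> and \<open>Y\<close> are combinations of them with
  smooth global coefficients, and locality of \<open>nabla\<close> with the Leibniz rule yields the
  coordinate formula.\<close>

lemma christoffel_symbols:
  assumes c: "(U, \<phi>) \<in> A" "p \<in> U"
  obtains r \<Gamma> where "r > 0" "christoffel_on U \<phi> (ball (\<phi> p) r) \<Gamma>"
proof -
  obtain r where r: "r > 0" "ball (\<phi> p) r \<subseteq> \<phi> ` U"
    and extf: "\<And>g. smooth_on (\<phi> ` U) g \<Longrightarrow> \<exists>f\<in>smooth_funs A. \<forall>x\<in>ball (\<phi> p) r. f (inv_into U \<phi> x) = g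
        x"
    and extv: "\<And>\<xi>. smooth_on (\<phi> ` U) \<xi> \<Longrightarrow> \<exists>X\<in>vector_fields A. \<forall>x\<in>ball (\<phi> p) r. vcomp U \<phi> X x = \<xi> x"
    by (rule local_extensions[OF c]) (rule that)
  let ?B = "ball (\<phi> p) r"
  have o: "open (\<phi> ` U)" by (rule chart_open_image[OF c(1)])
  have "\<forall>b. \<exists>X. X \<in> vector_fields A \<and> (\<forall>x\<in>?B. vcomp U \<phi> X x = b)"
    using extv[OF smooth_on_const[OF o]] by blast
  from choice[OF this] obtain E where E: "\<And>b. E b \<in> vector_fields A" "\<And>b x. x \<in> ?B \<Longrightarrow> vcomp U \<phi> (E
      b) x = b"
    by blast
  define G where "G b c = vcomp U \<phi> (nabla (E b) (E c))" for b c
  have G: "smooth_on ?B (G b c)" for b c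
    unfolding G_def by (rule smooth_on_subset[OF vcomp_smooth[OF c(1)] r(2)]) (intro nabla_vf E)
  \<comment> \<open>Extending bilinearly from the basis makes \<open>\<Gamma> x\<close> bilinear for
    every \<open>x\<close>, also off the ball, as \<open>christoffel_on\<close> asks.\<close>
  define \<Gamma> where "\<Gamma> x h k = (\<Sum>b\<in>Basis. \<Sum>c\<in>Basis. ((h \<bullet> b) * (k \<bullet> c)) *\<^sub>R G b c x)" for x h k
  have bil: "bilinear (\<Gamma> x)" for x
    unfolding bilinear_def \<Gamma>_def
    by (auto intro!: linearI simp: inner_add_left algebra_simps sum.distrib scaleR_sum_right
        scaleR_add_left)
  have smooth: "smooth_on ?B (\<lambda>x. \<Gamma> x h k)" for h k
    unfolding \<Gamma>_def by (intro smooth_on_sum smooth_on_scaleR smooth_on_const G open_ball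
        finite_Basis)
  have formula: "vcomp U \<phi> (nabla X Y) x = frechet_derivative (vcomp U \<phi> Y) (at x) (vcomp U \<phi> X x)
        + \<Gamma> x (vcomp U \<phi> X x) (vcomp U \<phi> Y x)"
    if X: "X \<in> vector_fields A" and Y: "Y \<in> vector_fields A" and x: "x \<in> ?B" for X Y x
  proof -
    have xU: "x \<in> \<phi> ` U" using x r by blast
    have frame: "\<exists>f. (\<forall>b. f b \<in> smooth_funs A) \<and> (\<forall>b. \<forall>x\<in>?B. f b (inv_into U \<phi> x) = vcomp U \<phi> Z x
        \<bullet> b)"
      if Z: "Z \<in> vector_fields A" for Z
    proof -
      have "\<forall>b. \<exists>f. f \<in> smooth_funs A \<and> (\<forall>x\<in>?B. f (inv_into U \<phi> x) = vcomp U \<phi> Z x \<bullet> b)"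
        using extf[OF smooth_on_inner[OF o vcomp_smooth[OF c(1) Z]]] by blast
      from choice[OF this] show ?thesis by blast
    qed
    obtain f where f: "\<And>b. f b \<in> smooth_funs A" "\<And>b x. x \<in> ?B \<Longrightarrow> f b (inv_into U \<phi> x) = vcomp U \<phi> X
        x \<bullet> b"
      using frame[OF X] by blast
    obtain g where g: "\<And>b. g b \<in> smooth_funs A" "\<And>b x. x \<in> ?B \<Longrightarrow> g b (inv_into U \<phi> x) = vcomp U \<phi> Y
        x \<bullet> b"
      using frame[OF Y] by blast
    define X' where "X' = (\<Sum>b\<in>Basis. fscale (f b) (E b))"
    define Y' where "Y' = (\<Sum>b\<in>Basis. fscale (g b) (E b))"
    have fE: "fscale (f b) (E b) \<in> vector_fields A" and gE: "fscale (g b) (E b) \<in> vector_fields A"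
        for b
      by (intro vf_fscale f g E)+
    have X'Y': "X' \<in> vector_fields A" "Y' \<in> vector_fields A"
      unfolding X'_def Y'_def by (intro vf_sum fE gE finite_Basis)+
    have comp: "vcomp U \<phi> X' z = vcomp U \<phi> X z" "vcomp U \<phi> Y' z = vcomp U \<phi> Y z" if z: "z \<in> ?B"
        for z
    proof -
      have zU: "z \<in> \<phi> ` U" using z r by blast
      show "vcomp U \<phi> X' z = vcomp U \<phi> X z" "vcomp U \<phi> Y' z = vcomp U \<phi> Y z"
        by (simp_all add: X'_def Y'_def vcomp_sum[OF c(1) zU] fE gE vcomp_fscale[OF c(1) zU E(1)]
            f(2)[OF z] g(2)[OF z]
            E(2)[OF z] euclidean_representation)
    qed
    have W: "open (U \<inter> \<phi> -` ?B)"
      using chart_homeomorphism[OF c(1)] chart_open[OF c(1)]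
      by (intro continuous_open_preimage) (auto simp: homeomorphism_def)
    have eqW: "X q = X' q" "Y q = Y' q" if q: "q \<in> U \<inter> \<phi> -` ?B" for q
      using vf_eq_iff[OF c(1), of "\<phi> q"] comp[of "\<phi> q"] q X Y X'Y' chart_inv[OF c(1)] by auto
    have inW: "inv_into U \<phi> x \<in> U \<inter> \<phi> -` ?B" using x chart_point[OF c(1) xU] by simp
    have "nabla X Y (inv_into U \<phi> x) = nabla X' Y' (inv_into U \<phi> x)"
      by (rule nabla_local[OF X X'Y'(1) Y X'Y'(2) W inW eqW])
    then have "vcomp U \<phi> (nabla X Y) x = vcomp U \<phi> (nabla X' Y') x" by (simp add: vcomp_def)
    also have "\<dots> = (\<Sum>b\<in>Basis. (vcomp U \<phi> X x \<bullet> b) *\<^sub>R vcomp U \<phi> (nabla (E b) Y') x)"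
      unfolding X'_def
      by (simp add: nabla_sum(1) fE X'Y' nabla_fscale_left f E vcomp_sum[OF c(1) xU] vf_fscale
          nabla_vf
          vcomp_fscale[OF c(1) xU] f(2)[OF x])
    also have "\<dots> = (\<Sum>b\<in>Basis. (vcomp U \<phi> X x \<bullet> b) *\<^sub>R (frechet_derivative (vcomp U \<phi> Y) (at x) b
        + (\<Sum>c\<in>Basis. (vcomp U \<phi> Y x \<bullet> c) *\<^sub>R G b c x)))"
    proof (intro sum.cong refl arg_cong[where f="scaleR _"])
      fix b :: 'e
      \<comment> \<open>The Leibniz term differentiates the coefficient \<open>g d\<close> along
        \<open>E b\<close>; on the ball that coefficient is the component of \<open>Y\<close> along
        \<open>d\<close>.\<close>
      have yder: "E b (inv_into U \<phi> x) (g d) = frechet_derivative (vcomp U \<phi> Y) (at x) b \<bullet> d" for d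
      proof -
        have "E b (inv_into U \<phi> x) (g d) = frechet_derivative (\<lambda>x. g d (inv_into U \<phi> x)) (at x) b"
          using vf_apply[OF c(1) xU E(1) g(1)] E(2)[OF x] by simp
        also have "\<dots> = frechet_derivative (\<lambda>x. vcomp U \<phi> Y x \<bullet> d) (at x) b"
          using frechet_derivative_cong_open(2)[OF open_ball x, of "\<lambda>x. g d (inv_into U \<phi> x)"]
              g(2) by simp
        also have "\<dots> = frechet_derivative (vcomp U \<phi> Y) (at x) b \<bullet> d"
          by (rule frechet_derivative_bounded_linear_compose[OF bounded_linear_inner_left])
            (use smooth_on_has_derivative[OF vcomp_smooth[OF c(1) Y] xU] in \<open>auto simp:
                differentiable_def\<close>)
        finally show ?thesis .
      qed
      have "vcomp U \<phi> (nabla (E b) Y') x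
        = (\<Sum>d\<in>Basis. vcomp U \<phi> (fscale (deriv_along (E b) (g d)) (E d) + fscale (g d) (nabla (E b)
            (E d))) x)"
        unfolding Y'_def
        by (simp add: nabla_sum(2) gE E nabla_fscale_right g vcomp_sum[OF c(1) xU] vf_add
            vf_fscale nabla_vf
            deriv_along_def vf_smooth)
      also have "\<dots> = (\<Sum>d\<in>Basis. (frechet_derivative (vcomp U \<phi> Y) (at x) b \<bullet> d) *\<^sub>R d + (vcomp U \<phi>
          Y x \<bullet> d) *\<^sub>R G b d x)"
        by (simp add: vcomp_add[OF c(1) xU] vf_fscale nabla_vf deriv_along_def vf_smooth g E
            vcomp_fscale[OF c(1) xU]
            yder g(2)[OF x] E(2)[OF x] G_def)
      finally show "vcomp U \<phi> (nabla (E b) Y') x = frechet_derivative (vcomp U \<phi> Y) (at x) b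
        + (\<Sum>c\<in>Basis. (vcomp U \<phi> Y x \<bullet> c) *\<^sub>R G b c x)"
        by (simp add: sum.distrib euclidean_representation)
    qed
    also have "\<dots> = frechet_derivative (vcomp U \<phi> Y) (at x) (vcomp U \<phi> X x) + \<Gamma> x (vcomp U \<phi> X x)
        (vcomp U \<phi> Y x)"
      unfolding bounded_linear_expand[OF smooth_on_linear_derivative[OF vcomp_smooth[OF c(1) Y]
          xU], of "vcomp U \<phi> X x"] \<Gamma>_def
      by (simp add: scaleR_add_right sum.distrib scaleR_sum_right)
    finally show ?thesis .
  qed
  have "christoffel_on U \<phi> ?B \<Gamma>"
    unfolding christoffel_on_def using r(2) extv bil smooth formula by simp
  then show thesis by (rule that[OF r(1)])
qed

end

text \<open>Product rule for a matrix applied to a vector, when differentiability is known for the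
  columns \<open>T y b\<close>.\<close>

lemma has_derivative_linear_family:
  fixes T :: "'e::euclidean_space \<Rightarrow> 'e \<Rightarrow> 'e" and w :: "'e \<Rightarrow> 'e"
  assumes S: "open S" "x \<in> S" and T: "\<And>y. y \<in> S \<Longrightarrow> linear (T y)"
    and dT: "\<And>b. ((\<lambda>y. T y b) has_derivative T' b) (at x)"
    and dw: "(w has_derivative w') (at x)"
  shows "((\<lambda>y. T y (w y)) has_derivative (\<lambda>h. (\<Sum>b\<in>Basis. (w x \<bullet> b) *\<^sub>R T' b h) + T x (w' h))) (at
      x)"
proof -
  have expand: "T y v = (\<Sum>b\<in>Basis. (v \<bullet> b) *\<^sub>R T y b)" if "y \<in> S" for y v
    using bounded_linear_expand[of "T y" v] T[OF that] by (simp add: linear_conv_bounded_linear)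
  have "((\<lambda>y. \<Sum>b\<in>Basis. (w y \<bullet> b) *\<^sub>R T y b) has_derivative
      (\<lambda>h. \<Sum>b\<in>Basis. (w x \<bullet> b) *\<^sub>R T' b h + (w' h \<bullet> b) *\<^sub>R T x b)) (at x)"
    by (intro has_derivative_sum has_derivative_scaleR has_derivative_inner_left dw dT)
  moreover have "(\<Sum>b\<in>Basis. (w x \<bullet> b) *\<^sub>R T' b h + (w' h \<bullet> b) *\<^sub>R T x b)
      = (\<Sum>b\<in>Basis. (w x \<bullet> b) *\<^sub>R T' b h) + T x (w' h)" for h
    by (subst expand[OF S(2), of "w' h"]) (rule sum.distrib)
  ultimately have "((\<lambda>y. \<Sum>b\<in>Basis. (w y \<bullet> b) *\<^sub>R T y b) has_derivative
      (\<lambda>h. (\<Sum>b\<in>Basis. (w x \<bullet> b) *\<^sub>R T' b h) + T x (w' h))) (at x)" by simp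
  then show ?thesis
    by (rule has_derivative_transform_within_open[OF _ S]) (rule expand[symmetric])
qed

context smooth_manifold
begin

section \<open>Endomorphism fields in coordinates\<close>

definition ecomp :: "'a set \<Rightarrow> ('a \<Rightarrow> 'e) \<Rightarrow> 'a endo \<Rightarrow> 'e \<Rightarrow> 'e \<Rightarrow> 'e" where
  "ecomp U \<phi> F x h = tcomp U \<phi> (inv_into U \<phi> x) (F (inv_into U \<phi> x) (coord_vec A U \<phi> h (inv_into U
      \<phi> x)))"

lemma tensor_tangent: "tensor_field_11 A F \<Longrightarrow> v \<in> tangent_space A p \<Longrightarrow> F p v \<in> tangent_space A p"
  and tensor_add: "tensor_field_11 A F \<Longrightarrow> v \<in> tangent_space A p \<Longrightarrow> w \<in> tangent_space A p \<Longrightarrow>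
    F p (v + w) = F p v + F p w"
  and tensor_scale: "tensor_field_11 A F \<Longrightarrow> v \<in> tangent_space A p \<Longrightarrow> F p (tscale k v) = tscale k (F
      p v)"
  and tensor_vf: "tensor_field_11 A F \<Longrightarrow> X \<in> vector_fields A \<Longrightarrow> tapply F X \<in> vector_fields A"
  by (auto simp: tensor_field_11_def)

lemma tensor_diff:
  assumes F: "tensor_field_11 A F" and v: "v \<in> tangent_space A p" and w: "w \<in> tangent_space A p"
  shows "F p (v - w) = F p v - F p w"
proof -
  have eq: "u - u' = u + tscale (- 1) u'" for u u' :: "'a tvec" by (simp add: fun_eq_iff tscale_def)
  show ?thesis
    unfolding eq using tensor_add[OF F v tangent_space_scale[OF w]] tensor_scale[OF F w] by simp
qed

lemma coord_vec_sum:
  assumes c: "(U, \<phi>) \<in> A" "p \<in> U" and "finite I"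
  shows "coord_vec A U \<phi> (\<Sum>i\<in>I. f i) p = (\<Sum>i\<in>I. coord_vec A U \<phi> (f i) p)"
  using assms(3) by (induction I rule: finite_induct) (simp_all add: coord_vec_zero[OF c]
      coord_vec_linear(1)[OF c])

lemma ecomp_coord:
  assumes c: "(U, \<phi>) \<in> A" "q \<in> U" and F: "tensor_field_11 A F"
  shows "F q (coord_vec A U \<phi> h q) = coord_vec A U \<phi> (ecomp U \<phi> F (\<phi> q) h) q"
  using coord_tcomp[OF c tensor_tangent[OF F coord_vec_tangent[OF c]], of h] chart_inv[OF c]
  by (simp add: ecomp_def)

lemma ecomp_eqI:
  assumes c: "(U, \<phi>) \<in> A" "x \<in> \<phi> ` U"
    and eq: "F (inv_into U \<phi> x) (coord_vec A U \<phi> h (inv_into U \<phi> x)) = coord_vec A U \<phi> k (inv_into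
        U \<phi> x)"
  shows "ecomp U \<phi> F x h = k"
  unfolding ecomp_def eq by (rule tcomp_coord[OF c(1) chart_point(1)[OF c]])

lemma ecomp_linear:
  assumes c: "(U, \<phi>) \<in> A" "x \<in> \<phi> ` U" and F: "tensor_field_11 A F"
  shows "linear (ecomp U \<phi> F x)"
proof -
  note q = c(1) chart_point(1)[OF c]
  show ?thesis
    by (rule linearI) (simp_all add: ecomp_def coord_vec_linear[OF q] tensor_add[OF F]
        tensor_scale[OF F]
        coord_vec_tangent[OF q] tcomp_add[OF q] tcomp_scale[OF q] tensor_tangent[OF F])
qed

lemma vcomp_tapply:
  assumes c: "(U, \<phi>) \<in> A" "x \<in> \<phi> ` U" and X: "X \<in> vector_fields A"
  shows "vcomp U \<phi> (tapply F X) x = ecomp U \<phi> F x (vcomp U \<phi> X x)"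
  unfolding vcomp_def tapply_def ecomp_def
  using vcomp_coord[OF c X] by (simp add: vcomp_def)

text \<open>The column in direction \<open>h\<close> is locally the component function of
  \<open>F\<close> applied to a global field with constant components \<open>h\<close>.\<close>

lemma ecomp_smooth:
  assumes c: "(U, \<phi>) \<in> A" and F: "tensor_field_11 A F"
  shows "smooth_on (\<phi> ` U) (\<lambda>x. ecomp U \<phi> F x h)"
proof (rule smooth_on_local)
  fix x0 assume "x0 \<in> \<phi> ` U"
  then obtain p where p: "p \<in> U" "x0 = \<phi> p" by auto
  obtain r where r: "r > 0" "ball (\<phi> p) r \<subseteq> \<phi> ` U"
    and "\<And>g. smooth_on (\<phi> ` U) g \<Longrightarrow> \<exists>f\<in>smooth_funs A. \<forall>x\<in>ball (\<phi> p) r. f (inv_into U \<phi> x) = g x"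
    and ext: "\<And>\<xi>. smooth_on (\<phi> ` U) \<xi> \<Longrightarrow> \<exists>X\<in>vector_fields A. \<forall>x\<in>ball (\<phi> p) r. vcomp U \<phi> X x = \<xi> x"
    by (rule local_extensions[OF c p(1)]) (rule that)
  obtain X where X: "X \<in> vector_fields A" "\<And>x. x \<in> ball (\<phi> p) r \<Longrightarrow> vcomp U \<phi> X x = h"
    using ext[OF smooth_on_const[OF chart_open_image[OF c]]] by blast
  have "smooth_on (ball (\<phi> p) r) (\<lambda>x. ecomp U \<phi> F x h)"
  proof (rule smooth_on_cong[OF open_ball])
    show "smooth_on (ball (\<phi> p) r) (vcomp U \<phi> (tapply F X))"
      by (rule smooth_on_subset[OF vcomp_smooth[OF c tensor_vf[OF F X(1)]] r(2)])
    show "vcomp U \<phi> (tapply F X) x = ecomp U \<phi> F x h" if "x \<in> ball (\<phi> p) r" for x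
      using vcomp_tapply[OF c _ X(1)] X(2)[OF that] that r(2) by (metis subsetD)
  qed
  then show "\<exists>T. open T \<and> x0 \<in> T \<and> smooth_on T (\<lambda>x. ecomp U \<phi> F x h)"
    using r p by (intro exI[of _ "ball (\<phi> p) r"]) auto
qed

text \<open>Chain rule through the inverse of the coordinate change, whose derivative is
  \<open>D\<close>.\<close>

lemma coord_vec_chart_change:
  fixes f :: "'e \<Rightarrow> 'e"
  assumes c: "(U, \<phi>) \<in> A" and V: "open V" "V \<subseteq> U"
    and f: "smooth_on (\<phi> ` V) f" "inj_on f (\<phi> ` V)" "open (f ` \<phi> ` V)"
    and g: "smooth_on (f ` \<phi> ` V) (inv_into (\<phi> ` V) f)"
    and q: "q \<in> V" and D: "(inv_into (\<phi> ` V) f has_derivative D) (at (f (\<phi> q)))"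
  shows "coord_vec A V (f \<circ> \<phi>) b q = coord_vec A U \<phi> (D b) q"
proof
  fix h
  show "coord_vec A V (f \<circ> \<phi>) b q h = coord_vec A U \<phi> (D b) q h"
  proof (cases "h \<in> smooth_funs A")
    case True
    note inv = chart_change(2)[OF c V f g]
    let ?g = "inv_into (\<phi> ` V) f" and ?h = "\<lambda>x. h (inv_into U \<phi> x)"
    have "?g (f (\<phi> q)) = \<phi> q" using q by (simp add: inv_into_f_f[OF f(2)])
    then have "(?h has_derivative frechet_derivative ?h (at (\<phi> q))) (at (?g (f (\<phi> q))))"
      using smooth_fun_has_derivative[OF True c, of q] q V by auto
    from has_derivative_compose[OF D this]
    have "((\<lambda>y. ?h (?g y)) has_derivative (\<lambda>b. frechet_derivative ?h (at (\<phi> q)) (D b))) (at (f (\<phi>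
        q)))" .
    then have "((\<lambda>y. h (inv_into V (f \<circ> \<phi>) y)) has_derivative (\<lambda>b. frechet_derivative ?h (at (\<phi>
        q)) (D b))) (at (f (\<phi> q)))"
      by (rule has_derivative_transform_within_open[OF _ f(3)]) (use q inv in auto)
    then show ?thesis by (simp add: coord_vec_apply[OF True] frechet_derivative_eqI)
  qed (simp add: coord_vec_def)
qed

text \<open>Coordinates change by \<open>L'\<close>, hence coordinate vectors by its inverse
  \<open>L\<close>.\<close>

lemma linear_chart_change:
  assumes c: "(U, \<phi>) \<in> A" and L: "linear L" "linear L'" "\<And>x. L (L' x) = x" "\<And>x. L' (L x) = x"
  shows "(U, L' \<circ> \<phi>) \<in> A" and "\<And>q b. q \<in> U \<Longrightarrow> coord_vec A U (L' \<circ> \<phi>) b q = coord_vec A U \<phi> (L b) q"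
proof -
  have inj: "inj_on L' (\<phi> ` U)" using L(3) by (metis inj_onI)
  have bl: "bounded_linear L" "bounded_linear L'" using L by (simp_all add:
      linear_conv_bounded_linear)
  have o: "open (L' ` \<phi> ` U)"
    by (rule open_surjective_linear_image[OF chart_open_image[OF c] L(2)]) (use L(4) in \<open>metis
        surjI\<close>)
  have inv: "inv_into (\<phi> ` U) L' y = L y" if "y \<in> L' ` \<phi> ` U" for y
    using that by (auto simp: inv_into_f_f[OF inj] L(3))
  have sm: "smooth_on S M" if "bounded_linear M" "open S" for S and M :: "'e \<Rightarrow> 'e"
    using smooth_on_bounded_linear[OF that smooth_on_id[OF that(2)]] .
  have s': "smooth_on (L' ` \<phi> ` U) (inv_into (\<phi> ` U) L')"
    by (rule smooth_on_cong[OF o _ sm[OF bl(1) o]]) (simp add: inv)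
  note * = c chart_open[OF c] subset_refl sm[OF bl(2) chart_open_image[OF c]] inj o s'
  show "(U, L' \<circ> \<phi>) \<in> A" by (rule chart_change(1)[OF *])
  fix q b assume q: "q \<in> U"
  show "coord_vec A U (L' \<circ> \<phi>) b q = coord_vec A U \<phi> (L b) q"
  proof (rule coord_vec_chart_change[OF * q])
    show "(inv_into (\<phi> ` U) L' has_derivative L) (at (L' (\<phi> q)))"
      by (rule has_derivative_transform_within_open[OF bounded_linear_imp_has_derivative[OF bl(1)]
          o])
        (use q inv in auto)
  qed
qed

end

context smooth_connection
begin

text \<open>\<open>nabla F = 0\<close> is evaluated on fields with constant components: the
  derivative of the matrix of \<open>F\<close> in direction \<open>h\<close> is its commutator with
  the Christoffel matrix \<open>\<Gamma> x h\<close>.\<close>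

lemma parallel_endo_coord:
  assumes c: "(U, \<phi>) \<in> A" and F: "tensor_field_11 A F" "parallel_endo A nabla F"
    and G: "christoffel_on U \<phi> B \<Gamma>" and B: "open B" and x: "x \<in> B"
  shows "frechet_derivative (\<lambda>x. ecomp U \<phi> F x k) (at x) h
    = ecomp U \<phi> F x (\<Gamma> x h k) - \<Gamma> x h (ecomp U \<phi> F x k)"
proof -
  obtain E where E: "\<And>h. E h \<in> vector_fields A" "\<And>h x. x \<in> B \<Longrightarrow> vcomp U \<phi> (E h) x = h"
    by (rule constant_fields[OF c G]) (rule that)
  have BU: "y \<in> \<phi> ` U" if "y \<in> B" for y using that christoffel_onD(1)[OF G] by blast
  have dE: "frechet_derivative (vcomp U \<phi> (E k)) (at x) h = 0"
    using frechet_derivative_cong_open(2)[OF B x, of "vcomp U \<phi> (E k)" "\<lambda>_. k"] E(2) by simp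
  have dFE: "frechet_derivative (vcomp U \<phi> (tapply F (E k))) (at x) h
      = frechet_derivative (\<lambda>x. ecomp U \<phi> F x k) (at x) h"
    using frechet_derivative_cong_open(2)[OF B x, of "vcomp U \<phi> (tapply F (E k))"]
      vcomp_tapply[OF c BU E(1)] E(2) by simp
  have "nabla (E h) (tapply F (E k)) - tapply F (nabla (E h) (E k)) = 0"
    using F(2) E(1) by (simp add: parallel_endo_def cov_deriv_endo_def)
  then have "vcomp U \<phi> (nabla (E h) (tapply F (E k))) x = vcomp U \<phi> (tapply F (nabla (E h) (E k)))
      x"
    by simp
  then show ?thesis
    by (simp add: nabla_coord[OF G E(1) E(1) x] nabla_coord[OF G E(1) tensor_vf[OF F(1) E(1)] x]
        E(2)[OF x] dFE dE vcomp_tapply[OF c BU[OF x]] nabla_vf E(1) algebra_simps)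
qed

text \<open>In flat coordinates every parallel field of endomorphisms has constant coefficients.\<close>

lemma flat_chart:
  assumes c: "(U, \<phi>) \<in> A" "p \<in> U"
    and T: "\<And>X Y. X \<in> vector_fields A \<Longrightarrow> Y \<in> vector_fields A \<Longrightarrow> torsion nabla X Y = 0"
    and R: "\<And>X Y Z. X \<in> vector_fields A \<Longrightarrow> Y \<in> vector_fields A \<Longrightarrow> Z \<in> vector_fields A \<Longrightarrow>
      curvature nabla X Y Z = 0"
  obtains V \<psi> where "(V, \<psi>) \<in> A" "p \<in> V"
    "\<And>F q b. tensor_field_11 A F \<Longrightarrow> parallel_endo A nabla F \<Longrightarrow> q \<in> V \<Longrightarrow>
      F q (coord_vec A V \<psi> b q) = coord_vec A V \<psi> (ecomp U \<phi> F (\<phi> p) b) q"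
proof -
  obtain r \<Gamma> where r: "r > 0" and G: "christoffel_on U \<phi> (ball (\<phi> p) r) \<Gamma>"
    by (rule christoffel_symbols[OF c])
  let ?B = "ball (\<phi> p) r"
  note B = christoffel_onD(1)[OF G] and bil = christoffel_onD(2)[OF G]
    and smooth = christoffel_onD(3)[OF G] and formula = nabla_coord[OF G]
  obtain E where E: "\<And>h. E h \<in> vector_fields A" "\<And>h x. x \<in> ?B \<Longrightarrow> vcomp U \<phi> (E h) x = h"
    by (rule constant_fields[OF c(1) G]) (rule that)
  have dE: "frechet_derivative (vcomp U \<phi> (E k)) (at x) h = 0" if x: "x \<in> ?B" for x k h
    using frechet_derivative_cong_open(2)[OF open_ball x, of "vcomp U \<phi> (E k)" "\<lambda>_. k"] E(2) by simp
  have nE: "vcomp U \<phi> (nabla (E h) (E k)) x = \<Gamma> x h k" if "x \<in> ?B" for x h k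
    using formula[OF E(1) E(1) that] by (simp add: dE[OF that] E(2)[OF that])
  have BU: "x \<in> \<phi> ` U" if "x \<in> ?B" for x using that B by blast
  have lE: "vcomp U \<phi> (lie_bracket (E h) (E k)) x = 0" if x: "x \<in> ?B" for x h k
    using vcomp_lie_bracket[OF c(1) BU[OF x] E(1) E(1)] by (simp add: dE[OF x] E(2)[OF x])
  \<comment> \<open>Brackets of the fields \<open>E h\<close> vanish on the ball, so their torsion
    reduces to the antisymmetrisation of \<open>\<Gamma>\<close>.\<close>
  have sym: "\<Gamma> x h k = \<Gamma> x k h" if x: "x \<in> ?B" for x h k
  proof -
    have "vcomp U \<phi> (torsion nabla (E h) (E k)) x = \<Gamma> x h k - \<Gamma> x k h"
      unfolding torsion_def
      by (simp add: vcomp_diff[OF c(1) BU[OF x]] vf_diff nabla_vf E(1) vf_lie_bracket nE[OF x]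
          lE[OF x])
    then show ?thesis using T[OF E(1) E(1)] vcomp_zero[OF c(1) BU[OF x]] by simp
  qed
  \<comment> \<open>The bracket of \<open>E h\<close> and \<open>E k\<close> vanishes only on the
    ball. This suffices, since the coordinate formula at \<open>x\<close> uses nothing but its
    component at \<open>x\<close>.\<close>
  have flat: "frechet_derivative (\<lambda>x. \<Gamma> x k l) (at x) h + \<Gamma> x h (\<Gamma> x k l)
        = frechet_derivative (\<lambda>x. \<Gamma> x h l) (at x) k + \<Gamma> x k (\<Gamma> x h l)" if x: "x \<in> ?B" for x h k l
  proof -
    have n2: "vcomp U \<phi> (nabla (E h) (nabla (E k) (E l))) x
      = frechet_derivative (\<lambda>x. \<Gamma> x k l) (at x) h + \<Gamma> x h (\<Gamma> x k l)" for h k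
      using formula[OF E(1) nabla_vf[OF E(1) E(1)] x]
        frechet_derivative_cong_open(2)[OF open_ball x, of "vcomp U \<phi> (nabla (E k) (E l))"] nE
      by (simp add: E(2)[OF x] nE[OF x])
    have "vcomp U \<phi> (nabla (lie_bracket (E h) (E k)) (E l)) x = 0"
      using formula[OF vf_lie_bracket[OF E(1) E(1)] E(1) x] by (simp add: lE[OF x] dE[OF x]
          bilinear_lzero[OF bil])
    then have "vcomp U \<phi> (curvature nabla (E h) (E k) (E l)) x
      = frechet_derivative (\<lambda>x. \<Gamma> x k l) (at x) h + \<Gamma> x h (\<Gamma> x k l)
        - (frechet_derivative (\<lambda>x. \<Gamma> x h l) (at x) k + \<Gamma> x k (\<Gamma> x h l))"
      unfolding curvature_def
      by (simp add: vcomp_diff[OF c(1) BU[OF x]] vf_diff nabla_vf E(1) vf_lie_bracket n2)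
    then show ?thesis using R[OF E(1) E(1) E(1)] vcomp_zero[OF c(1) BU[OF x]] by simp
  qed
  have pB: "\<phi> p \<in> ?B" using r by simp
  obtain V0 f C r' where V0: "open V0" "\<phi> p \<in> V0" "V0 \<subseteq> ball (\<phi> p) r'" "ball (\<phi> p) r' \<subseteq> ?B"
    and f: "smooth_on V0 f" "inj_on f V0" "open (f ` V0)" "smooth_on (f ` V0) (inv_into V0 f)"
    and dinv: "\<And>x. x \<in> V0 \<Longrightarrow> (inv_into V0 f has_derivative C x) (at (f x))"
    and par: "\<And>v x. \<forall>x\<in>ball (\<phi> p) r'. (v has_derivative (\<lambda>h. - \<Gamma> x h (v x))) (at x) \<Longrightarrow>
       x \<in> ball (\<phi> p) r' \<Longrightarrow> v x = C x (v (\<phi> p))"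
    and dC: "\<And>x k. x \<in> ball (\<phi> p) r' \<Longrightarrow> ((\<lambda>x. C x k) has_derivative (\<lambda>h. - \<Gamma> x h (C x k))) (at x)"
    and C0: "\<And>k. C (\<phi> p) k = k"
    by (rule flat_coordinates[OF open_ball pB bil smooth sym flat], assumption, assumption) (rule
        that)
  define V where "V = U \<inter> \<phi> -` V0"
  have V: "open V" "V \<subseteq> U"
    using chart_homeomorphism[OF c(1)] chart_open[OF c(1)] V0
    by (auto simp: V_def homeomorphism_def intro!: continuous_open_preimage)
  have "V0 \<subseteq> \<phi> ` U" using V0 B by blast
  then have img: "\<phi> ` V = V0" by (auto simp: V_def)
  have ch: "(V, f \<circ> \<phi>) \<in> A" by (rule chart_change(1)[OF c(1) V]) (simp_all add: img f)
  have cv: "coord_vec A V (f \<circ> \<phi>) b q = coord_vec A U \<phi> (C (\<phi> q) b) q" if q: "q \<in> V" for q b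
    by (rule coord_vec_chart_change[OF c(1) V]) (use q imageI[OF q, of \<phi>] in \<open>simp_all add: img f
        dinv\<close>)
  have "F q (coord_vec A V (f \<circ> \<phi>) b q) = coord_vec A V (f \<circ> \<phi>) (ecomp U \<phi> F (\<phi> p) b) q"
    if F: "tensor_field_11 A F" "parallel_endo A nabla F" and q: "q \<in> V" for F q b
  proof -
    let ?F = "ecomp U \<phi> F"
    have qB: "\<phi> q \<in> ball (\<phi> p) r'" using q V0 by (auto simp: V_def)
    \<comment> \<open>A parallel endomorphism maps parallel fields to parallel fields, and these are
      determined by their value at \<open>\<phi> p\<close>. Hence the matrix of \<open>F\<close> in
      the frame \<open>C\<close> is the one at \<open>\<phi> p\<close>.\<close>
    have "?F (\<phi> q) (C (\<phi> q) b) = C (\<phi> q) (?F (\<phi> p) (C (\<phi> p) b))"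
    proof (rule par[of "\<lambda>x. ?F x (C x b)", OF _ qB], rule ballI)
      fix x assume x: "x \<in> ball (\<phi> p) r'"
      then have xB: "x \<in> ?B" and xU: "x \<in> \<phi> ` U" using V0(4) BU by blast+
      have lin: "linear (?F x)" by (rule ecomp_linear[OF c(1) xU F(1)])
      have linG: "linear (\<Gamma> x h)" for h using bil by (simp add: bilinear_def)
      have dF: "((\<lambda>y. ?F y k) has_derivative (\<lambda>h. ?F x (\<Gamma> x h k) - \<Gamma> x h (?F x k))) (at x)" for k
      proof -
        have "frechet_derivative (\<lambda>y. ?F y k) (at x) h = ?F x (\<Gamma> x h k) - \<Gamma> x h (?F x k)" for h
          by (rule parallel_endo_coord[OF c(1) F G open_ball xB])
        then have "frechet_derivative (\<lambda>y. ?F y k) (at x) = (\<lambda>h. ?F x (\<Gamma> x h k) - \<Gamma> x h (?F x k))"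
            by blast
        then show ?thesis using smooth_on_has_derivative[OF ecomp_smooth[OF c(1) F(1)] xU, of k]
            by simp
      qed
      have "((\<lambda>y. ?F y (C y b)) has_derivative (\<lambda>h. (\<Sum>d\<in>Basis. (C x b \<bullet> d) *\<^sub>R (?F x (\<Gamma> x h d) - \<Gamma>
          x h (?F x d)))
          + ?F x (- \<Gamma> x h (C x b)))) (at x)"
        by (rule has_derivative_linear_family[OF chart_open_image[OF c(1)] xU ecomp_linear[OF c(1)
            _ F(1)] dF dC[OF x]])
      \<comment> \<open>The terms in which \<open>?F x\<close> acts after \<open>\<Gamma>\<close>
        cancel between the derivative of the matrix and that of the frame.\<close>
      moreover have "(\<Sum>d\<in>Basis. (C x b \<bullet> d) *\<^sub>R (?F x (\<Gamma> x h d) - \<Gamma> x h (?F x d)))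
          + ?F x (- \<Gamma> x h (C x b)) = - \<Gamma> x h (?F x (C x b))" for h
      proof -
        have "linear (\<lambda>k. ?F x (\<Gamma> x h k) - \<Gamma> x h (?F x k))"
          by (intro linear_compose_sub linear_compose[OF linG lin, unfolded o_def]
              linear_compose[OF lin linG, unfolded o_def])
        then have "?F x (\<Gamma> x h (C x b)) - \<Gamma> x h (?F x (C x b))
          = (\<Sum>d\<in>Basis. (C x b \<bullet> d) *\<^sub>R (?F x (\<Gamma> x h d) - \<Gamma> x h (?F x d)))"
          by (rule bounded_linear_expand[OF linear_conv_bounded_linear[THEN iffD1]])
        then show ?thesis by (simp add: linear_neg[OF lin] algebra_simps)
      qed
      ultimately show "((\<lambda>y. ?F y (C y b)) has_derivative (\<lambda>h. - \<Gamma> x h (?F x (C x b)))) (at x)" by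
          simp
    qed
    then show ?thesis
      using ecomp_coord[OF c(1) _ F(1), of q "C (\<phi> q) b"] q V(2) by (auto simp: cv[OF q] C0)
  qed
  moreover have "p \<in> V" using c V0 by (simp add: V_def)
  ultimately show thesis using that[OF ch] by blast
qed

end

section \<open>Almost biparacomplex structures\<close>

text \<open>By anticommutation \<open>F\<close> exchanges the two eigenspaces of \<open>P\<close>,
  so both have half the dimension. With a linear isomorphism \<open>f\<close> from
  \<open>real^'n\<close> onto the \<open>+1\<close> eigenspace, the map
  \<open>(a, c) \<mapsto> f a + F (f c)\<close> normalises \<open>F\<close> and \<open>P\<close>
  together.\<close>

lemma biparacomplex_normal_form:
  fixes F P :: "(real^'n) \<times> (real^'n) \<Rightarrow> (real^'n) \<times> (real^'n)"
  assumes lin: "linear F" "linear P" and F: "\<And>v. F (F v) = v" and P: "\<And>v. P (P v) = v"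
    and anti: "\<And>v. F (P v) = - P (F v)"
  obtains L L' :: "(real^'n) \<times> (real^'n) \<Rightarrow> (real^'n) \<times> (real^'n)" where "linear L" "linear L'"
      "\<And>v. L (L' v) = v" "\<And>v. L' (L v) = v"
    "\<And>a c. F (L (a, c)) = L (c, a)" "\<And>a c. P (L (a, c)) = L (a, - c)"
proof -
  define S where "S = {v. P v = v}"
  define T where "T = {v. P v = - v}"
  have S: "subspace S" and T: "subspace T"
    using lin(2) by (auto simp: S_def T_def subspace_def linear_0 linear_add linear_scale)
  have "F ` S = T"
  proof
    show "F ` S \<subseteq> T"
    proof (rule image_subsetI)
      fix v assume "v \<in> S"
      then have "F v = - P (F v)" using anti[of v] by (simp add: S_def)
      then show "F v \<in> T" by (simp add: T_def) (metis minus_minus)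
    qed
    show "T \<subseteq> F ` S"
    proof
      fix v assume "v \<in> T"
      then have "F v \<in> S" using anti[of v] by (simp add: S_def T_def linear_neg[OF lin(1)])
      then show "v \<in> F ` S" using F[of v] by (metis imageI)
    qed
  qed
  moreover have "inj F" using F by (metis injI)
  ultimately have "dim T = dim S" using dim_image_eq[OF lin(1), of S] by (metis inj_on_subset
      subset_UNIV)
  moreover have "S \<inter> T = {0}"
  proof -
    have "v = 0" if "v = - v" for v :: "(real^'n) \<times> (real^'n)" using that by (simp add:
        eq_neg_iff_add_eq_0 flip: scaleR_2)
    then show ?thesis using linear_0[OF lin(2)] by (force simp: S_def T_def)
  qed
  moreover have "{x + y |x y. x \<in> S \<and> y \<in> T} = UNIV"
  proof -
    have "\<exists>x y. v = x + y \<and> x \<in> S \<and> y \<in> T" for v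
    proof (intro exI conjI)
      show "v = (1/2) *\<^sub>R (v + P v) + (1/2) *\<^sub>R (v - P v)" by (simp flip: scaleR_add_right scaleR_2)
      show "(1/2) *\<^sub>R (v + P v) \<in> S" "(1/2) *\<^sub>R (v - P v) \<in> T"
        by (simp_all add: S_def T_def linear_add[OF lin(2)] linear_diff[OF lin(2)] linear_scale[OF
            lin(2)] P
            add.commute flip: scaleR_minus_right)
    qed
    then show ?thesis by blast
  qed
  \<comment> \<open>\<open>S\<close> and \<open>T\<close> are complementary and have equal
    dimension, so twice \<open>dim S\<close> is twice the cardinality of the index type.\<close>
  ultimately have d: "dim (UNIV :: (real^'n) set) = dim S"
    using dim_sums_Int[OF S T] by (simp add: dim_UNIV)
  obtain f :: "real^'n \<Rightarrow> (real^'n) \<times> (real^'n)" and g where fg: "linear f" "linear g" "f ` UNIV = S"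
    "\<And>x. g (f x) = x" "\<And>y. y \<in> S \<Longrightarrow> f (g y) = y"
  proof (rule isometries_subspaces[OF subspace_UNIV S d])
    fix f :: "real^'n \<Rightarrow> (real^'n) \<times> (real^'n)" and g
    assume "linear f" "linear g" "f ` UNIV = S" "\<And>x. x \<in> UNIV \<Longrightarrow> g (f x) = x" "\<And>y. y \<in> S \<Longrightarrow> f (g y)
        = y"
    then show thesis using that[of f g] by simp
  qed
  have fS: "P (f a) = f a" for a using fg(3) by (auto simp: S_def)
  have PFf: "P (F (f a)) = - F (f a)" for a using anti[of "f a"] fS[of a] by (metis minus_minus)
  define L where "L v = f (fst v) + F (f (snd v))" for v
  \<comment> \<open>The projections onto \<open>S\<close> and \<open>T\<close> are half of
    \<open>v + P v\<close> and of \<open>v - P v\<close>; \<open>F\<close> carries the second back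
    into \<open>S\<close>, where \<open>g\<close> inverts \<open>f\<close>.\<close>
  define L' where "L' v = (g ((1/2) *\<^sub>R (v + P v)), g (F ((1/2) *\<^sub>R (v - P v))))" for v
  have "linear L"
    unfolding L_def
    by (intro linear_compose_add linear_compose[OF _ lin(1), unfolded o_def] linear_compose[OF _
        fg(1), unfolded o_def]
        linear_fst linear_snd)
  moreover have "linear L'"
  proof (rule linearI)
    show "L' (v + w) = L' v + L' w" for v w
      by (simp add: L'_def linear_add[OF lin(1)] linear_add[OF lin(2)] linear_diff[OF lin(1)]
          linear_scale[OF lin(1)]
          linear_add[OF fg(2)] linear_scale[OF fg(2)] linear_diff[OF fg(2)] algebra_simps)
    show "L' (k *\<^sub>R v) = k *\<^sub>R L' v" for k v
      by (simp add: L'_def linear_add[OF lin(1)] linear_diff[OF lin(1)] linear_scale[OF lin(1)]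
          linear_scale[OF lin(2)]
          linear_add[OF fg(2)] linear_scale[OF fg(2)] linear_diff[OF fg(2)] algebra_simps)
  qed
  moreover have "L (L' v) = v" for v
  proof -
    have "(1/2) *\<^sub>R (v + P v) \<in> S" "F ((1/2) *\<^sub>R (v - P v)) \<in> S"
      using anti[of "v - P v"]
      by (simp_all add: S_def linear_add[OF lin(2)] linear_diff[OF lin(2)] linear_diff[OF lin(1)]
          linear_scale[OF lin(2)]
          linear_scale[OF lin(1)] P anti algebra_simps)
    then show ?thesis
      by (simp add: L_def L'_def fg(5) F flip: scaleR_add_right scaleR_2)
  qed
  moreover have "L' (L v) = v" for v
  proof -
    have PL: "P (L v) = f (fst v) - F (f (snd v))"
      by (simp add: L_def linear_add[OF lin(2)] fS PFf)
    have "(1/2) *\<^sub>R (L v + P (L v)) = f (fst v)" "(1/2) *\<^sub>R (L v - P (L v)) = F (f (snd v))"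
      unfolding PL by (simp_all add: L_def flip: scaleR_2)
    then show ?thesis by (simp add: L'_def F fg(4))
  qed
  moreover have "F (L (a, c)) = L (c, a)" for a c
    by (simp add: L_def linear_add[OF lin(1)] F add.commute)
  moreover have "P (L (a, c)) = L (a, - c)" for a c
    by (simp add: L_def linear_add[OF lin(2)] fS PFf linear_neg[OF fg(1)] linear_neg[OF lin(1)])
  ultimately show thesis using that[of L L'] by blast
qed

lemma axis_pair_expand:
  fixes a c :: "real^'n"
  shows "(a, c) = (\<Sum>i\<in>UNIV. (a $ i) *\<^sub>R (axis i 1, 0)) + (\<Sum>i\<in>UNIV. (c $ i) *\<^sub>R (0, axis i 1))"
  using basis_expansion[of a] basis_expansion[of c]
  by (simp add: prod_eq_iff fst_sum snd_sum scalar_mult_eq_scaleR)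

lemma linear_eq_on_axis_pairs:
  fixes f g :: "(real^'n) \<times> (real^'n) \<Rightarrow> 'b::real_vector"
  assumes "linear f" "linear g" "\<And>i. f (axis i 1, 0) = g (axis i 1, 0)" "\<And>i. f (0, axis i 1) = g
      (0, axis i 1)"
  shows "f (a, c) = g (a, c)"
  unfolding axis_pair_expand[of a c]
  by (simp add: linear_add linear_sum linear_scale assms del: add_Pair scaleR_Pair)

locale biparacomplex_manifold = smooth_manifold A
  for A :: "('a::t2_space, (real^'n) \<times> (real^'n)) atlas" +
  fixes F P :: "'a endo"
  assumes biparacomplex: "almost_biparacomplex A F P"
begin

lemma tensor_F: "tensor_field_11 A F" and tensor_P: "tensor_field_11 A P"
  and F_F: "v \<in> tangent_space A p \<Longrightarrow> F p (F p v) = v"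
  and P_P: "v \<in> tangent_space A p \<Longrightarrow> P p (P p v) = v"
  and F_P: "v \<in> tangent_space A p \<Longrightarrow> F p (P p v) = - P p (F p v)"
  using biparacomplex by (auto simp: almost_biparacomplex_def eq_neg_iff_add_eq_0)

lemma partial_x_y_tangent:
  assumes "(U, \<phi>) \<in> A" "q \<in> U"
  shows "partial_x A U \<phi> i q \<in> tangent_space A q" "partial_y A U \<phi> i q \<in> tangent_space A q"
  unfolding partial_x_def partial_y_def by (rule coord_vec_tangent[OF assms])+

lemma coord_vec_pair:
  assumes c: "(U, \<phi>) \<in> A" "q \<in> U"
  shows "coord_vec A U \<phi> (a, b) q =
    (\<Sum>i\<in>UNIV. tscale (a $ i) (partial_x A U \<phi> i q)) + (\<Sum>i\<in>UNIV. tscale (b $ i) (partial_y A U \<phi> i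
        q))"
  unfolding axis_pair_expand[of a b] coord_vec_linear(1)[OF c] coord_vec_sum[OF c finite]
      coord_vec_linear(2)[OF c]
    partial_x_def partial_y_def ..

lemma coord_vec_uminus:
  assumes "(U, \<phi>) \<in> A" "q \<in> U" shows "coord_vec A U \<phi> (- b) q = - coord_vec A U \<phi> b q"
  using coord_vec_linear(3)[OF assms, of 0 b] coord_vec_zero[OF assms] by (simp add: fun_eq_iff)

text \<open>Both sides are linear in the direction, so comparison on the coordinate frame is
  enough.\<close>

lemma tensor_coord_pair:
  assumes c: "(U, \<phi>) \<in> A" "q \<in> U" and K: "tensor_field_11 A K" and k: "linear k"
    and eq: "\<And>i. K q (partial_x A U \<phi> i q) = coord_vec A U \<phi> (k (axis i 1, 0)) q"
      "\<And>i. K q (partial_y A U \<phi> i q) = coord_vec A U \<phi> (k (0, axis i 1)) q"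
  shows "K q (coord_vec A U \<phi> (a, b) q) = coord_vec A U \<phi> (k (a, b)) q"
proof -
  have x: "\<phi> q \<in> \<phi> ` U" using c by simp
  have "ecomp U \<phi> K (\<phi> q) (a, b) = k (a, b)"
    by (rule linear_eq_on_axis_pairs[OF ecomp_linear[OF c(1) x K] k]; rule ecomp_eqI[OF c(1) x])
      (use eq c in \<open>simp_all add: partial_x_def partial_y_def\<close>)
  then show ?thesis using ecomp_coord[OF c K, of "(a, b)"] by simp
qed

section \<open>Normal charts and adapted frames\<close>

text \<open>Condition (ii) for one chart, stated for all coordinate directions instead of the frame;
  in this form it passes through a linear change of coordinates by mere substitution.\<close>

definition normal_chart :: "'a set \<Rightarrow> ('a \<Rightarrow> (real^'n) \<times> (real^'n)) \<Rightarrow> bool" where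
  "normal_chart U \<phi> \<longleftrightarrow> (\<forall>q\<in>U. \<forall>a c. F q (coord_vec A U \<phi> (a, c) q) = coord_vec A U \<phi> (c, a) q \<and>
     P q (coord_vec A U \<phi> (a, c) q) = coord_vec A U \<phi> (a, - c) q)"

lemma linear_swap: "linear (\<lambda>v. (snd v, fst v))"
  and linear_flip: "linear (\<lambda>v. (fst v, - snd v))"
  by (auto intro!: linearI)

lemma normal_chart_iff:
  assumes c: "(U, \<phi>) \<in> A"
  shows "normal_chart U \<phi> \<longleftrightarrow> (\<forall>q\<in>U. \<forall>i. F q (partial_x A U \<phi> i q) = partial_y A U \<phi> i q \<and>
         F q (partial_y A U \<phi> i q) = partial_x A U \<phi> i q \<and>
         P q (partial_x A U \<phi> i q) = partial_x A U \<phi> i q \<and>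
         P q (partial_y A U \<phi> i q) = - partial_y A U \<phi> i q)" (is "_ = ?R")
proof
  assume "normal_chart U \<phi>"
  moreover have "- partial_y A U \<phi> i q = coord_vec A U \<phi> (0, - axis i 1) q" if "q \<in> U" for i q
    using coord_vec_uminus[OF c that, of "(0, axis i 1)"] by (simp add: partial_y_def)
  ultimately show ?R by (simp add: normal_chart_def partial_x_def partial_y_def)
next
  assume R: ?R
  show "normal_chart U \<phi>"
    unfolding normal_chart_def
  proof (intro ballI allI)
    fix q a b assume q: "q \<in> U"
    have y: "- partial_y A U \<phi> i q = coord_vec A U \<phi> (0, - axis i 1) q" for i
      using coord_vec_uminus[OF c q, of "(0, axis i 1)"] by (simp add: partial_y_def)
    show "F q (coord_vec A U \<phi> (a, b) q) = coord_vec A U \<phi> (b, a) q \<and>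
     P q (coord_vec A U \<phi> (a, b) q) = coord_vec A U \<phi> (a, - b) q"
      using tensor_coord_pair[OF c q tensor_F linear_swap, of a b] tensor_coord_pair[OF c q
          tensor_P linear_flip, of a b]
        R q y by (simp add: partial_x_def[symmetric] partial_y_def[symmetric])
  qed
qed

lemma coord_frame_sum:
  assumes c: "(U, \<phi>) \<in> A" "q \<in> U"
  shows "(\<Sum>k\<in>UNIV. tscale (d k) (coord_frame A U \<phi> q k)) = coord_vec A U \<phi> (\<chi> i. d (Inl i), \<chi> i. d
      (Inr i)) q"
proof -
  have "(\<Sum>k\<in>UNIV. tscale (d k) (coord_frame A U \<phi> q k))
    = (\<Sum>k\<in>UNIV <+> UNIV. tscale (d k) (coord_frame A U \<phi> q k))" by simp
  also have "\<dots> = coord_vec A U \<phi> (\<chi> i. d (Inl i), \<chi> i. d (Inr i)) q"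
    by (subst sum.Plus) (simp_all add: coord_vec_pair[OF c] coord_frame_def)
  finally show ?thesis .
qed

lemma basis_of_coord_frame:
  assumes c: "(U, \<phi>) \<in> A" "q \<in> U"
  shows "basis_of (coord_frame A U \<phi> q) (tangent_space A q)"
  unfolding basis_of_def
proof (intro conjI ballI)
  show "range (coord_frame A U \<phi> q) \<subseteq> tangent_space A q"
    using partial_x_y_tangent[OF c] by (auto simp: coord_frame_def split: sum.split)
  fix v assume "v \<in> tangent_space A q"
  then obtain b where b: "v = coord_vec A U \<phi> b q" by (rule tangent_coord[OF c])
  show "\<exists>!d. v = (\<Sum>k\<in>UNIV. tscale (d k) (coord_frame A U \<phi> q k))"
  proof (rule ex1I)
    show "v = (\<Sum>k\<in>UNIV. tscale (case_sum (($) (fst b)) (($) (snd b)) k) (coord_frame A U \<phi> q k))"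
      unfolding coord_frame_sum[OF c] by (simp add: b)
    fix d assume "v = (\<Sum>k\<in>UNIV. tscale (d k) (coord_frame A U \<phi> q k))"
    then have "b = (\<chi> i. d (Inl i), \<chi> i. d (Inr i))"
      unfolding coord_frame_sum[OF c] b by (rule coord_vec_inject[OF c])
    then show "d = case_sum (($) (fst b)) (($) (snd b))" by (auto simp: fun_eq_iff split: sum.split)
  qed
qed

text \<open>If \<open>F\<close> fixes the \<open>partial_x\<close> and \<open>P\<close> maps them to
  the \<open>partial_y\<close>, anticommutation makes \<open>F\<close> act by \<open>-1\<close> on
  the \<open>partial_y\<close>. Thus \<open>F\<close> is diagonal in the coordinate frame, and the
  basis condition for \<open>T_plus\<close> follows from these equations.\<close>

lemma adapted_chart_iff:
  assumes c: "(U, \<phi>) \<in> A" "q \<in> U"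
  shows "(q, coord_frame A U \<phi> q) \<in> adapted_frames A F P \<longleftrightarrow>
    (\<forall>i. F q (partial_x A U \<phi> i q) = partial_x A U \<phi> i q \<and> partial_y A U \<phi> i q = P q (partial_x A
        U \<phi> i q))" (is "_ = ?R")
proof
  assume "(q, coord_frame A U \<phi> q) \<in> adapted_frames A F P"
  then have "range (\<lambda>i. partial_x A U \<phi> i q) \<subseteq> T_plus A F q" "\<forall>i. partial_y A U \<phi> i q = P q
      (partial_x A U \<phi> i q)"
    by (auto simp: adapted_frames_def coord_frame_def basis_of_def)
  then show ?R by (auto simp: T_plus_def)
next
  assume R: ?R
  note x = partial_x_y_tangent(1)[OF c] and y = partial_x_y_tangent(2)[OF c]
  have "F q (partial_y A U \<phi> i q) = coord_vec A U \<phi> (0, - axis i 1) q" for i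
    using R F_P[OF x, of i] coord_vec_uminus[OF c, of "(0, axis i 1)"] by (simp add: partial_y_def)
  then have Fq: "F q (coord_vec A U \<phi> (a, b) q) = coord_vec A U \<phi> (a, - b) q" for a b
    using tensor_coord_pair[OF c tensor_F linear_flip, of a b] R by (simp add: partial_x_def)
  have "basis_of (\<lambda>i. partial_x A U \<phi> i q) (T_plus A F q)"
    unfolding basis_of_def
  proof (intro conjI ballI)
    show "range (\<lambda>i. partial_x A U \<phi> i q) \<subseteq> T_plus A F q" using R x by (auto simp: T_plus_def)
    fix v assume "v \<in> T_plus A F q"
    then have v: "v \<in> tangent_space A q" "F q v = v" by (auto simp: T_plus_def)
    obtain a b where ab: "v = coord_vec A U \<phi> (a, b) q" using tangent_coord[OF c v(1)] by (metis
        surj_pair)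
    have "(a, - b) = (a, b)" using v(2) Fq[of a b] unfolding ab by (metis coord_vec_inject[OF c])
    then have b: "b = 0" by (simp add: vec_eq_iff)
    have sum: "(\<Sum>k\<in>UNIV. tscale (d k) (partial_x A U \<phi> k q)) = coord_vec A U \<phi> (\<chi> i. d i, 0) q"
        for d
      by (simp add: coord_vec_pair[OF c] tscale_def fun_eq_iff)
    show "\<exists>!d. v = (\<Sum>k\<in>UNIV. tscale (d k) (partial_x A U \<phi> k q))"
    proof (rule ex1I)
      show "v = (\<Sum>k\<in>UNIV. tscale (a $ k) (partial_x A U \<phi> k q))" unfolding sum by (simp add: ab b)
      fix d assume "v = (\<Sum>k\<in>UNIV. tscale (d k) (partial_x A U \<phi> k q))"
      then have "(a, b) = (\<chi> i. d i, 0)" unfolding sum ab by (rule coord_vec_inject[OF c])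
      then show "d = ($) a" by (auto simp: fun_eq_iff)
    qed
  qed
  then show "(q, coord_frame A U \<phi> q) \<in> adapted_frames A F P"
    using R basis_of_coord_frame[OF c] by (simp add: adapted_frames_def frame_bundle_def
        coord_frame_def)
qed

text \<open>Applied twice, \<open>L\<close> is multiplication by \<open>2\<close>. So half of it is
  its inverse, and the same change of coordinates leads from (ii) to (iii) and back.\<close>

lemma rotated_chart:
  assumes c: "(U, \<phi>) \<in> A"
  obtains \<psi> where "(U, \<psi>) \<in> A"
    "\<And>q a b. q \<in> U \<Longrightarrow> coord_vec A U \<psi> (a, b) q = coord_vec A U \<phi> (a + b, a - b) q"
proof -
  define L where "L v = (fst v + snd v, fst v - snd v)" for v :: "(real^'n) \<times> (real^'n)"
  define L' where "L' v = (1/2) *\<^sub>R L v" for v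
  have L: "linear L" unfolding L_def by (auto intro!: linearI simp: algebra_simps)
  have L': "linear L'" unfolding L'_def by (rule linear_compose_scale_right[OF L])
  have LL: "L (L v) = 2 *\<^sub>R v" for v by (simp add: L_def prod_eq_iff scaleR_2)
  have "L (L' v) = v" "L' (L v) = v" for v by (simp_all add: L'_def LL linear_scale[OF L])
  from linear_chart_change[OF c L L' this]
  show thesis using that[of "L' \<circ> \<phi>"] by (simp add: L_def)
qed

text \<open>In a normal chart \<open>F\<close> swaps \<open>partial_x\<close> and
  \<open>partial_y\<close>, hence fixes their sum, while \<open>P\<close> turns the sum into the
  difference. In an adapted chart \<open>F\<close> and \<open>P\<close> have these roles
  interchanged.\<close>

lemma normal_charts_iff_integrable:
  "(\<forall>x. \<exists>(U, \<phi>)\<in>A. x \<in> U \<and> normal_chart U \<phi>) \<longleftrightarrow> integrable_structure A (adapted_frames A F P)"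
proof
  assume N: "\<forall>x. \<exists>(U, \<phi>)\<in>A. x \<in> U \<and> normal_chart U \<phi>"
  show "integrable_structure A (adapted_frames A F P)"
    unfolding integrable_structure_def
  proof
    fix x
    obtain U \<phi> where c: "(U, \<phi>) \<in> A" "x \<in> U" "normal_chart U \<phi>" using N by blast
    obtain \<psi> where \<psi>: "(U, \<psi>) \<in> A"
      "\<And>q a b. q \<in> U \<Longrightarrow> coord_vec A U \<psi> (a, b) q = coord_vec A U \<phi> (a + b, a - b) q"
      by (rule rotated_chart[OF c(1)]) (rule that)
    have "(q, coord_frame A U \<psi> q) \<in> adapted_frames A F P" if "q \<in> U" for q
      unfolding adapted_chart_iff[OF \<psi>(1) that] partial_x_def partial_y_def
      using c(3) that by (simp add: \<psi>(2)[OF that] normal_chart_def)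
    then show "\<exists>(U, \<phi>)\<in>A. x \<in> U \<and> (\<forall>q\<in>U. (q, coord_frame A U \<phi> q) \<in> adapted_frames A F P)"
      using \<psi>(1) c(2) by blast
  qed
next
  assume I: "integrable_structure A (adapted_frames A F P)"
  show "\<forall>x. \<exists>(U, \<phi>)\<in>A. x \<in> U \<and> normal_chart U \<phi>"
  proof
    fix x
    obtain U \<phi> where c: "(U, \<phi>) \<in> A" "x \<in> U" "\<forall>q\<in>U. (q, coord_frame A U \<phi> q) \<in> adapted_frames A F P"
      using I unfolding integrable_structure_def by blast
    obtain \<psi> where \<psi>: "(U, \<psi>) \<in> A"
      "\<And>q a b. q \<in> U \<Longrightarrow> coord_vec A U \<psi> (a, b) q = coord_vec A U \<phi> (a + b, a - b) q"
      by (rule rotated_chart[OF c(1)]) (rule that)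
    have "normal_chart U \<psi>"
      unfolding normal_chart_iff[OF \<psi>(1)]
    proof (intro ballI allI)
      fix q i assume q: "q \<in> U"
      let ?x = "partial_x A U \<phi> i q" and ?y = "partial_y A U \<phi> i q"
      have t: "?x \<in> tangent_space A q" "?y \<in> tangent_space A q" by (rule partial_x_y_tangent[OF
          c(1) q])+
      have R: "F q ?x = ?x" "?y = P q ?x" using c(3) q adapted_chart_iff[OF c(1) q] by blast+
      have FP: "P q ?y = ?x" "F q ?y = - ?y" using R P_P[OF t(1)] F_P[OF t(1)] by simp_all
      have x': "partial_x A U \<psi> i q = ?x + ?y" and y': "partial_y A U \<psi> i q = ?x - ?y"
        using coord_vec_linear(1)[OF c(1) q, of "(axis i 1, 0)" "(0, axis i 1)"]
          coord_vec_linear(3)[OF c(1) q, of "(axis i 1, 0)" "(0, axis i 1)"]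
        by (simp_all add: partial_x_def partial_y_def \<psi>(2)[OF q])
      show "F q (partial_x A U \<psi> i q) = partial_y A U \<psi> i q \<and>
         F q (partial_y A U \<psi> i q) = partial_x A U \<psi> i q \<and>
         P q (partial_x A U \<psi> i q) = partial_x A U \<psi> i q \<and>
         P q (partial_y A U \<psi> i q) = - partial_y A U \<psi> i q"
        unfolding x' y' tensor_add[OF tensor_F t] tensor_add[OF tensor_P t] tensor_diff[OF
            tensor_F t]
          tensor_diff[OF tensor_P t] FP R(1) R(2)[symmetric] by (simp add: add.commute)
    qed
    then show "\<exists>(U, \<phi>)\<in>A. x \<in> U \<and> normal_chart U \<phi>" using \<psi>(1) c(2) by blast
  qed
qed

end

section \<open>The canonical connection: flatness and normal charts\<close>

locale canonical_biparacomplex = biparacomplex_manifold A F P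
  for A :: "('a::t2_space, (real^'n) \<times> (real^'n)) atlas" and F P :: "'a endo" +
  fixes nabla :: "'a connection"
  assumes canonical: "canonical_connection A F P nabla"
begin

sublocale smooth_connection A nabla
  by unfold_locales (use canonical in \<open>simp add: canonical_connection_def\<close>)

lemma parallel_F: "parallel_endo A nabla F" and parallel_P: "parallel_endo A nabla P"
  using canonical by (simp_all add: canonical_connection_def)

text \<open>In the flat chart both tensors keep the matrices they have at \<open>p\<close>. The
  problem is thereby reduced to linear algebra at a single point: the coordinate change that
  normalises these two matrices works on all of \<open>V\<close>.\<close>

lemma flat_imp_normal_chart:
  assumes T: "\<And>X Y. X \<in> vector_fields A \<Longrightarrow> Y \<in> vector_fields A \<Longrightarrow> torsion nabla X Y = 0"
    and R: "\<And>X Y Z. X \<in> vector_fields A \<Longrightarrow> Y \<in> vector_fields A \<Longrightarrow> Z \<in> vector_fields A \<Longrightarrow>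
      curvature nabla X Y Z = 0"
  shows "\<exists>(U, \<phi>)\<in>A. p \<in> U \<and> normal_chart U \<phi>"
proof -
  obtain U \<phi> where c: "(U, \<phi>) \<in> A" "p \<in> U" using chart_at by blast
  obtain V \<psi> where V: "(V, \<psi>) \<in> A" "p \<in> V"
    and const: "\<And>F q b. tensor_field_11 A F \<Longrightarrow> parallel_endo A nabla F \<Longrightarrow> q \<in> V \<Longrightarrow>
      F q (coord_vec A V \<psi> b q) = coord_vec A V \<psi> (ecomp U \<phi> F (\<phi> p) b) q"
    by (rule flat_chart[OF c T R], assumption+) (rule that)
  let ?F = "ecomp U \<phi> F (\<phi> p)" and ?P = "ecomp U \<phi> P (\<phi> p)"
  have x: "\<phi> p \<in> \<phi> ` U" using c by simp
  have lin: "linear ?F" "linear ?P" by (rule ecomp_linear[OF c(1) x tensor_F] ecomp_linear[OF c(1)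
      x tensor_P])+
  note t = coord_vec_tangent[OF c]
  have F: "?F (?F v) = v" and P: "?P (?P v) = v" and FP: "?F (?P v) = - ?P (?F v)" for v
    using F_F[OF t, of v] P_P[OF t, of v] F_P[OF t, of v]
    by (simp_all add: ecomp_coord[OF c tensor_F] ecomp_coord[OF c tensor_P] coord_vec_uminus[OF c,
        symmetric])
      (auto dest: coord_vec_inject[OF c])
  obtain L L' :: "(real^'n) \<times> (real^'n) \<Rightarrow> (real^'n) \<times> (real^'n)" where L: "linear L" "linear L'"
      "\<And>v. L (L' v) = v" "\<And>v. L' (L v) = v"
    "\<And>a c. ?F (L (a, c)) = L (c, a)" "\<And>a c. ?P (L (a, c)) = L (a, - c)"
    by (rule biparacomplex_normal_form[OF lin F P FP]) (rule that)
  have ch: "(V, L' \<circ> \<psi>) \<in> A" and cv: "\<And>q b. q \<in> V \<Longrightarrow> coord_vec A V (L' \<circ> \<psi>) b q = coord_vec A V \<psi>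
      (L b) q"
    using linear_chart_change[OF V(1) L(1-4)] by blast+
  have "normal_chart V (L' \<circ> \<psi>)"
    unfolding normal_chart_def
    by (simp add: cv const[OF tensor_F parallel_F] const[OF tensor_P parallel_P] L)
  then show ?thesis using ch V(2) by blast
qed

lemma christoffel_zero:
  assumes c: "(U, \<phi>) \<in> A" and N: "normal_chart U \<phi>"
    and G: "christoffel_on U \<phi> B \<Gamma>" and "open B" and x: "x \<in> B"
  shows "\<Gamma> x h k = 0"
proof -
  note B = christoffel_onD(1)[OF G] and bil = christoffel_onD(2)[OF G] and formula =
      nabla_coord[OF G]
  define F0 where "F0 v = (snd v, fst v)" for v :: "(real^'n) \<times> (real^'n)"
  define P0 where "P0 v = (fst v, - snd v)" for v :: "(real^'n) \<times> (real^'n)"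
  have lin: "linear F0" "linear P0" unfolding F0_def P0_def by (rule linear_swap linear_flip)+
  have ec: "ecomp U \<phi> F y = F0" "ecomp U \<phi> P y = P0" if y: "y \<in> \<phi> ` U" for y
    using N chart_point[OF c y] by (auto simp: fun_eq_iff normal_chart_def F0_def P0_def intro!:
        ecomp_eqI[OF c y])
  have xU: "x \<in> \<phi> ` U" using x B by blast
  have const: "frechet_derivative (\<lambda>y. ecomp U \<phi> F y k) (at x) h = 0" "frechet_derivative (\<lambda>y.
      ecomp U \<phi> P y k) (at x) h = 0" for h k
  proof -
    have "ecomp U \<phi> F y k = F0 k" "ecomp U \<phi> P y k = P0 k" if "y \<in> B" for y
      using ec[OF subsetD[OF B that]] by simp_all
    then show "frechet_derivative (\<lambda>y. ecomp U \<phi> F y k) (at x) h = 0" "frechet_derivative (\<lambda>y.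
        ecomp U \<phi> P y k) (at x) h = 0"
      using frechet_derivative_cong_open(2)[OF \<open>open B\<close> x, of "\<lambda>y. ecomp U \<phi> F y k" "\<lambda>_. F0 k"]
        frechet_derivative_cong_open(2)[OF \<open>open B\<close> x, of "\<lambda>y. ecomp U \<phi> P y k" "\<lambda>_. P0 k"] by
            simp_all
  qed
  have "frechet_derivative (\<lambda>y. ecomp U \<phi> F y k) (at x) h = ecomp U \<phi> F x (\<Gamma> x h k) - \<Gamma> x h (ecomp
      U \<phi> F x k)"
    "frechet_derivative (\<lambda>y. ecomp U \<phi> P y k) (at x) h = ecomp U \<phi> P x (\<Gamma> x h k) - \<Gamma> x h (ecomp U
        \<phi> P x k)" for h k
    by (rule parallel_endo_coord[OF c _ _ G \<open>open B\<close> x];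
        rule tensor_F tensor_P parallel_F parallel_P)+
  then have comm: "\<Gamma> x h (F0 k) = F0 (\<Gamma> x h k)" "\<Gamma> x h (P0 k) = P0 (\<Gamma> x h k)" for h k
    by (simp_all add: const ec[OF xU])
  have zero_self: "v = 0" if "v = - v" for v :: "(real^'n) \<times> (real^'n)"
    using that by (simp add: eq_neg_iff_add_eq_0 flip: scaleR_2)
  have pm: "\<Gamma> x a b = \<Gamma> x b a" if a: "F0 a = a" and b: "F0 b = - b" for a b
  proof -
    obtain E where E: "\<And>d. E d \<in> vector_fields A" "\<And>d y. y \<in> B \<Longrightarrow> vcomp U \<phi> (E d) y = d"
      by (rule constant_fields[OF c G]) (rule that)
    \<comment> \<open>The torsion condition speaks of fields that lie in the distributions
      everywhere, whereas \<open>E a\<close> and \<open>E b\<close> have the eigenvector components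
      only on \<open>B\<close>. Adding or subtracting the image under \<open>F\<close> forces the
      condition globally; on \<open>B\<close> it just doubles the components, whence the factor
      \<open>4\<close> below.\<close>
    define X' where "X' = E a + tapply F (E a)"
    define Y' where "Y' = E b - tapply F (E b)"
    have vf: "X' \<in> vector_fields A" "Y' \<in> vector_fields A"
      unfolding X'_def Y'_def by (intro vf_add vf_diff tensor_vf[OF tensor_F] E)+
    have "X' q \<in> T_plus A F q" "Y' q \<in> T_minus A F q" for q
    proof -
      have X'q: "X' q = E a q + F q (E a q)" and Y'q: "Y' q = E b q - F q (E b q)"
        by (simp_all add: X'_def Y'_def tapply_def fun_eq_iff)
      note tX = vf_tangent[OF E(1)[of a], of q] and tY = vf_tangent[OF E(1)[of b], of q]
      have "F q (X' q) = X' q" "F q (Y' q) = - Y' q"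
        unfolding X'q Y'q tensor_add[OF tensor_F tX tensor_tangent[OF tensor_F tX]]
          tensor_diff[OF tensor_F tY tensor_tangent[OF tensor_F tY]] F_F[OF tX] F_F[OF tY]
        by (simp_all add: add.commute)
      then show "X' q \<in> T_plus A F q" "Y' q \<in> T_minus A F q"
        using vf_tangent[OF vf(1)] vf_tangent[OF vf(2)] by (simp_all add: T_plus_def T_minus_def)
    qed
    then have tor: "torsion nabla X' Y' = 0"
      using canonical vf unfolding canonical_connection_def by blast
    have comp: "vcomp U \<phi> X' y = 2 *\<^sub>R a" "vcomp U \<phi> Y' y = 2 *\<^sub>R b" if y: "y \<in> B" for y
    proof -
      have yU: "y \<in> \<phi> ` U" using y B by blast
      show "vcomp U \<phi> X' y = 2 *\<^sub>R a" "vcomp U \<phi> Y' y = 2 *\<^sub>R b"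
        unfolding X'_def Y'_def
        by (simp_all add: vcomp_add[OF c yU] vcomp_diff[OF c yU] E(1) tensor_vf[OF tensor_F]
            vcomp_tapply[OF c yU]
            E(2)[OF y] ec[OF yU] a b scaleR_2)
    qed
    have d: "frechet_derivative (vcomp U \<phi> X') (at x) h = 0" "frechet_derivative (vcomp U \<phi> Y')
        (at x) h = 0" for h
      using frechet_derivative_cong_open(2)[OF \<open>open B\<close> x, of "vcomp U \<phi> X'" "\<lambda>_. 2 *\<^sub>R a"]
        frechet_derivative_cong_open(2)[OF \<open>open B\<close> x, of "vcomp U \<phi> Y'" "\<lambda>_. 2 *\<^sub>R b"] comp by
            simp_all
    have "vcomp U \<phi> (torsion nabla X' Y') x = \<Gamma> x (2 *\<^sub>R a) (2 *\<^sub>R b) - \<Gamma> x (2 *\<^sub>R b) (2 *\<^sub>R a)"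
      unfolding torsion_def
      by (simp add: vcomp_diff[OF c xU] vf_diff nabla_vf vf vf_lie_bracket formula[OF vf x]
          formula[OF vf(2,1) x]
          vcomp_lie_bracket[OF c xU vf] comp[OF x] d)
    then have "4 *\<^sub>R (\<Gamma> x a b - \<Gamma> x b a) = 0"
      unfolding tor vcomp_zero[OF c xU] by (simp add: bilinear_lmul[OF bil] bilinear_rmul[OF bil]
          algebra_simps)
    then show ?thesis by simp
  qed
  have mixed: "\<Gamma> x a b = 0" "\<Gamma> x b a = 0" if a: "F0 a = a" and b: "F0 b = - b" for a b
  proof -
    have "- \<Gamma> x a b = F0 (\<Gamma> x a b)" using comm(1)[of a b] b by (simp add: bilinear_rneg[OF bil])
    moreover have "\<Gamma> x b a = F0 (\<Gamma> x b a)" using comm(1)[of b a] a by simp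
    ultimately show "\<Gamma> x a b = 0" "\<Gamma> x b a = 0" using pm[OF a b] zero_self by metis+
  qed
  have P0P0: "P0 (P0 v) = v" and F0P0: "F0 (P0 v) = - P0 (F0 v)" for v by (simp_all add: P0_def
      F0_def)
  \<comment> \<open>\<open>a'\<close> is \<open>P0\<close> applied to \<open>P0 a'\<close>, which
    lies in the other eigenspace of \<open>F0\<close>. Moving the outer \<open>P0\<close> past
    \<open>\<Gamma>\<close> leaves a mixed term; \<open>minus\<close> is treated in the same
    way.\<close>
  have plus: "\<Gamma> x a a' = 0" if "F0 a = a" "F0 a' = a'" for a a'
    using mixed(1)[OF that(1), of "P0 a'"] comm(2)[of a "P0 a'"] that F0P0[of a'] linear_0[OF
        lin(2)] by (simp add: P0P0)
  have minus: "\<Gamma> x b b' = 0" if "F0 b = - b" "F0 b' = - b'" for b b'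
    using mixed(2)[OF _ that(1), of "P0 b'"] comm(2)[of b "P0 b'"] that F0P0[of b'] linear_0[OF
        lin(2)]
    by (simp add: P0P0 linear_neg[OF lin(2)])
  have split: "\<exists>a b. v = a + b \<and> F0 a = a \<and> F0 b = - b" for v
    by (rule exI[of _ "(1/2) *\<^sub>R (v + F0 v)"], rule exI[of _ "(1/2) *\<^sub>R (v - F0 v)"])
      (simp add: F0_def prod_eq_iff algebra_simps flip: scaleR_add_left)
  obtain a b where h: "h = a + b" "F0 a = a" "F0 b = - b" using split by blast
  obtain a' b' where k: "k = a' + b'" "F0 a' = a'" "F0 b' = - b'" using split by blast
  show ?thesis
    by (simp add: h(1) k(1) bilinear_ladd[OF bil] bilinear_radd[OF bil] plus[OF h(2) k(2)]
        minus[OF h(3) k(3)]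
        mixed(1)[OF h(2) k(3)] mixed(2)[OF k(2) h(3)])
qed

text \<open>With vanishing Christoffel symbols \<open>nabla X Y\<close> differentiates the
  components of \<open>Y\<close> along \<open>X\<close>. The torsion is then the coordinate
  expression of the bracket minus itself, and the curvature vanishes by the symmetry of second
  derivatives.\<close>

lemma normal_charts_imp_flat:
  assumes N: "\<And>p. \<exists>(U, \<phi>)\<in>A. p \<in> U \<and> normal_chart U \<phi>"
    and X: "X \<in> vector_fields A" and Y: "Y \<in> vector_fields A"
  shows "torsion nabla X Y = 0" and "Z \<in> vector_fields A \<Longrightarrow> curvature nabla X Y Z = 0"
proof -
  have "torsion nabla X Y p = 0 \<and> (Z \<in> vector_fields A \<longrightarrow> curvature nabla X Y Z p = 0)" for p
  proof -
    obtain U \<phi> where c: "(U, \<phi>) \<in> A" "p \<in> U" and n: "normal_chart U \<phi>" using N by blast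
    obtain r \<Gamma> where r: "r > 0" and G: "christoffel_on U \<phi> (ball (\<phi> p) r) \<Gamma>"
      by (rule christoffel_symbols[OF c])
    let ?B = "ball (\<phi> p) r" and ?c = "vcomp U \<phi>"
    have "\<Gamma> x h k = 0" if "x \<in> ?B" for x h k
      by (rule christoffel_zero[OF c(1) n G open_ball that])
    then have nab: "?c (nabla X Y) x = frechet_derivative (?c Y) (at x) (?c X x)"
      if "X \<in> vector_fields A" "Y \<in> vector_fields A" "x \<in> ?B" for X Y x
      using nabla_coord[OF G that] that(3) by simp
    have pB: "\<phi> p \<in> ?B" using r by simp
    have pU: "\<phi> p \<in> \<phi> ` U" using c by simp
    have o: "open (\<phi> ` U)" by (rule chart_open_image[OF c(1)])
    have zeroI: "W p = 0" if W: "W \<in> vector_fields A" "?c W (\<phi> p) = 0" for W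
      using vcomp_coord[OF c(1) pU W(1)] c by (simp add: W(2) coord_vec_zero)
    have "torsion nabla X Y p = 0"
    proof (rule zeroI)
      show "torsion nabla X Y \<in> vector_fields A"
        unfolding torsion_def by (intro vf_diff nabla_vf vf_lie_bracket X Y)
      show "?c (torsion nabla X Y) (\<phi> p) = 0"
        unfolding torsion_def
        by (simp add: vcomp_diff[OF c(1) pU] vf_diff nabla_vf vf_lie_bracket X Y nab[OF X Y pB]
            nab[OF Y X pB]
            vcomp_lie_bracket[OF c(1) pU X Y])
    qed
    moreover have "curvature nabla X Y Z p = 0" if Z: "Z \<in> vector_fields A"
    proof (rule zeroI)
      show "curvature nabla X Y Z \<in> vector_fields A"
        unfolding curvature_def by (intro vf_diff nabla_vf vf_lie_bracket X Y Z)
      have sZ: "smooth_on (\<phi> ` U) (?c Z)" by (rule vcomp_smooth[OF c(1) Z])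
      \<comment> \<open>The first summand is symmetric in \<open>X\<close> and \<open>Y\<close>. The
        second, antisymmetrised, is the derivative of \<open>Z\<close> along the bracket, which the
        last term of the curvature removes.\<close>
      have nn: "?c (nabla X (nabla Y Z)) (\<phi> p)
        = frechet_derivative (\<lambda>y. frechet_derivative (?c Z) (at y) (?c Y (\<phi> p))) (at (\<phi> p)) (?c X
            (\<phi> p))
          + frechet_derivative (?c Z) (at (\<phi> p)) (frechet_derivative (?c Y) (at (\<phi> p)) (?c X (\<phi>
              p)))"
        if X: "X \<in> vector_fields A" and Y: "Y \<in> vector_fields A" for X Y
        using nab[OF X nabla_vf[OF Y Z] pB] has_derivative_deriv_apply[OF o pU sZ vcomp_smooth[OF
            c(1) Y]]
          frechet_derivative_cong_open(2)[OF open_ball pB, of "?c (nabla Y Z)" "\<lambda>y.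
              frechet_derivative (?c Z) (at y) (?c Y y)"]
          nab[OF Y Z] by simp
      have "frechet_derivative (?c Z) (at (\<phi> p)) (v - w)
        = frechet_derivative (?c Z) (at (\<phi> p)) v - frechet_derivative (?c Z) (at (\<phi> p)) w" for v w
        by (rule linear_diff[OF bounded_linear.linear[OF smooth_on_linear_derivative[OF sZ pU]]])
      then show "?c (curvature nabla X Y Z) (\<phi> p) = 0"
        unfolding curvature_def
        using mixed_derivatives[OF o pU sZ, of "?c Y (\<phi> p)" "?c X (\<phi> p)"]
        by (simp add: vcomp_diff[OF c(1) pU] vf_diff nabla_vf vf_lie_bracket X Y Z nn[OF X Y]
            nn[OF Y X]
            nab[OF vf_lie_bracket[OF X Y] Z pB] vcomp_lie_bracket[OF c(1) pU X Y])
    qed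
    ultimately show ?thesis by blast
  qed
  then show "torsion nabla X Y = 0" and "Z \<in> vector_fields A \<Longrightarrow> curvature nabla X Y Z = 0"
    by (auto simp: fun_eq_iff)
qed

end

theorem theorem7:
  fixes A :: "('a::{t2_space, second_countable_topology}, (real^'n) \<times> (real^'n)) atlas"
    and F P :: "'a endo"
    and nabla :: "'a connection"
  assumes "smooth_structure A"
    and "almost_biparacomplex A F P"
    and "canonical_connection A F P nabla"
  defines "cond_i \<equiv>
      (\<forall>X\<in>vector_fields A. \<forall>Y\<in>vector_fields A. torsion nabla X Y = 0) \<and>
      (\<forall>X\<in>vector_fields A. \<forall>Y\<in>vector_fields A. \<forall>Z\<in>vector_fields A. curvature nabla X Y Z = 0)"
    and "cond_ii \<equiv>
      (\<forall>x. \<exists>(U, \<phi>)\<in>A. x \<in> U \<and> (\<forall>q\<in>U. \<forall>i.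
         F q (partial_x A U \<phi> i q) = partial_y A U \<phi> i q \<and>
         F q (partial_y A U \<phi> i q) = partial_x A U \<phi> i q \<and>
         P q (partial_x A U \<phi> i q) = partial_x A U \<phi> i q \<and>
         P q (partial_y A U \<phi> i q) = - partial_y A U \<phi> i q))"
    and "cond_iii \<equiv> integrable_structure A (adapted_frames A F P)"
  shows "(cond_i \<longleftrightarrow> cond_ii) \<and> (cond_ii \<longleftrightarrow> cond_iii)"
proof -
  interpret canonical_biparacomplex A F P nabla
    by unfold_locales (rule assms)+
  have ii: "cond_ii \<longleftrightarrow> (\<forall>x. \<exists>(U, \<phi>)\<in>A. x \<in> U \<and> normal_chart U \<phi>)"
    unfolding cond_ii_def by (intro iff_allI bex_cong refl) (auto simp: normal_chart_iff)
  have "cond_ii \<longleftrightarrow> cond_iii"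
    unfolding ii cond_iii_def by (rule normal_charts_iff_integrable)
  moreover have "cond_ii" if cond_i
    unfolding ii by (rule allI, rule flat_imp_normal_chart) (use that in \<open>simp_all add: cond_i_def\<close>)
  moreover have "cond_i" if cond_ii
  proof -
    have "\<exists>(U, \<phi>)\<in>A. p \<in> U \<and> normal_chart U \<phi>" for p using that unfolding ii by (rule spec)
    from normal_charts_imp_flat[OF this] show ?thesis by (simp add: cond_i_def)
  qed
  ultimately show ?thesis by blast
qed

end
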